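(* Let $n\ge 1$ be an integer, let $X_1,\ldots,X_n$ be independent nonnegative real-valued random variables with $\mathbb{E}X_i\le 1$ for every $i$, and put $S=\sum_{i=1}^n X_i$. For $\delta>0$, set $$b_{n,\delta}=\begin{cases}\displaystyle \delta\left(\frac{n}{n+\delta}\right)^n, & 0<\delta<1,\\[0.8em] \displaystyle \left(1-\frac{1}{n+\delta}\right)^n, & \delta\ge 1.\end{cases}$$ Then for every $\delta>0$, $$\mathbb{P}\left(S<\mathbb{E}S+\delta\right)\ge b_{n,\delta}.$$ Moreover, for every integer $n\ge 1$ and every real $\delta\ge 1$ the bound is optimal: for that $n$ and $\delta$, the constant $b_{n,\delta}$ cannot be replaced by any larger constant in the inequality holding for all independent nonnegative random variables $X_1,\ldots,X_n$ with $\mathbb{E}X_i\le 1$.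
   Context: $\mathbb{P}$ and $\mathbb{E}$ denote probability and expectation. The random variables $X_1,\ldots,X_n$ are not assumed identically distributed. *)

theory Defs
  imports "HOL-Probability.Probability"
begin

definition feige_bound :: "nat \<Rightarrow> real \<Rightarrow> real" where
  "feige_bound n \<delta> =
     (if \<delta> < 1 then \<delta> * (real n / (real n + \<delta>)) ^ n
      else (1 - 1 / (real n + \<delta>)) ^ n)"

text \<open>
  Integrability is stated explicitly because the Bochner integral of a non-integrable function
  is 0, so that the bound on the integral alone would also admit variables of infinite mean.
  Measurability is part of \<open>indep_vars\<close>.
\<close>

definition admissible :: "nat \<Rightarrow> 'a measure \<Rightarrow> (nat \<Rightarrow> 'a \<Rightarrow> real) \<Rightarrow> bool" where
  "admissible n M X \<longleftrightarrow>
     prob_space M \<and>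
     prob_space.indep_vars M (\<lambda>_. borel) X {1..n} \<and>
     (\<forall>i\<in>{1..n}. (\<forall>\<omega>\<in>space M. 0 \<le> X i \<omega>) \<and>
        integrable M (X i) \<and> (\<integral>\<omega>. X i \<omega> \<partial>M) \<le> 1)"

definition prob_sum_less :: "nat \<Rightarrow> 'a measure \<Rightarrow> (nat \<Rightarrow> 'a \<Rightarrow> real) \<Rightarrow> real \<Rightarrow> real" where
  "prob_sum_less n M X \<delta> =
     measure M {\<omega> \<in> space M.
       (\<Sum>i=1..n. X i \<omega>) < (\<integral>\<omega>'. (\<Sum>i=1..n. X i \<omega>') \<partial>M) + \<delta>}"

end

theory Submission
  imports Defs
begin

text \<open>
  Write \<open>S\<close> for the sum, \<open>\<lambda> = E S + d\<close> for the threshold and \<open>W = P(S < \<lambda>)\<close>.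

  As a function of the law of a single summand, the others being fixed, \<open>W\<close> is the expectation
  of a bounded function of that summand. If such an expectation is at least \<open>b\<close> for every law
  on two points with the same mean, a supporting line shows that it is at least \<open>b\<close> for the
  given law. So each \<open>X\<^sub>i\<close> may be assumed to take two values, and after subtraction of the
  smaller one to take the values \<open>0\<close> and \<open>L\<^sub>i\<close> and to have a mean \<open>c\<^sub>i \<le> 1\<close>
  (\<open>two_point_reduction\<close>).

  For such variables the lower bound is proved in the form \<open>W \<ge> m (1 - m / (e + d))\<^sup>e\<close> with
  \<open>m = min 1 d\<close>, for every real \<open>e > 1\<close> that satisfies \<open>Var S \<le> e (e + d - 1)\<close>; for
  \<open>e = n\<close> this is the required bound, and variables that make the variance of \<open>S\<close> larger are
  removed beforehand (\<open>two_point_sum_tail_bound_card\<close>). The induction is on the number of variables. A variable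
  with a large \<open>L\<^sub>j\<close> is conditioned to be \<open>0\<close>; this increases the slack \<open>d\<close> by \<open>c\<^sub>j\<close>, and
  \<open>e\<close> can be decreased by \<open>c\<^sub>j\<close> (\<open>W_ge_remove\<close>). If no variable is large, the law is tilted:
  for \<open>0 \<le> p \<le> m / (e + d)\<close> the probability of the value \<open>0\<close> of \<open>X\<^sub>i\<close> is multiplied by
  \<open>(1 - p) powr - c\<^sub>i\<close>. Let \<open>f(p)\<close> be the probability of \<open>S < \<lambda>\<close> under the tilted law and
  \<open>u(p)\<close> the expectation of \<open>(1 - p) max 0 (S - \<lambda>)\<close>. Three facts about the tilting carry the
  proof.

  \<^item> \<open>- u'(p) \<ge> (1 - f(p)) (Var S - d - \<dots>)\<close> (\<open>u_derivative_bound\<close>), a correlation inequality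
    between the monotone functions involved; the dots stand for a loss that vanishes when all
    means \<open>c\<^sub>i\<close> are \<open>1\<close>.

  \<^item> \<open>f\<close> cannot grow fast, because the change of one variable matters only if the other ones have
    a sum close to \<open>\<lambda>\<close>, where the density of the tilted law is small (\<open>f_le\<close>).

  \<^item> \<open>x = E[E S - S | S < \<lambda>]\<close> is at most \<open>e\<close> (\<open>N_over_W_le\<close>), by a second moment argument.

  Since \<open>u(0) = (x + d) W - d\<close> and \<open>u \<ge> 0\<close>, integration of the first fact, with the bound on
  \<open>f\<close> from the second one, yields an inequality for \<open>W\<close> that contradicts
  \<open>W < m (1 - m / (e + d))\<^sup>e\<close>. If some means are smaller than \<open>1\<close>, the loss is compensated by an
  improvement of the second moment argument: the induction hypothesis for \<open>S - X\<^sub>i\<close>, whose slack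
  is \<open>d + c\<^sub>i\<close>, shows that \<open>X\<^sub>i\<close> and the event \<open>S < \<lambda>\<close> are substantially correlated
  (\<open>D_le\<close>). That the gain exceeds the loss is an elementary inequality in \<open>d\<close>, \<open>e\<close> and
  \<open>e - x\<close> (\<open>final_inequality\<close>).

  The bound is attained for \<open>d \<ge> 1\<close> by independent variables with the values \<open>0\<close> and \<open>n + d\<close>
  and mean \<open>1\<close>, for which \<open>S < n + d\<close> means that all of them vanish.
\<close>

section \<open>Expectations over independent two-point variables\<close>

text \<open>
  The expectation of \<open>g (\<Sum>i\<in>I. X\<^sub>i)\<close> for independent \<open>X\<^sub>i\<close> with values \<open>L i\<close> (with
  probability \<open>q i\<close>) and \<open>0\<close>. It is a finite sum over the set \<open>T\<close> of the indices with \<open>X\<^sub>i = L i\<close>,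
  hence smooth in the probabilities, and it is meaningful for any real \<open>q i\<close>.
\<close>

definition texp :: "('i \<Rightarrow> real) \<Rightarrow> ('i \<Rightarrow> real) \<Rightarrow> 'i set \<Rightarrow> (real \<Rightarrow> real) \<Rightarrow> real" where
  "texp q L I g =
     (\<Sum>T\<in>Pow I. (\<Prod>i\<in>T. q i) * (\<Prod>i\<in>I - T. 1 - q i) * g (\<Sum>i\<in>T. L i))"

lemma texp_empty [simp]: "texp q L {} g = g 0"
  by (simp add: texp_def)

lemma texp_insert:
  assumes "finite I" "i \<notin> I"
  shows "texp q L (insert i I) g =
    q i * texp q L I (\<lambda>s. g (s + L i)) + (1 - q i) * texp q L I g"
proof -
  have disj: "Pow I \<inter> insert i ` Pow I = {}"
    using assms by auto
  have inj: "inj_on (insert i) (Pow I)"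
    using assms(2) by (auto simp: inj_on_def)
  have 1: "(\<Sum>T\<in>insert i ` Pow I. (\<Prod>i\<in>T. q i) * (\<Prod>j\<in>insert i I - T. 1 - q j) * g (\<Sum>i\<in>T. L i))
      = q i * texp q L I (\<lambda>s. g (s + L i))"
    unfolding sum.reindex[OF inj] texp_def sum_distrib_left o_def
  proof (rule sum.cong[OF refl])
    fix T assume T: "T \<in> Pow I"
    then have "finite T" "i \<notin> T" "insert i I - insert i T = I - T"
      using assms by (auto intro: finite_subset)
    then show "(\<Prod>i\<in>insert i T. q i) * (\<Prod>j\<in>insert i I - insert i T. 1 - q j) * g (sum L (insert i T))
        = q i * ((\<Prod>i\<in>T. q i) * (\<Prod>i\<in>I - T. 1 - q i) * g (sum L T + L i))"
      by (simp add: add.commute)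
  qed
  have 2: "(\<Sum>T\<in>Pow I. (\<Prod>i\<in>T. q i) * (\<Prod>j\<in>insert i I - T. 1 - q j) * g (\<Sum>i\<in>T. L i))
      = (1 - q i) * texp q L I g"
    unfolding texp_def sum_distrib_left
  proof (rule sum.cong[OF refl])
    fix T assume T: "T \<in> Pow I"
    then have "insert i I - T = insert i (I - T)" "i \<notin> I - T" "finite (I - T)"
      using assms by auto
    then show "(\<Prod>i\<in>T. q i) * (\<Prod>j\<in>insert i I - T. 1 - q j) * g (sum L T)
        = (1 - q i) * ((\<Prod>i\<in>T. q i) * (\<Prod>i\<in>I - T. 1 - q i) * g (sum L T))"
      by simp
  qed
  show ?thesis
    unfolding texp_def[of q L "insert i I"] Pow_insert
    using assms disj 1 2 by (subst sum.union_disjoint) auto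
qed

lemma texp_remove:
  assumes "finite I" "i \<in> I"
  shows "texp q L I g =
    q i * texp q L (I - {i}) (\<lambda>s. g (s + L i)) + (1 - q i) * texp q L (I - {i}) g"
  using texp_insert[of "I - {i}" i q L g] assms by (simp add: insert_absorb)

lemma texp_add: "texp q L I (\<lambda>s. g s + h s) = texp q L I g + texp q L I h"
  by (simp add: texp_def algebra_simps sum.distrib)

lemma texp_diff: "texp q L I (\<lambda>s. g s - h s) = texp q L I g - texp q L I h"
  by (simp add: texp_def algebra_simps sum_subtractf)

lemma texp_cmult: "texp q L I (\<lambda>s. a * g s) = a * texp q L I g"
  by (simp add: texp_def sum_distrib_left algebra_simps)

lemma texp_const:
  assumes "finite I"
  shows "texp q L I (\<lambda>s. a) = a"
  using assms by (induction I) (simp_all add: texp_insert algebra_simps)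

lemma texp_mono:
  assumes "finite I" "\<And>i. i \<in> I \<Longrightarrow> 0 \<le> q i" "\<And>i. i \<in> I \<Longrightarrow> q i \<le> 1" "\<And>s. g s \<le> h s"
  shows "texp q L I g \<le> texp q L I h"
  unfolding texp_def using assms
  by (intro sum_mono mult_left_mono mult_nonneg_nonneg prod_nonneg) auto

lemma texp_nonneg:
  assumes "finite I" "\<And>i. i \<in> I \<Longrightarrow> 0 \<le> q i" "\<And>i. i \<in> I \<Longrightarrow> q i \<le> 1" "\<And>s. 0 \<le> g s"
  shows "0 \<le> texp q L I g"
  using texp_mono[of I q "\<lambda>_. 0" g L] assms by (simp add: texp_const)

lemma texp_cong:
  assumes "\<And>i. i \<in> I \<Longrightarrow> q i = q' i" "\<And>i. i \<in> I \<Longrightarrow> L i = L' i"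
  shows "texp q L I g = texp q' L' I g"
  unfolding texp_def
proof (rule sum.cong[OF refl])
  fix T assume "T \<in> Pow I"
  then have "(\<Prod>i\<in>T. q i) = (\<Prod>i\<in>T. q' i)" "(\<Prod>i\<in>I - T. 1 - q i) = (\<Prod>i\<in>I - T. 1 - q' i)"
    "sum L T = sum L' T"
    using assms by (auto intro!: prod.cong sum.cong)
  then show "(\<Prod>i\<in>T. q i) * (\<Prod>i\<in>I - T. 1 - q i) * g (sum L T) =
       (\<Prod>i\<in>T. q' i) * (\<Prod>i\<in>I - T. 1 - q' i) * g (sum L' T)"
    by simp
qed

text \<open>
  By linearity \<open>S g(S)\<close> is the sum of the \<open>X\<^sub>i g(S)\<close>, and \<open>X\<^sub>i\<close> contributes only if it has the
  value \<open>L i\<close>.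
\<close>

lemma texp_times_sum:
  assumes "finite I"
  shows "texp q L I (\<lambda>s. s * g s) =
    (\<Sum>i\<in>I. q i * L i * texp q L (I - {i}) (\<lambda>s. g (s + L i)))"
  using assms
proof (induction I arbitrary: g)
  case empty
  then show ?case by simp
next
  case (insert j I)
  have eq: "q i * L i * texp q L (insert j I - {i}) (\<lambda>s. g (s + L i)) =
      q j * (q i * L i * texp q L (I - {i}) (\<lambda>s. g (s + L j + L i))) +
      (1 - q j) * (q i * L i * texp q L (I - {i}) (\<lambda>s. g (s + L i)))" if "i \<in> I" for i
  proof -
    have "insert j I - {i} = insert j (I - {i})" using insert that by auto
    then show ?thesis
      using insert that by (simp add: texp_insert algebra_simps)
  qed
  have "texp q L (insert j I) (\<lambda>s. s * g s) =
     q j * texp q L I (\<lambda>s. s * g (s + L j) + L j * g (s + L j)) + (1 - q j) * texp q L I (\<lambda>s. s * g s)"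
    using insert by (simp add: texp_insert algebra_simps)
  also have "\<dots> = q j * L j * texp q L I (\<lambda>s. g (s + L j)) +
      (q j * texp q L I (\<lambda>s. s * g (s + L j)) + (1 - q j) * texp q L I (\<lambda>s. s * g s))"
    by (simp add: texp_add texp_cmult algebra_simps)
  also have "q j * texp q L I (\<lambda>s. s * g (s + L j)) + (1 - q j) * texp q L I (\<lambda>s. s * g s) =
     (\<Sum>i\<in>I. q i * L i * texp q L (insert j I - {i}) (\<lambda>s. g (s + L i)))"
    unfolding insert.IH[of "\<lambda>s. g (s + L j)"] insert.IH[of g] sum_distrib_left sum.distrib[symmetric]
    using eq by (intro sum.cong refl) (simp add: ac_simps)
  finally show ?case
    using insert by (simp add: algebra_simps)
qed

text \<open>
  The expectation is affine in each probability, with the difference of the two conditional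
  expectations as its slope.
\<close>

lemma texp_has_real_derivative:
  assumes "finite I" "\<And>i. i \<in> I \<Longrightarrow> ((\<lambda>p. r p i) has_real_derivative r' i) (at x)"
  shows "((\<lambda>p. texp (r p) L I g) has_real_derivative
    (\<Sum>i\<in>I. r' i * (texp (r x) L (I - {i}) (\<lambda>s. g (s + L i)) - texp (r x) L (I - {i}) g))) (at x)"
  using assms
proof (induction I arbitrary: g)
  case empty
  then show ?case by simp
next
  case (insert j I)
  let ?D = "\<lambda>I i g. texp (r x) L (I - {i}) (\<lambda>s. g (s + L i)) - texp (r x) L (I - {i}) g"
  have eq: "r' i * ?D (insert j I) i g =
      r x j * (r' i * ?D I i (\<lambda>s. g (s + L j))) + (1 - r x j) * (r' i * ?D I i g)" if "i \<in> I" for i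
  proof -
    have "insert j I - {i} = insert j (I - {i})" using insert that by auto
    then show ?thesis
      using insert that by (simp add: texp_insert algebra_simps)
  qed
  have fe: "(\<lambda>p. texp (r p) L (insert j I) g) =
     (\<lambda>p. r p j * texp (r p) L I (\<lambda>s. g (s + L j)) + (1 - r p j) * texp (r p) L I g)"
    using insert by (simp add: texp_insert)
  have "((\<lambda>p. texp (r p) L (insert j I) g) has_real_derivative
      (r' j * texp (r x) L I (\<lambda>s. g (s + L j)) +
        (\<Sum>i\<in>I. r' i * ?D I i (\<lambda>s. g (s + L j))) * r x j) +
      ((0 - r' j) * texp (r x) L I g + (\<Sum>i\<in>I. r' i * ?D I i g) * (1 - r x j))) (at x)"
    unfolding fe using insert.prems
    by (intro DERIV_add DERIV_mult DERIV_diff DERIV_const insert.IH) auto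
  also have "(r' j * texp (r x) L I (\<lambda>s. g (s + L j)) +
        (\<Sum>i\<in>I. r' i * ?D I i (\<lambda>s. g (s + L j))) * r x j) +
      ((0 - r' j) * texp (r x) L I g + (\<Sum>i\<in>I. r' i * ?D I i g) * (1 - r x j)) =
      r' j * ?D (insert j I) j g + (\<Sum>i\<in>I. r' i * ?D (insert j I) i g)"
  proof -
    have "(\<Sum>i\<in>I. r' i * ?D (insert j I) i g) =
       r x j * (\<Sum>i\<in>I. r' i * ?D I i (\<lambda>s. g (s + L j))) +
       (1 - r x j) * (\<Sum>i\<in>I. r' i * ?D I i g)"
      unfolding sum_distrib_left sum.distrib[symmetric] by (rule sum.cong[OF refl eq])
    moreover have "?D (insert j I) j g = texp (r x) L I (\<lambda>s. g (s + L j)) - texp (r x) L I g"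
      using insert by simp
    moreover have "a * b + c * x + ((0 - a) * f + h * (1 - x)) =
        a * (b - f) + (x * c + (1 - x) * h)" for a b c f h x :: real
      by algebra
    ultimately show ?thesis
      by simp
  qed
  finally show ?case
    using insert by simp
qed

text \<open>
  The density of the law with probabilities \<open>r\<close> with respect to the one with probabilities \<open>q\<close>
  is a product over the variables. The two hypotheses bound the factor of \<open>X\<^sub>i\<close> by
  \<open>v powr (c i - X\<^sub>i)\<close>, so the density is at most \<open>v powr (\<Sum>c - S)\<close>, a function of the sum.
\<close>

lemma texp_change_of_measure:
  assumes "finite I" "0 < v" "\<And>s. 0 \<le> g s"
    "\<And>i. i \<in> I \<Longrightarrow> 0 \<le> q i \<and> q i \<le> 1 \<and> 0 \<le> r i \<and> r i \<le> 1"
    "\<And>i. i \<in> I \<Longrightarrow> r i \<le> q i * v powr (c i - L i)"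
    "\<And>i. i \<in> I \<Longrightarrow> 1 - r i \<le> (1 - q i) * v powr c i"
  shows "texp r L I g \<le> v powr (\<Sum>i\<in>I. c i) * texp q L I (\<lambda>s. v powr (- s) * g s)"
  using assms(1,3-)
proof (induction I arbitrary: g)
  case empty
  then show ?case using assms(2) by simp
next
  case (insert j I)
  let ?V = "v powr (\<Sum>i\<in>I. c i)"
  have *: "texp r L I h \<le> ?V * texp q L I (\<lambda>s. v powr (- s) * h s)" if "\<And>s. 0 \<le> h s" for h
    using insert that by (intro insert.IH) auto
  have nn: "0 \<le> texp q L I (\<lambda>s. v powr (- s) * h s)" if "\<And>s. 0 \<le> h s" for h
    using insert that by (intro texp_nonneg) auto
  have "texp r L (insert j I) g = r j * texp r L I (\<lambda>s. g (s + L j)) + (1 - r j) * texp r L I g"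
    using insert by (simp add: texp_insert)
  also have "\<dots> \<le> (q j * v powr (c j - L j)) * (?V * texp q L I (\<lambda>s. v powr (- s) * g (s + L j))) +
      ((1 - q j) * v powr c j) * (?V * texp q L I (\<lambda>s. v powr (- s) * g s))"
    using insert.prems nn
    by (intro add_mono mult_mono * mult_nonneg_nonneg texp_nonneg insert) auto
  also have "\<dots> = v powr (c j + (\<Sum>i\<in>I. c i)) * (q j * texp q L I (\<lambda>s. v powr (- (s + L j)) * g (s + L j)) +
      (1 - q j) * texp q L I (\<lambda>s. v powr (- s) * g s))"
  proof -
    have "texp q L I (\<lambda>s. v powr (- (s + L j)) * g (s + L j)) =
        texp q L I (\<lambda>s. v powr (- L j) * (v powr (- s) * g (s + L j)))"
      by (simp add: powr_add[symmetric] mult.assoc[symmetric] algebra_simps)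
    also have "\<dots> = v powr (- L j) * texp q L I (\<lambda>s. (v powr (- s) * g (s + L j)))"
      by (rule texp_cmult)
    finally show ?thesis
      using assms(2) by (simp add: algebra_simps powr_add powr_diff powr_minus divide_simps)
  qed
  also have "\<dots> = v powr (\<Sum>i\<in>insert j I. c i) * texp q L (insert j I) (\<lambda>s. v powr (- s) * g s)"
    using insert by (simp add: texp_insert)
  finally show ?case .
qed

section \<open>Elementary inequalities for powers\<close>

text \<open>
  The weighted inequality of arithmetic and geometric means for \<open>1 + x\<close> and \<open>1\<close>.
\<close>

lemma Bernoulli_powr_le:
  fixes x a :: real
  assumes "-1 < x" "0 \<le> a" "a \<le> 1"
  shows "(1 + x) powr a \<le> 1 + a * x"
  using Youngs_inequality_0[of a "1 - a" "1 + x" 1] assms by (simp add: algebra_simps)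

lemma Bernoulli_powr_ge:
  fixes x a :: real
  assumes "-1 < x" "1 \<le> a"
  shows "1 + a * x \<le> (1 + x) powr a"
proof (cases "0 < 1 + a * x")
  case True
  have "(1 + a * x) powr (1 / a) \<le> 1 + x"
    using Bernoulli_powr_le[of "a * x" "1 / a"] True assms by simp
  then have "((1 + a * x) powr (1 / a)) powr a \<le> (1 + x) powr a"
    using assms by (intro powr_mono2) auto
  then show ?thesis
    using True assms by (simp add: powr_powr)
next
  case False
  then have "1 + a * x \<le> 0" by simp
  also have "0 \<le> (1 + x) powr a" by simp
  finally show ?thesis .
qed

lemma ln_one_minus_le:
  fixes y :: real
  assumes "0 \<le> y" "y < 1"
  shows "ln (1 - y) \<le> - (2 * y / (2 - y))"
proof -
  define \<phi> where "\<phi> = (\<lambda>y :: real. ln (1 - y) + 2 * y / (2 - y))"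
  have "\<phi> y \<le> \<phi> 0"
  proof (rule DERIV_nonpos_imp_nonincreasing[OF assms(1)])
    fix x :: real assume x: "0 \<le> x" "x \<le> y"
    then have x1: "x < 1" using assms by simp
    have "(\<phi> has_real_derivative (- 1 / (1 - x) + 4 / (2 - x)\<^sup>2)) (at x)"
      unfolding \<phi>_def using x1
      by (auto intro!: derivative_eq_intros simp: power2_eq_square)
    moreover have "- 1 / (1 - x) + 4 / (2 - x)\<^sup>2 \<le> 0"
    proof -
      have "4 * (1 - x) \<le> (2 - x)\<^sup>2"
        by (simp add: power2_eq_square algebra_simps)
      then show ?thesis
        using x1 by (simp add: divide_simps)
    qed
    ultimately show "\<exists>D. (\<phi> has_real_derivative D) (at x) \<and> D \<le> 0"
      by blast
  qed
  then show ?thesis by (simp add: \<phi>_def)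
qed

text \<open>
  Only a factor with exponent \<open>e - 1\<close> is estimated, by \<open>exp (- z) \<le> 1 / (1 + z + z\<^sup>2 / 2)\<close> after
  \<open>ln_one_minus_le\<close>. The result is therefore exact at \<open>e = 1\<close>, as the later division by \<open>e - 1\<close>
  demands.
\<close>

lemma one_minus_powr_le:
  fixes y e :: real
  assumes "0 \<le> y" "y < 1" "1 \<le> e"
  defines "u \<equiv> e - 1"
  shows "(1 - y) powr e \<le>
    (1 - y) * (2 - y)\<^sup>2 / ((2 - y)\<^sup>2 + 2 * y * u * (2 - y) + 2 * y\<^sup>2 * u\<^sup>2)"
proof -
  define z where "z = 2 * y * u / (2 - y)"
  have z: "0 \<le> z" unfolding z_def u_def using assms by simp
  have "u * ln (1 - y) \<le> u * (- (2 * y / (2 - y)))"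
    using ln_one_minus_le[of y] assms by (intro mult_left_mono) (auto simp: u_def)
  then have "(1 - y) powr u \<le> exp (- z)"
    using assms by (simp add: powr_def z_def mult.commute)
  also have "\<dots> \<le> 1 / (1 + z + z\<^sup>2 / 2)"
    using exp_lower_Taylor_quadratic[OF z] z
    by (simp add: exp_minus inverse_eq_divide frac_le add_pos_nonneg)
  also have "1 + z + z\<^sup>2 / 2 = ((2 - y)\<^sup>2 + 2 * y * u * (2 - y) + 2 * y\<^sup>2 * u\<^sup>2) / (2 - y)\<^sup>2"
    using assms by (simp add: z_def add_divide_distrib power_divide power2_eq_square)
  finally have "(1 - y) powr u \<le> (2 - y)\<^sup>2 / ((2 - y)\<^sup>2 + 2 * y * u * (2 - y) + 2 * y\<^sup>2 * u\<^sup>2)"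
    by simp
  then have "(1 - y) * (1 - y) powr u \<le>
     (1 - y) * ((2 - y)\<^sup>2 / ((2 - y)\<^sup>2 + 2 * y * u * (2 - y) + 2 * y\<^sup>2 * u\<^sup>2))"
    using assms by (intro mult_left_mono) auto
  moreover have "(1 - y) * (1 - y) powr u = (1 - y) powr e"
    using assms by (simp add: u_def powr_diff)
  ultimately show ?thesis by simp
qed

section \<open>The bound as a function of the slack and of the size\<close>

text \<open>
  The lower bound for the probability of \<open>S < E S + d\<close>, at a real size \<open>e\<close> in place of the
  number of variables. The induction over the variables reaches sizes below \<open>1\<close>; there the bound is
  the one that Markov's inequality gives. The two branches agree at \<open>e = 1\<close>.
\<close>

definition tail_bound :: "real \<Rightarrow> real \<Rightarrow> real" where
  "tail_bound d e =
     (if e \<le> 1 then d / (e + d) else min 1 d * (1 - min 1 d / (e + d)) powr e)"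

lemma tail_bound_ge_1:
  assumes "0 < d" "1 \<le> e"
  shows "tail_bound d e = min 1 d * (1 - min 1 d / (e + d)) powr e"
proof (cases "e = 1")
  case True
  then show ?thesis
    using assms by (simp add: tail_bound_def min_def divide_simps)
qed (use assms in \<open>simp add: tail_bound_def\<close>)

lemma feige_bound_eq_tail_bound:
  assumes "1 \<le> n" "0 < d"
  shows "feige_bound n d = tail_bound d (real n)"
proof -
  have n: "1 \<le> real n" using assms by simp
  show ?thesis
  proof (cases "d < 1")
    case True
    have "0 < real n / (real n + d)" "1 - d / (real n + d) = real n / (real n + d)"
      using n assms by (simp_all add: field_simps)
    then show ?thesis
      using True n assms by (simp add: tail_bound_ge_1 feige_bound_def powr_realpow)
  next
    case False
    have "0 < 1 - 1 / (real n + d)"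
      using n assms by (simp add: field_simps)
    then show ?thesis
      using False n assms by (simp add: tail_bound_ge_1 feige_bound_def powr_realpow)
  qed
qed

text \<open>
  The derivative of the logarithm in \<open>e\<close> is nonpositive by \<open>ln x \<le> x - 1\<close>.
\<close>

lemma tail_bound_antimono:
  assumes "0 < d" "1 \<le> e" "e \<le> e'"
  shows "tail_bound d e' \<le> tail_bound d e"
proof -
  define m where "m = min 1 d"
  have m: "0 < m" "m \<le> 1" "m \<le> d" using assms by (auto simp: m_def)
  define \<phi> where "\<phi> = (\<lambda>x. x * ln (1 - m / (x + d)))"
  have "\<phi> e' \<le> \<phi> e"
  proof (rule DERIV_nonpos_imp_nonincreasing[OF assms(3)])
    fix x assume "e \<le> x" "x \<le> e'"
    then have x: "1 \<le> x" using assms by simp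
    let ?l = "x + d"
    have l: "0 < ?l" "m < ?l" "x \<le> ?l - m" using x m by auto
    have y: "m / ?l < 1" "0 < 1 - m / ?l" using l by (auto simp: field_simps)
    have "(\<phi> has_real_derivative (1 * ln (1 - m / ?l) + (m / ?l^2 / (1 - m / ?l)) * x)) (at x)"
      unfolding \<phi>_def using l y
      by (auto intro!: derivative_eq_intros simp: power2_eq_square)
    moreover have "1 * ln (1 - m / ?l) + (m / ?l^2 / (1 - m / ?l)) * x \<le> 0"
    proof -
      have "ln (1 - m / ?l) \<le> - (m / ?l)"
        using ln_le_minus_one[OF y(2)] by simp
      moreover have "(m / ?l^2 / (1 - m / ?l)) * x = m / ?l * (x / (?l - m))"
      proof -
        have "1 - m / ?l = (?l - m) / ?l" using l by (simp add: diff_divide_distrib)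
        then show ?thesis using l by (simp add: power2_eq_square)
      qed
      moreover have "m / ?l * (x / (?l - m)) \<le> m / ?l * 1"
        using l m by (intro mult_left_mono) auto
      ultimately show ?thesis by linarith
    qed
    ultimately show "\<exists>D. (\<phi> has_real_derivative D) (at x) \<and> D \<le> 0" by blast
  qed
  moreover have "(1 - m / (x + d)) powr x = exp (\<phi> x)" if "1 \<le> x" for x
    using that m assms by (simp add: powr_def \<phi>_def)
  ultimately show ?thesis
    using assms m by (simp add: tail_bound_ge_1 m_def[symmetric])
qed

lemma tail_bound_pos:
  assumes "0 < d" "0 \<le> e"
  shows "0 < tail_bound d e"
proof -
  have "0 < 1 - min 1 d / (e + d)" if "e > 1"
    using assms that by (auto simp: min_def field_simps)
  then show ?thesis
    using assms unfolding tail_bound_def by auto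
qed

lemma tail_bound_le_1:
  assumes "0 < d" "0 \<le> e"
  shows "tail_bound d e \<le> 1"
proof (cases "e \<le> 1")
  case True
  then show ?thesis using assms by (simp add: tail_bound_def)
next
  case False
  then have "tail_bound d e \<le> tail_bound d 1"
    using assms by (intro tail_bound_antimono) auto
  also have "\<dots> \<le> 1" using assms by (simp add: tail_bound_def)
  finally show ?thesis .
qed

text \<open>
  The effect of conditioning a variable of mean \<open>c\<close> to be \<open>0\<close>, an event of probability at least
  \<open>(1 - 1 / l) powr c\<close>: the sum \<open>l = e + d\<close> of size and slack is preserved. Once the new slack is at
  least \<open>1\<close>, both sides compare with \<open>(1 - 1 / l) powr e\<close> through Bernoulli's inequality.
\<close>

lemma tail_bound_remove_ge1:
  fixes c d e :: real
  assumes "0 < d" "1 < e" "0 < c" "c \<le> 1" "1 \<le> d + c"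
  defines "l \<equiv> e + d"
  shows "tail_bound d e \<le> (1 - 1 / l) powr c * tail_bound (d + c) (e - c)"
proof -
  have l: "1 < l" "(e - c) + (d + c) = l" using assms by (auto simp: l_def)
  have y: "-1 < - (1 / l)" "0 < 1 - 1 / l" using l(1) by (auto simp: divide_simps)
  have 1: "(1 - 1 / l) powr (e - c) \<le> tail_bound (d + c) (e - c)"
  proof (cases "e - c \<le> 1")
    case True
    have "(1 + - (1 / l)) powr (e - c) \<le> 1 + (e - c) * (- (1 / l))"
      using True assms(2,4) y by (intro Bernoulli_powr_le) auto
    also have "\<dots> = (d + c) / l"
      using l(1) by (simp add: divide_simps) (simp add: l_def)
    finally show ?thesis
      unfolding tail_bound_def l(2) using True by simp
  next
    case False
    then show ?thesis
      unfolding tail_bound_def l(2) using assms(5) by simp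
  qed
  have 2: "tail_bound d e \<le> (1 - 1 / l) powr e"
  proof (cases "d < 1")
    case True
    have "1 + e * (- ((1 - d) / e)) \<le> (1 + - ((1 - d) / e)) powr e"
      using assms(1,2) True by (intro Bernoulli_powr_ge) (auto simp: divide_simps)
    then have "d \<le> (1 - (1 - d) / e) powr e"
      using assms(2) by simp
    then have "d * (e / l) powr e \<le> (1 - (1 - d) / e) powr e * (e / l) powr e"
      by (rule mult_right_mono) simp
    also have "\<dots> = ((1 - (1 - d) / e) * (e / l)) powr e"
      by (rule powr_mult[symmetric])
    also have "(1 - (1 - d) / e) * (e / l) = 1 - 1 / l"
      using assms(2) l(1) by (simp add: divide_simps l_def)
    also have "e / l = 1 - d / l"
      using l(1) by (simp add: divide_simps) (simp add: l_def)
    finally show ?thesis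
      using True assms(1,2) by (simp add: tail_bound_ge_1 l_def[symmetric])
  next
    case False
    then show ?thesis
      using assms(1,2) by (simp add: tail_bound_ge_1 l_def[symmetric])
  qed
  also have "(1 - 1 / l) powr e = (1 - 1 / l) powr c * (1 - 1 / l) powr (e - c)"
    by (simp add: powr_add[symmetric])
  also have "\<dots> \<le> (1 - 1 / l) powr c * tail_bound (d + c) (e - c)"
    using 1 by (intro mult_left_mono) auto
  finally show ?thesis .
qed

text \<open>
  The same for a new slack \<open>d + c\<close> below \<open>1\<close>. After cancellation of powers of \<open>l\<close> the claim is
  \<open>(e / (l - 1)) powr c * (e / (e - c)) powr (e - c) \<le> (d + c) / d\<close>. By the weighted inequality of
  means the left side is at most \<open>(1 + c / (l - 1)) powr e\<close>, which Bernoulli's inequality compares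
  with the right side.
\<close>

lemma tail_bound_remove_lt1:
  fixes c d e :: real
  assumes "0 < d" "1 < e" "0 < c" "d + c < 1"
  defines "l \<equiv> e + d"
  shows "tail_bound d e \<le> (1 - 1 / l) powr c * tail_bound (d + c) (e - c)"
proof -
  define D where "D = d + c"
  have D: "0 < D" "D < 1" "d < D" "d < 1" "c < 1" "c < e" using assms(1-4) by (auto simp: D_def)
  have l: "1 < l" "(e - c) + D = l" "0 < l - 1" using assms(1-4) by (auto simp: l_def D_def)
  have 1: "D * ((e - c) / l) powr (e - c) \<le> tail_bound D (e - c)"
  proof (cases "e - c \<le> 1")
    case True
    have eq: "(e - c) / l = 1 + - (D / l)"
      using l by (simp add: divide_simps)
    have "(1 + - (D / l)) powr (e - c) \<le> 1 + (e - c) * (- (D / l))"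
      using True D l by (intro Bernoulli_powr_le) (auto simp: divide_simps)
    also have "\<dots> = (l - (e - c) * D) / l"
      using l(1) by (simp add: divide_simps)
    also have "\<dots> \<le> 1 / l"
    proof -
      have "0 \<le> (1 - (e - c)) * (1 - D)" using True D by simp
      also have "\<dots> = 1 - (l - (e - c) * D)" using l(2) by (simp add: algebra_simps)
      finally show ?thesis using l(1) by (simp add: divide_right_mono)
    qed
    finally have "D * ((e - c) / l) powr (e - c) \<le> D * (1 / l)"
      unfolding eq using D by (intro mult_left_mono) auto
    then show ?thesis
      unfolding tail_bound_def l(2) using True by simp
  next
    case False
    have "1 - D / l = (e - c) / l" using l by (simp add: divide_simps)
    then show ?thesis
      unfolding tail_bound_def l(2) using D False by simp
  qed
  have 2: "(e / (l - 1)) powr c * (e / (e - c)) powr (e - c) \<le> D / d"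
  proof -
    (* the weights c / e and 1 - c / e belong to the two powers on the left *)
    have "(e / (l - 1)) powr (c / e) * (e / (e - c)) powr (1 - c / e)
        \<le> c / e * (e / (l - 1)) + (1 - c / e) * (e / (e - c))"
      using assms(2,3) D l by (intro Youngs_inequality_0) auto
    also have "c / e * (e / (l - 1)) + (1 - c / e) * (e / (e - c)) = 1 + c / (l - 1)"
    proof -
      have "(1 - c / e) * (e / (e - c)) = 1" using assms(2) D(6) by (simp add: field_simps)
      then show ?thesis using assms(2) by simp
    qed
    finally have "((e / (l - 1)) powr (c / e) * (e / (e - c)) powr (1 - c / e)) powr e
        \<le> (1 + c / (l - 1)) powr e"
      using assms(2) by (intro powr_mono2) auto
    moreover have "((e / (l - 1)) powr (c / e) * (e / (e - c)) powr (1 - c / e)) powr e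
        = (e / (l - 1)) powr c * (e / (e - c)) powr (e - c)"
      using assms(2) by (simp add: powr_mult powr_powr left_diff_distrib)
    ultimately have "(e / (l - 1)) powr c * (e / (e - c)) powr (e - c) \<le> (1 + c / (l - 1)) powr e"
      by simp
    also have "\<dots> \<le> D / d"
    proof -
      have "1 + e * (- (c / (l - 1 + c))) \<le> (1 + - (c / (l - 1 + c))) powr e"
        using assms(2,3) l by (intro Bernoulli_powr_ge) (auto simp: divide_simps)
      moreover have "d / D \<le> 1 + e * (- (c / (l - 1 + c)))"
      proof -
        have "0 \<le> (e - 1) * (1 - D)" using assms(2) D by simp
        then have "e * D \<le> l - 1 + c" using l(2) by (simp add: algebra_simps)
        then have "e / (l - 1 + c) \<le> 1 / D" using l D assms(3) by (simp add: divide_simps)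
        then have "c * (e / (l - 1 + c)) \<le> c * (1 / D)" using assms(3) by (intro mult_left_mono) auto
        moreover have "d / D = 1 - c / D" using D by (simp add: divide_simps) (simp add: D_def)
        ultimately show ?thesis by (simp add: mult.commute)
      qed
      moreover have pos: "0 < 1 + c / (l - 1)" using l(3) assms(3) by (intro add_pos_nonneg) auto
      moreover have "1 + - (c / (l - 1 + c)) = inverse (1 + c / (l - 1))"
      proof -
        have "1 + c / (l - 1) = (l - 1 + c) / (l - 1)"
          using l(3) by (simp add: add_divide_distrib)
        then show ?thesis using l(3) assms(3) by (simp add: divide_simps)
      qed
      ultimately have "d / D \<le> inverse ((1 + c / (l - 1)) powr e)"
        using l assms(3) by (simp add: inverse_powr)
      moreover have "0 < (1 + c / (l - 1)) powr e" using pos by simp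
      ultimately show ?thesis using assms(1) D by (simp add: field_simps)
    qed
    finally show ?thesis .
  qed
  have "tail_bound d e = d * (e / l) powr e"
  proof -
    have "1 - d / l = e / l" using l by (simp add: divide_simps) (simp add: l_def)
    then show ?thesis using assms(1,2) D by (simp add: tail_bound_ge_1 l_def[symmetric])
  qed
  also have "\<dots> = d * (((1 - 1 / l) powr c * ((e - c) / l) powr (e - c)) *
      ((e / (l - 1)) powr c * (e / (e - c)) powr (e - c)))"
  proof -
    have "1 - 1 / l = (l - 1) / l" using l by (simp add: divide_simps)
    then have a: "e / l = (1 - 1 / l) * (e / (l - 1))" using l by simp
    have b: "e / l = (e - c) / l * (e / (e - c))" using D by simp
    have "(e / l) powr e = (e / l) powr c * (e / l) powr (e - c)"
      by (simp add: powr_add[symmetric])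
    also have "(e / l) powr c = (1 - 1 / l) powr c * (e / (l - 1)) powr c"
      by (subst a) (rule powr_mult)
    also have "(e / l) powr (e - c) = ((e - c) / l) powr (e - c) * (e / (e - c)) powr (e - c)"
      unfolding b by (rule powr_mult)
    finally show ?thesis by simp
  qed
  also have "\<dots> \<le> d * (((1 - 1 / l) powr c * ((e - c) / l) powr (e - c)) * (D / d))"
    using 2 assms(1) by (intro mult_left_mono) auto
  also have "\<dots> = (1 - 1 / l) powr c * (D * ((e - c) / l) powr (e - c))"
    using assms(1) by simp
  also have "\<dots> \<le> (1 - 1 / l) powr c * tail_bound (d + c) (e - c)"
    using 1 unfolding D_def by (intro mult_left_mono) auto
  finally show ?thesis .
qed

lemma tail_bound_increment_ge1:
  fixes c d e :: real
  assumes "1 \<le> d" "1 < e" "0 \<le> c"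
  defines "l \<equiv> e + d"
  shows "tail_bound d e * (1 + e * c / ((l + c) * (l - 1))) \<le> tail_bound (d + c) e"
proof -
  have l: "1 < l" "e + (d + c) = l + c" using assms by (auto simp: l_def)
  define x where "x = c / ((l + c) * (l - 1))"
  have x: "0 \<le> x" using l assms(3) by (simp add: x_def)
  have eq: "1 - 1 / (l + c) = (1 - 1 / l) * (1 + x)"
  proof -
    have "(l + c) * (l - 1) * (1 + x) = l * (l + c - 1)"
      using l assms(3) by (simp add: x_def distrib_left) (simp add: algebra_simps)
    then have "1 + x = l * (l + c - 1) / ((l + c) * (l - 1))"
      using l(1) assms(3) by (simp add: eq_divide_eq mult.commute[of "1 + x"])
    moreover have "1 - 1 / l = (l - 1) / l" "1 - 1 / (l + c) = (l + c - 1) / (l + c)"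
      using l(1) assms(3) by (simp_all add: diff_divide_distrib)
    ultimately show ?thesis using l(1) assms(3) by simp
  qed
  have "tail_bound d e * (1 + e * x) \<le> (1 - 1 / l) powr e * (1 + x) powr e"
    using Bernoulli_powr_ge[of x e] x assms(1,2)
    by (simp add: tail_bound_ge_1 l_def[symmetric] mult_left_mono)
  also have "\<dots> = (1 - 1 / (l + c)) powr e"
    unfolding eq by (simp add: powr_mult)
  also have "\<dots> = tail_bound (d + c) e"
    using assms(1-3) by (simp add: tail_bound_ge_1 l(2))
  finally show ?thesis by (simp add: x_def)
qed

lemma tail_bound_increment_le1:
  fixes c d e :: real
  assumes "0 < d" "1 < e" "0 \<le> c" "d + c \<le> 1"
  defines "l \<equiv> e + d"
  shows "tail_bound d e * (1 + c / (l + 1)) \<le> tail_bound (d + c) e"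
proof -
  define D where "D = d + c"
  have D: "0 < D" "D \<le> 1" "d \<le> D" "c \<le> 1" "d \<le> 1" using assms(1-4) by (auto simp: D_def)
  have l: "1 < l" "e + D = l + c" using assms(1-4) by (auto simp: l_def D_def)
  have tb: "tail_bound D e = D * (e / (l + c)) powr e" "tail_bound d e = d * (e / l) powr e"
  proof -
    have "1 - D / (l + c) = e / (l + c)" "1 - d / l = e / l"
      using l assms(3) by (simp_all add: divide_simps) (simp_all add: l_def)
    then show "tail_bound D e = D * (e / (l + c)) powr e" "tail_bound d e = d * (e / l) powr e"
      using assms(1,2) D l by (simp_all add: tail_bound_ge_1 l_def[symmetric])
  qed
  have "d * (1 + c / (l + 1)) \<le> D * (1 + e * (- (c / (l + c))))"
  proof -
    have "0 \<le> (e - 1) * (1 - D)" using assms(2) D by simp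
    then have "c * 1 \<le> c * (e + D - D * e)"
      using assms(3) by (intro mult_left_mono) (auto simp: algebra_simps)
    also have "\<dots> = D * (l + c - e * c) - d * (l + c)"
      unfolding l(2)[symmetric] by (simp add: D_def algebra_simps)
    finally have 1: "c / (l + c) \<le> (D * (l + c - e * c) - d * (l + c)) / (l + c)"
      using l assms(3) by (intro divide_right_mono) auto
    have "d * (l + c) \<le> 1 * (l + 1)"
      using D l assms(1,3) by (intro mult_mono) auto
    then have "d / (l + 1) \<le> 1 / (l + c)"
      using l assms(3) by (simp add: divide_simps)
    then have "c * (d / (l + 1)) \<le> c * (1 / (l + c))"
      using assms(3) by (rule mult_left_mono)
    with 1 have "c * (d / (l + 1)) \<le> (D * (l + c - e * c) - d * (l + c)) / (l + c)"
      by simp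
    also have "\<dots> = D * (1 - e * c / (l + c)) - d"
      using l assms(3) by (simp add: field_simps)
    finally show ?thesis by (simp add: algebra_simps)
  qed
  also have "\<dots> \<le> D * (1 + - (c / (l + c))) powr e"
    using D l assms(2,3) by (intro mult_left_mono Bernoulli_powr_ge) (auto simp: divide_simps)
  also have "1 + - (c / (l + c)) = l / (l + c)"
    using l assms(3) by (simp add: divide_simps)
  finally have "(d * (1 + c / (l + 1))) * (e / l) powr e \<le> (D * (l / (l + c)) powr e) * (e / l) powr e"
    by (rule mult_right_mono) simp
  also have "\<dots> = D * ((l / (l + c)) * (e / l)) powr e"
    using l assms(2,3) by (subst powr_mult) auto
  also have "(l / (l + c)) * (e / l) = e / (l + c)"
    using l by simp
  finally show ?thesis
    unfolding D_def[symmetric] tb by (simp add: mult_ac)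
qed

text \<open>
  A linear lower bound for the gain from a slack larger by \<open>c\<close>. It measures how much the absence
  of a variable of mean \<open>c\<close> increases the probability that the sum stays below the threshold.
\<close>

lemma tail_bound_increment:
  fixes c d e :: real
  assumes "0 < d" "1 < e" "0 \<le> c" "c \<le> 1"
  defines "l \<equiv> e + d"
  shows "tail_bound d e * (1 + e / ((l + 1) * (l - min 1 d)) * c) \<le> tail_bound (d + c) e"
proof -
  have l: "1 < l" using assms by (simp add: l_def)
  have pos: "0 \<le> tail_bound d e" using tail_bound_pos[of d e] assms(1,2) by simp
  consider "1 \<le> d" | "d < 1" "d + c \<le> 1" | "d < 1" "1 < d + c" by linarith
  then show ?thesis
  proof cases
    case 1
    have "e * c / ((l + 1) * (l - 1)) \<le> e * c / ((l + c) * (l - 1))"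
      using l assms(2-4) by (intro divide_left_mono mult_right_mono mult_pos_pos mult_nonneg_nonneg) auto
    then have "tail_bound d e * (1 + e / ((l + 1) * (l - 1)) * c)
        \<le> tail_bound d e * (1 + e * c / ((l + c) * (l - 1)))"
      using pos by (intro mult_left_mono) auto
    also have "\<dots> \<le> tail_bound (d + c) e"
      unfolding l_def using 1 assms(2,3) by (rule tail_bound_increment_ge1)
    finally show ?thesis using 1 by simp
  next
    case 2
    have "tail_bound d e * (1 + c / (l + 1)) \<le> tail_bound (d + c) e"
      unfolding l_def using assms(1-3) 2(2) by (rule tail_bound_increment_le1)
    moreover have "e / ((l + 1) * (l - min 1 d)) = 1 / (l + 1)"
      using 2(1) assms(2) by (simp add: l_def)
    ultimately show ?thesis by simp
  next
    case 3
    (* The slack grows in two steps, from d to 1 and from 1 to 1 + c1. *)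
    define c1 where "c1 = d + c - 1"
    have c1: "0 \<le> c1" "1 + c1 = d + c" "c - c1 = 1 - d" "e + 1 + c1 = l + c"
      using 3 by (auto simp: c1_def l_def)
    have "tail_bound d e * (1 + (1 - d) / (l + 1)) \<le> tail_bound (d + (1 - d)) e"
      unfolding l_def using assms(1-3) 3 by (intro tail_bound_increment_le1) auto
    then have a: "tail_bound d e * (1 + (1 - d) / (l + 1)) \<le> tail_bound 1 e"
      by simp
    have "c1 / (l + 1) \<le> c1 / (l + c)"
      using c1 l assms(3,4) by (intro divide_left_mono) auto
    then have "tail_bound 1 e * (1 + c1 / (l + 1)) \<le> tail_bound 1 e * (1 + c1 / (l + c))"
      using tail_bound_pos[of 1 e] assms(2) by (intro mult_left_mono) auto
    also have "\<dots> = tail_bound 1 e * (1 + e * c1 / ((e + 1 + c1) * (e + 1 - 1)))"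
      using assms(2) c1(4) by simp
    also have "\<dots> \<le> tail_bound (1 + c1) e"
      using assms(2) c1 by (intro tail_bound_increment_ge1) auto
    finally have b: "tail_bound 1 e * (1 + c1 / (l + 1)) \<le> tail_bound (d + c) e"
      using c1 by simp
    have "1 + c / (l + 1) \<le> (1 + (1 - d) / (l + 1)) * (1 + c1 / (l + 1))"
    proof -
      have "0 \<le> a * b \<Longrightarrow> 1 + (a + b) \<le> (1 + a) * (1 + b)" for a b :: real
        by (simp add: algebra_simps)
      moreover have "0 \<le> ((1 - d) / (l + 1)) * (c1 / (l + 1))" using 3 c1 l by simp
      moreover have "c / (l + 1) = (1 - d) / (l + 1) + c1 / (l + 1)"
        using c1 by (simp add: add_divide_distrib[symmetric])
      ultimately show ?thesis by metis
    qed
    then have "tail_bound d e * (1 + c / (l + 1))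
        \<le> tail_bound d e * ((1 + (1 - d) / (l + 1)) * (1 + c1 / (l + 1)))"
      using pos by (rule mult_left_mono)
    also have "\<dots> \<le> tail_bound 1 e * (1 + c1 / (l + 1))"
      unfolding mult.assoc[symmetric] using a c1 l by (intro mult_right_mono) auto
    also note b
    finally have "tail_bound d e * (1 + c / (l + 1)) \<le> tail_bound (d + c) e" .
    moreover have "e / ((l + 1) * (l - min 1 d)) = 1 / (l + 1)"
      using 3(1) assms(2) by (simp add: l_def)
    ultimately show ?thesis by simp
  qed
qed

section \<open>The polynomial inequality behind the tilting estimate\<close>

text \<open>
  The left side of \<open>final_inequality\<close> after multiplication by \<open>2 * e\<^sup>2 * (e + d)\<^sup>2\<close>, written as a
  polynomial in \<open>X = (e + d) * J\<close> and made homogeneous in \<open>X\<close> and \<open>Q\<close>, so that a quotient may be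
  inserted for \<open>X\<close> without division.
\<close>

definition Gpoly :: "real \<Rightarrow> real \<Rightarrow> real \<Rightarrow> real \<Rightarrow> real \<Rightarrow> real \<Rightarrow> real" where
  "Gpoly m d e s X Q =
     2 * e^2 * (e + d) * (d * Q + (e - 1) * X)
     + 2 * e * (e - 1) * (e + d) * (m * e * Q - m * (e - 1) * X - (e + d) * X)
     - (2 * e + d - 1 - s) * m * (e + d + 1)
         * (e * (e + d) * X + s * (m * e * Q - m * (e - 1) * X - (e + d) * X))"

text \<open>
  \<open>Gpoly\<close> is quadratic in \<open>s\<close>. The hypotheses say that its coefficients in the Bernstein basis
  \<open>(e - s)\<^sup>2\<close>, \<open>s (e - s)\<close>, \<open>s\<^sup>2\<close> are nonnegative; the middle one is expressed by values at
  \<open>0\<close>, \<open>e\<close> and \<open>- e\<close>.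
\<close>

lemma Gpoly_quadratic:
  assumes "0 \<le> s" "s \<le> e" "0 < e"
    "0 \<le> Gpoly m d e 0 X Q" "0 \<le> Gpoly m d e e X Q"
    "0 \<le> 4 * Gpoly m d e 0 X Q + Gpoly m d e e X Q - Gpoly m d e (- e) X Q"
  shows "0 \<le> Gpoly m d e s X Q"
proof -
  have "e^2 * Gpoly m d e s X Q = (e - s)^2 * Gpoly m d e 0 X Q + s^2 * Gpoly m d e e X Q
     + s * (e - s) / 2 * (4 * Gpoly m d e 0 X Q + Gpoly m d e e X Q - Gpoly m d e (- e) X Q)"
    unfolding Gpoly_def by (simp add: field_simps power2_eq_square)
  also have "0 \<le> \<dots>"
    using assms by (intro add_nonneg_nonneg mult_nonneg_nonneg) auto
  finally show ?thesis using assms(3) by (simp add: zero_le_mult_iff)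
qed

text \<open>
  \<open>Gpoly\<close> is linear in \<open>(X, Q)\<close>, so its sign for \<open>0 \<le> X \<le> N / Q\<close> is decided at the end points.
\<close>

lemma Gpoly_affine:
  assumes "0 \<le> X" "0 < Q" "Q * X \<le> N" "0 \<le> Gpoly m d e s 0 1" "0 \<le> Gpoly m d e s N Q"
  shows "0 \<le> Gpoly m d e s X 1"
proof (cases "X = 0")
  case True then show ?thesis using assms by simp
next
  case False
  then have N: "0 < N" using assms by (smt (verit) mult_pos_pos)
  have "N * Gpoly m d e s X 1 = (N - Q * X) * Gpoly m d e s 0 1 + X * Gpoly m d e s N Q"
    unfolding Gpoly_def by (simp add: algebra_simps)
  also have "0 \<le> \<dots>"
    using assms by (intro add_nonneg_nonneg mult_nonneg_nonneg) auto
  finally show ?thesis using N by (simp add: zero_le_mult_iff)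
qed

text \<open>
  For slack \<open>d = 1 + g\<close> and size \<open>e = 1 + u\<close> each of the Bernstein coefficients, at the smallest and
  at the largest possible \<open>X\<close>, turns out to be a polynomial in \<open>g\<close> and \<open>u\<close> with nonnegative
  coefficients. The largest value \<open>n / q\<close> comes from \<open>one_minus_powr_le\<close>.
\<close>

lemma Gpoly_ge1_lo_0:
  fixes g u n q :: real
  assumes "0 \<le> g" "0 \<le> u"
    "n = 0" "q = 1"
  shows "0 \<le> Gpoly 1 (1 + g) (1 + u) 0 n q"
proof -
  have "Gpoly 1 (1 + g) (1 + u) 0 n q =
      4 + 14*u + 18*u^2 + 10*u^3 + 2*u^4 + 6*g + 16*g*u + 14*g*u^2 + 4*g*u^3 + 2*g^2 + 4*g^2*u
       + 2*g^2*u^2"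
    unfolding Gpoly_def assms(3,4) by algebra
  also have "0 \<le> \<dots>"
    using assms(1-2) by (intro add_nonneg_nonneg mult_nonneg_nonneg zero_le_power) auto
  finally show ?thesis .
qed

lemma Gpoly_ge1_lo_m:
  fixes g u n q :: real
  assumes "0 \<le> g" "0 \<le> u"
    "n = 0" "q = 1"
  shows "0 \<le> 4 * Gpoly 1 (1 + g) (1 + u) 0 n q + Gpoly 1 (1 + g) (1 + u) (1 + u) n q - Gpoly 1 (1 + g) (1 + u) (- (1 + u)) n q"
proof -
  have "4 * Gpoly 1 (1 + g) (1 + u) 0 n q + Gpoly 1 (1 + g) (1 + u) (1 + u) n q - Gpoly 1 (1 + g) (1 + u) (- (1 + u)) n q =
      4 + 16*u + 24*u^2 + 16*u^3 + 4*u^4 + 14*g + 38*g*u + 34*g*u^2 + 10*g*u^3 + 6*g^2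
       + 12*g^2*u + 6*g^2*u^2"
    unfolding Gpoly_def assms(3,4) by algebra
  also have "0 \<le> \<dots>"
    using assms(1-2) by (intro add_nonneg_nonneg mult_nonneg_nonneg zero_le_power) auto
  finally show ?thesis .
qed

lemma Gpoly_ge1_lo_e:
  fixes g u n q :: real
  assumes "0 \<le> g" "0 \<le> u"
    "n = 0" "q = 1"
  shows "0 \<le> Gpoly 1 (1 + g) (1 + u) (1 + u) n q"
proof -
  have "Gpoly 1 (1 + g) (1 + u) (1 + u) n q =
      1 + 4*u + 6*u^2 + 4*u^3 + u^4 + 2*g + 6*g*u + 6*g*u^2 + 2*g*u^3 + g^2 + 2*g^2*u
       + g^2*u^2"
    unfolding Gpoly_def assms(3,4) by algebra
  also have "0 \<le> \<dots>"
    using assms(1-2) by (intro add_nonneg_nonneg mult_nonneg_nonneg zero_le_power) auto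
  finally show ?thesis .
qed

lemma Gpoly_ge1_hi_0:
  fixes g u n q :: real
  assumes "0 \<le> g" "0 \<le> u"
    "n = (((2 * ((1 + u) + (1 + g)) - 1)^2 - 2 * (1 + g) * (2 * ((1 + u) + (1 + g)) - 1) - 2 * (1 + g) * u))" 
    "q = ((2 * ((1 + u) + (1 + g)) - 1)^2 + 2 * u * (2 * ((1 + u) + (1 + g)) - 1) + 2 * u^2)"
  shows "0 \<le> Gpoly 1 (1 + g) (1 + u) 0 n q"
proof -
  have "Gpoly 1 (1 + g) (1 + u) 0 n q =
      12*u + 46*u^2 + 72*u^3 + 58*u^4 + 24*u^5 + 4*u^6 + 30*g + 149*g*u + 282*g*u^2
       + 257*g*u^3 + 114*g*u^4 + 20*g*u^5 + 53*g^2 + 197*g^2*u + 268*g^2*u^2 + 158*g^2*u^3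
       + 34*g^2*u^4 + 31*g^3 + 87*g^3*u + 80*g^3*u^2 + 24*g^3*u^3 + 6*g^4 + 12*g^4*u
       + 6*g^4*u^2"
    unfolding Gpoly_def assms(3,4) by algebra
  also have "0 \<le> \<dots>"
    using assms(1-2) by (intro add_nonneg_nonneg mult_nonneg_nonneg zero_le_power) auto
  finally show ?thesis .
qed

lemma Gpoly_ge1_hi_m:
  fixes g u n q :: real
  assumes "0 \<le> g" "0 \<le> u"
    "n = (((2 * ((1 + u) + (1 + g)) - 1)^2 - 2 * (1 + g) * (2 * ((1 + u) + (1 + g)) - 1) - 2 * (1 + g) * u))" 
    "q = ((2 * ((1 + u) + (1 + g)) - 1)^2 + 2 * u * (2 * ((1 + u) + (1 + g)) - 1) + 2 * u^2)"
  shows "0 \<le> 4 * Gpoly 1 (1 + g) (1 + u) 0 n q + Gpoly 1 (1 + g) (1 + u) (1 + u) n q - Gpoly 1 (1 + g) (1 + u) (- (1 + u)) n q"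
proof -
  have "4 * Gpoly 1 (1 + g) (1 + u) 0 n q + Gpoly 1 (1 + g) (1 + u) (1 + u) n q - Gpoly 1 (1 + g) (1 + u) (- (1 + u)) n q =
      30*u + 130*u^2 + 230*u^3 + 206*u^4 + 92*u^5 + 16*u^6 + 84*g + 422*g*u + 832*g*u^2
       + 806*g*u^3 + 384*g*u^4 + 72*g*u^5 + 158*g^2 + 596*g^2*u + 834*g^2*u^2 + 512*g^2*u^3
       + 116*g^2*u^4 + 98*g^3 + 278*g^3*u + 260*g^3*u^2 + 80*g^3*u^3 + 20*g^4 + 40*g^4*u
       + 20*g^4*u^2"
    unfolding Gpoly_def assms(3,4) by algebra
  also have "0 \<le> \<dots>"
    using assms(1-2) by (intro add_nonneg_nonneg mult_nonneg_nonneg zero_le_power) auto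
  finally show ?thesis .
qed

lemma Gpoly_ge1_hi_e:
  fixes g u n q :: real
  assumes "0 \<le> g" "0 \<le> u"
    "n = (((2 * ((1 + u) + (1 + g)) - 1)^2 - 2 * (1 + g) * (2 * ((1 + u) + (1 + g)) - 1) - 2 * (1 + g) * u))" 
    "q = ((2 * ((1 + u) + (1 + g)) - 1)^2 + 2 * u * (2 * ((1 + u) + (1 + g)) - 1) + 2 * u^2)"
  shows "0 \<le> Gpoly 1 (1 + g) (1 + u) (1 + u) n q"
proof -
  have "Gpoly 1 (1 + g) (1 + u) (1 + u) n q =
      9 + 51*u + 121*u^2 + 153*u^3 + 108*u^4 + 40*u^5 + 6*u^6 + 30*g + 142*g*u + 270*g*u^2
       + 256*g*u^3 + 120*g*u^4 + 22*g*u^5 + 37*g^2 + 141*g^2*u + 202*g^2*u^2 + 128*g^2*u^3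
       + 30*g^2*u^4 + 20*g^3 + 58*g^3*u + 56*g^3*u^2 + 18*g^3*u^3 + 4*g^4 + 8*g^4*u
       + 4*g^4*u^2"
    unfolding Gpoly_def assms(3,4) by algebra
  also have "0 \<le> \<dots>"
    using assms(1-2) by (intro add_nonneg_nonneg mult_nonneg_nonneg zero_le_power) auto
  finally show ?thesis .
qed

text \<open>
  For slack \<open>d < 1\<close> the same coefficients are homogenised in \<open>d\<close> and \<open>k = 1 - d\<close>; as polynomials in
  \<open>d\<close>, \<open>k\<close> and \<open>u\<close> they again have nonnegative coefficients only.
\<close>

lemma Gpoly_lt1_lo_0:
  fixes d k u n q :: real
  assumes "0 < d" "0 \<le> k" "0 \<le> u" and k: "k = 1 - d" and nq:
    "n = 0" "q = 1"
  shows "0 \<le> Gpoly d d (1 + u) 0 n q"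
proof -
  have "Gpoly d d (1 + u) 0 n q =
      2*d*k + 8*d*k*u + 12*d*k*u^2 + 8*d*k*u^3 + 2*d*k*u^4 + 4*d^2 + 14*d^2*u + 18*d^2*u^2
       + 10*d^2*u^3 + 2*d^2*u^4"
    unfolding Gpoly_def nq k by algebra
  also have "0 \<le> \<dots>"
    using assms(1-3) by (intro add_nonneg_nonneg mult_nonneg_nonneg zero_le_power) auto
  finally show ?thesis .
qed

lemma Gpoly_lt1_lo_m:
  fixes d k u n q :: real
  assumes "0 < d" "0 \<le> k" "0 \<le> u" and k: "k = 1 - d" and nq:
    "n = 0" "q = 1"
  shows "0 \<le> 4 * Gpoly d d (1 + u) 0 n q + Gpoly d d (1 + u) (1 + u) n q - Gpoly d d (1 + u) (- (1 + u)) n q"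
proof -
  have "4 * Gpoly d d (1 + u) 0 n q + Gpoly d d (1 + u) (1 + u) n q - Gpoly d d (1 + u) (- (1 + u)) n q =
      8*d*k^3 + 32*d*k^3*u + 48*d*k^3*u^2 + 32*d*k^3*u^3 + 8*d*k^3*u^4 + 28*d^2*k^2
       + 102*d^2*k^2*u + 140*d^2*k^2*u^2 + 86*d^2*k^2*u^3 + 20*d^2*k^2*u^4 + 26*d^3*k
       + 90*d^3*k*u + 118*d^3*k*u^2 + 70*d^3*k*u^3 + 16*d^3*k*u^4 + 4*d^4 + 16*d^4*u
       + 24*d^4*u^2 + 16*d^4*u^3 + 4*d^4*u^4"
    unfolding Gpoly_def nq k by algebra
  also have "0 \<le> \<dots>"
    using assms(1-3) by (intro add_nonneg_nonneg mult_nonneg_nonneg zero_le_power) auto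
  finally show ?thesis .
qed

lemma Gpoly_lt1_lo_e:
  fixes d k u n q :: real
  assumes "0 < d" "0 \<le> k" "0 \<le> u" and k: "k = 1 - d" and nq:
    "n = 0" "q = 1"
  shows "0 \<le> Gpoly d d (1 + u) (1 + u) n q"
proof -
  have "Gpoly d d (1 + u) (1 + u) n q =
      2*d*k^3 + 8*d*k^3*u + 12*d*k^3*u^2 + 8*d*k^3*u^3 + 2*d*k^3*u^4 + 8*d^2*k^2
       + 28*d^2*k^2*u + 37*d^2*k^2*u^2 + 22*d^2*k^2*u^3 + 5*d^2*k^2*u^4 + 8*d^3*k + 26*d^3*k*u
       + 32*d^3*k*u^2 + 18*d^3*k*u^3 + 4*d^3*k*u^4 + d^4 + 4*d^4*u + 6*d^4*u^2 + 4*d^4*u^3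
       + d^4*u^4"
    unfolding Gpoly_def nq k by algebra
  also have "0 \<le> \<dots>"
    using assms(1-3) by (intro add_nonneg_nonneg mult_nonneg_nonneg zero_le_power) auto
  finally show ?thesis .
qed

lemma Gpoly_lt1_hi_0:
  fixes d k u n q :: real
  assumes "0 < d" "0 \<le> k" "0 \<le> u" and k: "k = 1 - d" and nq:
    "n = (d * ((2 * ((1 + u) + d) - d)^2 - 2 * d * (2 * ((1 + u) + d) - d) - 2 * d * d * u))" 
    "q = ((2 * ((1 + u) + d) - d)^2 + 2 * d * u * (2 * ((1 + u) + d) - d) + 2 * d^2 * u^2)"
  shows "0 \<le> Gpoly d d (1 + u) 0 n q"
proof -
  have "Gpoly d d (1 + u) 0 n q =
      8*d*k^6 + 48*d*k^6*u + 120*d*k^6*u^2 + 160*d*k^6*u^3 + 120*d*k^6*u^4 + 48*d*k^6*u^5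
       + 8*d*k^6*u^6 + 56*d^2*k^5 + 316*d^2*k^5*u + 744*d^2*k^5*u^2 + 936*d^2*k^5*u^3
       + 664*d^2*k^5*u^4 + 252*d^2*k^5*u^5 + 40*d^2*k^5*u^6 + 150*d^3*k^4 + 800*d^3*k^4*u
       + 1788*d^3*k^4*u^2 + 2148*d^3*k^4*u^3 + 1466*d^3*k^4*u^4 + 540*d^3*k^4*u^5
       + 84*d^3*k^4*u^6 + 188*d^4*k^3 + 961*d^4*k^3*u + 2080*d^4*k^3*u^2 + 2449*d^4*k^3*u^3
       + 1658*d^4*k^3*u^4 + 612*d^4*k^3*u^5 + 96*d^4*k^3*u^6 + 105*d^5*k^2 + 539*d^5*k^2*u
       + 1196*d^5*k^2*u^2 + 1462*d^5*k^2*u^3 + 1032*d^5*k^2*u^4 + 396*d^5*k^2*u^5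
       + 64*d^5*k^2*u^6 + 18*d^6*k + 119*d^6*k*u + 324*d^6*k*u^2 + 457*d^6*k*u^3
       + 354*d^6*k*u^4 + 144*d^6*k*u^5 + 24*d^6*k*u^6 + 12*d^7*u + 46*d^7*u^2 + 72*d^7*u^3
       + 58*d^7*u^4 + 24*d^7*u^5 + 4*d^7*u^6"
    unfolding Gpoly_def nq k by algebra
  also have "0 \<le> \<dots>"
    using assms(1-3) by (intro add_nonneg_nonneg mult_nonneg_nonneg zero_le_power) auto
  finally show ?thesis .
qed

lemma Gpoly_lt1_hi_m:
  fixes d k u n q :: real
  assumes "0 < d" "0 \<le> k" "0 \<le> u" and k: "k = 1 - d" and nq:
    "n = (d * ((2 * ((1 + u) + d) - d)^2 - 2 * d * (2 * ((1 + u) + d) - d) - 2 * d * d * u))" 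
    "q = ((2 * ((1 + u) + d) - d)^2 + 2 * d * u * (2 * ((1 + u) + d) - d) + 2 * d^2 * u^2)"
  shows "0 \<le> 4 * Gpoly d d (1 + u) 0 n q + Gpoly d d (1 + u) (1 + u) n q - Gpoly d d (1 + u) (- (1 + u)) n q"
proof -
  have "4 * Gpoly d d (1 + u) 0 n q + Gpoly d d (1 + u) (1 + u) n q - Gpoly d d (1 + u) (- (1 + u)) n q =
      32*d*k^6 + 192*d*k^6*u + 480*d*k^6*u^2 + 640*d*k^6*u^3 + 480*d*k^6*u^4 + 192*d*k^6*u^5
       + 32*d*k^6*u^6 + 240*d^2*k^5 + 1352*d^2*k^5*u + 3176*d^2*k^5*u^2 + 3984*d^2*k^5*u^3
       + 2816*d^2*k^5*u^4 + 1064*d^2*k^5*u^5 + 168*d^2*k^5*u^6 + 704*d^3*k^4 + 3752*d^3*k^4*u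
       + 8360*d^3*k^4*u^2 + 9984*d^3*k^4*u^3 + 6752*d^3*k^4*u^4 + 2456*d^3*k^4*u^5
       + 376*d^3*k^4*u^6 + 1004*d^4*k^3 + 5130*d^4*k^3*u + 11018*d^4*k^3*u^2
       + 12766*d^4*k^3*u^3 + 8434*d^4*k^3*u^4 + 3016*d^4*k^3*u^5 + 456*d^4*k^3*u^6
       + 690*d^5*k^2 + 3468*d^5*k^2*u + 7400*d^5*k^2*u^2 + 8580*d^5*k^2*u^3 + 5698*d^5*k^2*u^4
       + 2052*d^5*k^2*u^5 + 312*d^5*k^2*u^6 + 180*d^6*k + 956*d^6*k*u + 2178*d^6*k*u^2
       + 2688*d^6*k*u^3 + 1886*d^6*k*u^4 + 712*d^6*k*u^5 + 112*d^6*k*u^6 + 30*d^7*u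
       + 130*d^7*u^2 + 230*d^7*u^3 + 206*d^7*u^4 + 92*d^7*u^5 + 16*d^7*u^6"
    unfolding Gpoly_def nq k by algebra
  also have "0 \<le> \<dots>"
    using assms(1-3) by (intro add_nonneg_nonneg mult_nonneg_nonneg zero_le_power) auto
  finally show ?thesis .
qed

lemma Gpoly_lt1_hi_e:
  fixes d k u n q :: real
  assumes "0 < d" "0 \<le> k" "0 \<le> u" and k: "k = 1 - d" and nq:
    "n = (d * ((2 * ((1 + u) + d) - d)^2 - 2 * d * (2 * ((1 + u) + d) - d) - 2 * d * d * u))" 
    "q = ((2 * ((1 + u) + d) - d)^2 + 2 * d * u * (2 * ((1 + u) + d) - d) + 2 * d^2 * u^2)"
  shows "0 \<le> Gpoly d d (1 + u) (1 + u) n q"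
proof -
  have "Gpoly d d (1 + u) (1 + u) n q =
      8*d*k^6 + 48*d*k^6*u + 120*d*k^6*u^2 + 160*d*k^6*u^3 + 120*d*k^6*u^4 + 48*d*k^6*u^5
       + 8*d*k^6*u^6 + 64*d^2*k^5 + 360*d^2*k^5*u + 844*d^2*k^5*u^2 + 1056*d^2*k^5*u^3
       + 744*d^2*k^5*u^4 + 280*d^2*k^5*u^5 + 44*d^2*k^5*u^6 + 202*d^3*k^4 + 1076*d^3*k^4*u
       + 2392*d^3*k^4*u^2 + 2844*d^3*k^4*u^3 + 1910*d^3*k^4*u^4 + 688*d^3*k^4*u^5
       + 104*d^3*k^4*u^6 + 318*d^4*k^3 + 1626*d^4*k^3*u + 3479*d^4*k^3*u^2 + 3994*d^4*k^3*u^3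
       + 2599*d^4*k^3*u^4 + 910*d^4*k^3*u^5 + 134*d^4*k^3*u^6 + 256*d^5*k^2 + 1282*d^5*k^2*u
       + 2697*d^5*k^2*u^2 + 3051*d^5*k^2*u^3 + 1958*d^5*k^2*u^4 + 676*d^5*k^2*u^5
       + 98*d^5*k^2*u^6 + 93*d^6*k + 472*d^6*k*u + 1010*d^6*k*u^2 + 1160*d^6*k*u^3
       + 753*d^6*k*u^4 + 262*d^6*k*u^5 + 38*d^6*k*u^6 + 9*d^7 + 51*d^7*u + 121*d^7*u^2
       + 153*d^7*u^3 + 108*d^7*u^4 + 40*d^7*u^5 + 6*d^7*u^6"
    unfolding Gpoly_def nq k by algebra
  also have "0 \<le> \<dots>"
    using assms(1-3) by (intro add_nonneg_nonneg mult_nonneg_nonneg zero_le_power) auto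
  finally show ?thesis .
qed

lemma Gpoly_nonneg_ge1:
  assumes "1 \<le> d" "1 \<le> e" "0 \<le> s" "s \<le> e"
    and q: "q = (2 * (e + d) - 1)^2 + 2 * (e - 1) * (2 * (e + d) - 1) + 2 * (e - 1)^2"
    and n: "n = (2 * (e + d) - 1)^2 - 2 * d * (2 * (e + d) - 1) - 2 * d * (e - 1)"
    and X: "0 \<le> X" "q * X \<le> n"
  shows "0 \<le> Gpoly 1 d e s X 1"
proof -
  define g where "g = d - 1"
  define u where "u = e - 1"
  have gu: "0 \<le> g" "0 \<le> u" "d = 1 + g" "e = 1 + u"
    using assms by (auto simp: g_def u_def)
  have "0 < (2 * (e + d) - 1)^2" using assms by simp
  then have q0: "0 < q"
    unfolding q using assms by (intro add_pos_nonneg mult_nonneg_nonneg) auto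
  have q': "q = (2 * (1 + u + (1 + g)) - 1)\<^sup>2 + 2 * u * (2 * (1 + u + (1 + g)) - 1) + 2 * u\<^sup>2"
    and n': "n = (2 * (1 + u + (1 + g)) - 1)\<^sup>2 - 2 * (1 + g) * (2 * (1 + u + (1 + g)) - 1) - 2 * (1 + g) * u"
    unfolding q n gu by (simp_all add: add.assoc)
  have "0 \<le> Gpoly 1 d e s 0 1"
    using assms(3,4) gu unfolding gu(3,4)
    by (intro Gpoly_quadratic[OF _ _ _ Gpoly_ge1_lo_0[OF gu(1,2) refl refl] Gpoly_ge1_lo_e[OF gu(1,2) refl refl] Gpoly_ge1_lo_m[OF gu(1,2) refl refl]]) auto
  moreover have "0 \<le> Gpoly 1 d e s n q"
    using assms(3,4) gu unfolding gu(3,4)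
    by (intro Gpoly_quadratic[OF _ _ _ Gpoly_ge1_hi_0[OF gu(1,2) n' q'] Gpoly_ge1_hi_e[OF gu(1,2) n' q'] Gpoly_ge1_hi_m[OF gu(1,2) n' q']]) auto
  ultimately show ?thesis
    using Gpoly_affine X q0 by blast
qed

lemma Gpoly_nonneg_lt1:
  assumes "0 < d" "d \<le> 1" "1 \<le> e" "0 \<le> s" "s \<le> e"
    and q: "q = (2 * (e + d) - d)^2 + 2 * d * (e - 1) * (2 * (e + d) - d) + 2 * d^2 * (e - 1)^2"
    and n: "n = d * ((2 * (e + d) - d)^2 - 2 * d * (2 * (e + d) - d) - 2 * d * d * (e - 1))"
    and X: "0 \<le> X" "q * X \<le> n"
  shows "0 \<le> Gpoly d d e s X 1"
proof -
  define u where "u = e - 1"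
  have gu: "0 \<le> u" "e = 1 + u"
    using assms by (auto simp: u_def)
  have "0 < (2 * (e + d) - d)^2" using assms by simp
  then have q0: "0 < q"
    unfolding q using assms by (intro add_pos_nonneg mult_nonneg_nonneg) auto
  have q': "q = (2 * (1 + u + d) - d)\<^sup>2 + 2 * d * u * (2 * (1 + u + d) - d) + 2 * d\<^sup>2 * u\<^sup>2"
    and n': "n = d * ((2 * (1 + u + d) - d)\<^sup>2 - 2 * d * (2 * (1 + u + d) - d) - 2 * d * d * u)"
    unfolding q n gu by simp_all
  have k: "0 \<le> 1 - d" using assms by simp
  have "0 \<le> Gpoly d d e s 0 1"
    using assms(4,5) gu unfolding gu(2)
    by (intro Gpoly_quadratic[OF _ _ _ Gpoly_lt1_lo_0[OF assms(1) k gu(1) refl refl refl] Gpoly_lt1_lo_e[OF assms(1) k gu(1) refl refl refl] Gpoly_lt1_lo_m[OF assms(1) k gu(1) refl refl refl]]) auto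
  moreover have "0 \<le> Gpoly d d e s n q"
    using assms(4,5) gu unfolding gu(2)
    by (intro Gpoly_quadratic[OF _ _ _ Gpoly_lt1_hi_0[OF assms(1) k gu(1) refl n' q'] Gpoly_lt1_hi_e[OF assms(1) k gu(1) refl n' q'] Gpoly_lt1_hi_m[OF assms(1) k gu(1) refl n' q']]) auto
  ultimately show ?thesis
    using Gpoly_affine X q0 by blast
qed

text \<open>
  The inequality on which the tilting estimate rests. Here \<open>J + b2 * s\<close> is the integral over
  \<open>0 \<le> p \<le> m / l\<close> of \<open>1 - b * (1 + (e - s) * ((1 - p) powr - e - 1) / e)\<close>, with \<open>e - s\<close> in the
  role of \<open>E[E S - S | S < \<lambda>]\<close>. The term with \<open>l + 1\<close> is the loss caused by means below \<open>1\<close>. The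
  value \<open>b\<close> enters through \<open>J\<close>, which lies between \<open>0\<close> and the rational bound that
  \<open>one_minus_powr_le\<close> provides.
\<close>

lemma final_inequality:
  fixes d e s :: real
  assumes "0 < d" "1 < e" "0 \<le> s" "s \<le> e"
  defines "m \<equiv> min 1 d" and "l \<equiv> e + d"
  defines "b \<equiv> m * (1 - m / l) powr e"
  defines "J \<equiv> (b - d / l) / (e - 1)"
  defines "b2 \<equiv> (m / l * (1 - b) - J) / e"
  shows "0 \<le> b + b2 * (e - 1) * l - (2 * e + d - 1 - s) * (m * (l + 1) / (2 * e)) * (J + b2 * s)"
proof -
  define u where "u = e - 1"
  have m: "0 < m" "m \<le> 1" "m \<le> d"
    using assms(1) unfolding m_def by simp_all
  have md: "m = 1 \<or> m = d"
    unfolding m_def by (simp add: min_def)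
  have l: "0 < l" "m < l" "l = e + d" "1 < l"
    using assms(1-2) m(2) unfolding l_def by linarith+
  have u: "0 < u" "e = u + 1" using assms(2) by (auto simp: u_def)
  (* y = m / l in one_minus_powr_le, scaled by l: the bound for b becomes X \<le> n / q *)
  define X where "X = l * J"
  have Xu: "X * u = l * b - d"
  proof -
    have "J * u = b - d / l" unfolding J_def u_def using assms(2) by simp
    then have "l * (J * u) = l * (b - d / l)" by simp
    then show ?thesis using l by (simp add: X_def right_diff_distrib mult.assoc)
  qed
  define w where "w = 2 * l - m"
  define q where "q = w^2 + 2 * m * u * w + 2 * m^2 * u^2"
  define n where "n = m * (w^2 - 2 * d * w - 2 * m * d * u)"
  have w: "0 < w" using l m by (simp add: w_def)
  have q0: "0 < q" unfolding q_def using w m(1) u(1) by (intro add_pos_nonneg mult_nonneg_nonneg) simp_all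
  have X0: "0 \<le> X"
  proof -
    have "1 + e * (- (m / l)) \<le> (1 + - (m / l)) powr e"
      using l m assms(2) by (intro Bernoulli_powr_ge) (auto simp: divide_simps)
    then have "m * (1 - e * m / l) \<le> b"
      unfolding b_def using m by (intro mult_left_mono) auto
    then have "l * (m * (1 - e * m / l)) \<le> l * b" using l by simp
    then have "m * l - e * m^2 \<le> l * b"
      using l(1) by (simp add: right_diff_distrib power2_eq_square mult_ac)
    moreover have "0 \<le> m * l - e * m^2 - d"
    proof -
      from md show ?thesis
      proof
        assume "m = d"
        then have "m * l - e * m^2 - d = d * ((e - 1) * (1 - d))"
          using l by (simp add: algebra_simps power2_eq_square)
        then show ?thesis using assms m \<open>m = d\<close> by simp
      qed (use l in simp)
    qed
    ultimately have "0 \<le> X * u" using Xu by simp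
    then show ?thesis using u by (simp add: zero_le_mult_iff)
  qed
  have qX: "q * X \<le> n"
  proof -
    define y where "y = m / l"
    have y: "0 < y" "y < 1" "y * l = m" using m l by (auto simp: y_def)
    have den: "((2 - y)\<^sup>2 + 2 * y * u * (2 - y) + 2 * y\<^sup>2 * u\<^sup>2) * l^2 = q"
      unfolding q_def w_def y(3)[symmetric] by algebra
    have "(1 - y) powr e \<le> (1 - y) * (2 - y)\<^sup>2 / ((2 - y)\<^sup>2 + 2 * y * u * (2 - y) + 2 * y\<^sup>2 * u\<^sup>2)"
      using one_minus_powr_le[of y e] y assms by (simp add: u_def)
    also have "\<dots> = (1 - y) * (2 - y)\<^sup>2 * l^2 / q"
      using l unfolding den[symmetric] by simp
    also have "(1 - y) * (2 - y)\<^sup>2 * l^2 = (1 - y) * w^2"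
      unfolding w_def y(3)[symmetric] by algebra
    finally have "b \<le> m * ((1 - y) * w^2 / q)"
      unfolding b_def y_def using m by (intro mult_left_mono) auto
    then have "b * (q * l) \<le> m * ((1 - y) * w^2 / q) * (q * l)"
      using q0 l by (intro mult_right_mono) auto
    also have "\<dots> = m * (l - y * l) * w^2"
      using q0 by (simp add: field_simps)
    finally have "q * (l * b) \<le> m * (l - m) * w^2"
      using y by (simp add: mult.commute mult.left_commute)
    then have "q * (X * u) \<le> m * (l - m) * w^2 - d * q"
      unfolding Xu by (simp add: algebra_simps)
    also have "m * (l - m) * w^2 - d * q = n * u"
    proof -
      have "m * (l - m) = m * u + d"
        using md unfolding l(3) u(2) by (auto simp: algebra_simps)
      then show ?thesis unfolding n_def q_def by (simp add: algebra_simps power2_eq_square)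
    qed
    finally show ?thesis using u by (simp add: mult.assoc[symmetric])
  qed
  have G: "0 \<le> Gpoly m d e s X 1"
  proof (cases "d < 1")
    case True
    then have "m = d" by (simp add: m_def)
    show ?thesis
      unfolding \<open>m = d\<close>
    proof (rule Gpoly_nonneg_lt1)
      show "q = (2 * (e + d) - d)^2 + 2 * d * (e - 1) * (2 * (e + d) - d) + 2 * d^2 * (e - 1)^2"
        and "n = d * ((2 * (e + d) - d)^2 - 2 * d * (2 * (e + d) - d) - 2 * d * d * (e - 1))"
        unfolding q_def n_def w_def l(3) u_def \<open>m = d\<close> by simp_all
    qed (use assms(1-4) True X0 qX in auto)
  next
    case False
    then have "m = 1" by (simp add: m_def)
    show ?thesis
      unfolding \<open>m = 1\<close>
    proof (rule Gpoly_nonneg_ge1)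
      show "q = (2 * (e + d) - 1)^2 + 2 * (e - 1) * (2 * (e + d) - 1) + 2 * (e - 1)^2"
        and "n = (2 * (e + d) - 1)^2 - 2 * d * (2 * (e + d) - 1) - 2 * d * (e - 1)"
        unfolding q_def n_def w_def l(3) u_def \<open>m = 1\<close> by simp_all
    qed (use assms(1-4) False X0 qX in auto)
  qed
  define B where "B = e * l^2 * b2"
  have b': "l * b = d + (e - 1) * X"
    using Xu u by (simp add: algebra_simps)
  have Bb: "B = m * l - m * (d + (e - 1) * X) - l * X"
  proof -
    have "B = l * (m - m * b) - l^2 * J"
    proof -
      have "e * b2 = m / l * (1 - b) - J" using assms(2) by (simp add: b2_def)
      moreover have "m / l * l = m" using l by simp
      ultimately show ?thesis unfolding B_def by algebra
    qed
    also have "\<dots> = m * l - m * (l * b) - l * (l * J)"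
      by (simp add: algebra_simps power2_eq_square)
    finally show ?thesis unfolding b' X_def[symmetric] .
  qed
  define R where "R = b + b2 * (e - 1) * l - (2 * e + d - 1 - s) * (m * (l + 1) / (2 * e)) * (J + b2 * s)"
  have "2 * e^2 * l^2 * R = 2 * e^2 * l * (l * b) + 2 * e * (e - 1) * l * B
     - (2 * e + d - 1 - s) * m * (l + 1) * (e * l * (l * J) + s * B)"
  proof -
    define t where "t = m * (l + 1) / (2 * e)"
    have "2 * e * t = m * (l + 1)" using assms(2) by (simp add: t_def)
    then show ?thesis
      unfolding R_def B_def t_def[symmetric] by algebra
  qed
  also have "\<dots> = Gpoly m d e s X 1"
    unfolding b' Bb X_def[symmetric] unfolding Gpoly_def l(3) by algebra
  finally have "0 \<le> 2 * e^2 * l^2 * R" using G by simp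
  moreover have "0 < 2 * e^2 * l^2" using assms(2) l(1) by simp
  ultimately have "0 \<le> R" by (smt (verit) mult_pos_neg)
  then show ?thesis by (simp add: R_def)
qed

section \<open>Tilting a sum of independent two-point variables\<close>

text \<open>
  One summand of \<open>u_derivative_bound\<close>: \<open>a1\<close> and \<open>a0\<close> are the probabilities of \<open>S \<ge> \<lambda>\<close> given
  \<open>X = L\<close> and \<open>X = 0\<close>. The coefficients of \<open>a0\<close> alone cancel, which is what singles out this
  tilting.
\<close>

lemma tilt_identity:
  fixes r L c t V a0 a1 :: real
  assumes "r * L = c - t * V" "V = c * (L - c)"
  shows "r * L * a1 + V * (1 + c * t) * a0 -
      ((r * a1 + (1 - r) * a0) * (V - (1 - c) * V * t) + c * (r * a1 + (1 - r) * a0)) =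
    r * (L - c) * (1 - c * (1 - (1 - c) * t)) * (a1 - a0)"
proof -
  have eq: "r * (L - c) * (1 - c * (1 - (1 - c) * t)) = r * L - r * (V - (1 - c) * V * t + c)"
    unfolding assms(2) by (simp add: algebra_simps)
  show ?thesis unfolding eq assms(1) by (simp add: algebra_simps)
qed

lemma threshold_identity: "F * (V - d - T) = F * (V - T) + C * F - (d + C) * (F :: real)"
  by (simp add: algebra_simps)

text \<open>
  Independent \<open>X\<^sub>i\<close> with the values \<open>0\<close> and \<open>L i\<close> and the mean \<open>c i\<close>; the slack \<open>d\<close> is the distance of
  the threshold from the mean of the sum.
\<close>

locale two_point_sum =
  fixes I :: "'i set" and L c :: "'i \<Rightarrow> real" and d :: real
  assumes finite_I: "finite I" and d_pos: "0 < d"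
    and c_pos: "\<And>i. i \<in> I \<Longrightarrow> 0 < c i" and c_le_1: "\<And>i. i \<in> I \<Longrightarrow> c i \<le> 1"
    and c_less_L: "\<And>i. i \<in> I \<Longrightarrow> c i < L i"
begin

definition q :: "'i \<Rightarrow> real" where "q i = c i / L i"
definition lam :: real where "lam = d + (\<Sum>i\<in>I. c i)"
definition below :: "real \<Rightarrow> real" where "below s = (if s < lam then 1 else 0)"
definition var :: "'i \<Rightarrow> real" where "var i = c i * (L i - c i)"
definition W :: real where "W = texp q L I below"

text \<open>
  The conditional probabilities of \<open>S < lam\<close> given \<open>X\<^sub>i = 0\<close> and, for \<open>W1\<close>, given \<open>X\<^sub>i = L i\<close>.
\<close>

definition W0 :: "'i \<Rightarrow> real" where "W0 i = texp q L (I - {i}) below"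
definition W1 :: "'i \<Rightarrow> real" where "W1 i = texp q L (I - {i}) (\<lambda>s. below (s + L i))"
definition deficit :: "'i \<Rightarrow> real" where "deficit i = c i * (W - W1 i)"
definition N :: real where "N = (\<Sum>i\<in>I. deficit i)"

lemma L_pos: "i \<in> I \<Longrightarrow> 0 < L i"
  using c_pos[of i] c_less_L[of i] by simp

lemma q_range: "i \<in> I \<Longrightarrow> 0 < q i" "i \<in> I \<Longrightarrow> q i < 1"
  using c_pos[of i] c_less_L[of i] L_pos[of i] by (auto simp: q_def)

lemma q_L: "i \<in> I \<Longrightarrow> q i * L i = c i"
  using L_pos[of i] by (simp add: q_def)

lemma q_var: "i \<in> I \<Longrightarrow> q i * (L i - c i) = (1 - q i) * c i"
  using q_L[of i] by (simp add: algebra_simps)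

lemma var_pos: "i \<in> I \<Longrightarrow> 0 < var i"
  using c_pos[of i] c_less_L[of i] by (simp add: var_def)

lemma below_range: "0 \<le> below s" "below s \<le> 1"
  by (simp_all add: below_def)

lemma W_split: "i \<in> I \<Longrightarrow> W = q i * W1 i + (1 - q i) * W0 i"
  unfolding W_def W0_def W1_def using finite_I by (rule texp_remove)

lemma W1_nonneg: "0 \<le> W1 i"
  unfolding W1_def using finite_I q_range
  by (intro texp_nonneg below_range) (auto simp: less_imp_le)

lemma W1_le_W0: "i \<in> I \<Longrightarrow> W1 i \<le> W0 i"
  unfolding W1_def W0_def using finite_I q_range L_pos[of i]
  by (intro texp_mono) (auto simp: less_imp_le below_def)

lemma W_minus_W1: "i \<in> I \<Longrightarrow> W - W1 i = (1 - q i) * (W0 i - W1 i)"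
  by (subst W_split[of i]) (auto simp: algebra_simps)

lemma W1_le_W: "i \<in> I \<Longrightarrow> W1 i \<le> W"
  using W_minus_W1[of i] W1_le_W0[of i] q_range(2)[of i]
  by (smt (verit) mult_nonneg_nonneg)

lemma deficit_nonneg: "i \<in> I \<Longrightarrow> 0 \<le> deficit i"
  using W1_le_W[of i] c_pos[of i] by (simp add: deficit_def)

text \<open>
  Given \<open>W\<close>, the conditional probabilities for \<open>X\<^sub>i = L i\<close> and \<open>X\<^sub>i = 0\<close> determine each other.
\<close>

lemma deficit_eq: 
  assumes "i \<in> I"
  shows "deficit i = (L i - c i) * (W0 i - W)"
proof -
  have "L i * W = c i * W1 i + (L i - c i) * W0 i"
    using W_split[OF assms] q_L[OF assms] by algebra
  then show ?thesis by (simp add: deficit_def algebra_simps)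
qed

lemma N_nonneg: "0 \<le> N"
  unfolding N_def by (intro sum_nonneg deficit_nonneg)

lemma texp_s_below: "texp q L I (\<lambda>s. s * below s) = (\<Sum>i\<in>I. c i * W1 i)"
  unfolding texp_times_sum[OF finite_I] W1_def by (intro sum.cong refl) (simp add: q_L)

lemma texp_s: "texp q L I (\<lambda>s. s) = (\<Sum>i\<in>I. c i)"
  using texp_times_sum[OF finite_I, of q L "\<lambda>_. 1"] finite_I
  by (simp add: texp_const q_L)

text \<open>
  \<open>N / W\<close> is the amount by which conditioning on \<open>S < lam\<close> decreases the mean of \<open>S\<close>, and
  \<open>deficit i / W\<close> is the share of the variable \<open>X\<^sub>i\<close>.
\<close>

lemma N_eq: "N = texp q L I (\<lambda>s. (sum c I - s) * below s)"
proof -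
  have "texp q L I (\<lambda>s. (sum c I - s) * below s) = sum c I * W - (\<Sum>i\<in>I. c i * W1 i)"
    unfolding texp_s_below[symmetric] W_def
    by (simp add: left_diff_distrib texp_diff texp_cmult)
  then show ?thesis
    by (simp add: N_def deficit_def right_diff_distrib sum_subtractf sum_distrib_right)
qed

text \<open>
  From \<open>max 0 x = x + max 0 (- x)\<close>, as \<open>S - lam\<close> has mean \<open>- d\<close>.
\<close>

lemma overshoot_eq: "texp q L I (\<lambda>s. max 0 (s - lam)) = N + d * W - d"
proof -
  have "max 0 (s - lam) = (s - lam) + ((sum c I - s) * below s + d * below s)" for s
    by (simp add: below_def lam_def)
  then have "texp q L I (\<lambda>s. max 0 (s - lam)) = (sum c I - lam) + (N + d * W)"
    unfolding N_eq W_def by (simp only: texp_add texp_diff texp_cmult texp_s texp_const[OF finite_I])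
  then show ?thesis by (simp add: lam_def)
qed

lemma Markov_bound: "d \<le> N + d * W"
proof -
  have "0 \<le> texp q L I (\<lambda>s. max 0 (s - lam))"
    using finite_I q_range by (intro texp_nonneg) (auto simp: less_imp_le)
  then show ?thesis by (simp add: overshoot_eq)
qed

lemma W_pos: "0 < W"
proof (rule ccontr)
  assume "\<not> 0 < W"
  then have "deficit i \<le> 0" if "i \<in> I" for i
    using W1_nonneg[of i] c_pos[OF that] by (auto simp: deficit_def mult_le_0_iff)
  then have "N \<le> 0" unfolding N_def by (rule sum_nonpos)
  moreover have "d * W \<le> 0" using \<open>\<not> 0 < W\<close> d_pos by (simp add: mult_le_0_iff)
  ultimately show False using Markov_bound d_pos by simp
qed

text \<open>
  Put \<open>Z = E S - S\<close>. On \<open>S < lam\<close> the product \<open>(lam - S) Z\<close> splits into contributions of the single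
  variables, and \<open>max 0 (lam - S)\<close> drops by at most \<open>L i\<close> when \<open>X\<^sub>i\<close> jumps; this bounds
  \<open>E[(Z\<^sup>2 + d Z); S < lam]\<close> by the right side divided by \<open>W\<close>. By the Cauchy-Schwarz inequality
  \<open>E[Z\<^sup>2; S < lam] \<ge> N\<^sup>2 / W\<close>.
\<close>

lemma second_moment_bound:
  "N * (N + d * W) \<le> W * (W * (\<Sum>i\<in>I. var i) + (\<Sum>i\<in>I. c i * deficit i))"
proof -
  let ?C = "sum c I"
  define T where "T = texp q L I (\<lambda>s. (?C - s)\<^sup>2 * below s)"
  (* the Cauchy-Schwarz inequality, for W * (?C - S), whose mean given S < lam is N *)
  have "0 \<le> texp q L I (\<lambda>s. (W * (?C - s) - N)\<^sup>2 * below s)"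
    using finite_I q_range below_range by (intro texp_nonneg) (auto simp: less_imp_le)
  also have "(\<lambda>s. (W * (?C - s) - N)\<^sup>2 * below s) = (\<lambda>s. W\<^sup>2 * ((?C - s)\<^sup>2 * below s) -
      2 * W * N * ((?C - s) * below s) + N\<^sup>2 * below s)"
    by (rule ext) algebra
  also have "texp q L I \<dots> = W\<^sup>2 * T - 2 * W * N * N + N\<^sup>2 * W"
    by (simp only: texp_add texp_diff texp_cmult T_def[symmetric] N_eq[symmetric] W_def[symmetric])
  also have "\<dots> = W * (W * T - N\<^sup>2)" by (simp add: algebra_simps power2_eq_square)
  finally have 1: "N\<^sup>2 \<le> W * T"
    using W_pos by (simp add: zero_le_mult_iff)
  have "T + d * N = texp q L I (\<lambda>s. ?C * ((lam - s) * below s) + s * ((s - lam) * below s))"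
  proof -
    have "?C * ((lam - s) * below s) + s * ((s - lam) * below s) =
        (?C - s)\<^sup>2 * below s + d * ((?C - s) * below s)" for s
      unfolding lam_def by algebra
    then show ?thesis by (simp only: texp_add texp_cmult T_def N_eq)
  qed
  also have "\<dots> = (\<Sum>i\<in>I. c i * texp q L I (\<lambda>s. (lam - s) * below s) +
      c i * texp q L (I - {i}) (\<lambda>s. (s + L i - lam) * below (s + L i)))"
    unfolding texp_add texp_cmult texp_times_sum[OF finite_I]
    unfolding sum.distrib sum_distrib_right
    by (intro arg_cong2[where f = "(+)"] sum.cong refl) (simp add: q_L)
  also have "\<dots> \<le> (\<Sum>i\<in>I. c i * ((1 - q i) * (L i * W0 i)))"
  proof (intro sum_mono)
    fix i assume i: "i \<in> I"
    let ?E = "texp q L (I - {i})"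
    have "texp q L I (\<lambda>s. (lam - s) * below s) + ?E (\<lambda>s. (s + L i - lam) * below (s + L i)) =
      (1 - q i) * ?E (\<lambda>s. (lam - s) * below s + (s + L i - lam) * below (s + L i))"
    proof -
      have "?E (\<lambda>s. (lam - (s + L i)) * below (s + L i)) = ?E (\<lambda>s. (-1) * ((s + L i - lam) * below (s + L i)))"
        by (simp add: algebra_simps)
      then have "?E (\<lambda>s. (lam - (s + L i)) * below (s + L i)) = - ?E (\<lambda>s. (s + L i - lam) * below (s + L i))"
        unfolding texp_cmult by simp
      moreover have "x = a * y + (1 - a) * z \<Longrightarrow> y = - w \<Longrightarrow> x + w = (1 - a) * (z + w)"
        for a w x y z :: real by algebra
      ultimately show ?thesis
        unfolding texp_add using texp_remove[OF finite_I i, of q L "\<lambda>s. (lam - s) * below s"] by blast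
    qed
    also have "\<dots> \<le> (1 - q i) * ?E (\<lambda>s. L i * below s)"
      using finite_I q_range i L_pos[OF i]
      by (intro mult_left_mono texp_mono) (auto simp: less_imp_le below_def)
    finally have "texp q L I (\<lambda>s. (lam - s) * below s) + ?E (\<lambda>s. (s + L i - lam) * below (s + L i))
        \<le> (1 - q i) * (L i * W0 i)"
      by (simp add: texp_cmult W0_def)
    then show "c i * texp q L I (\<lambda>s. (lam - s) * below s) +
      c i * ?E (\<lambda>s. (s + L i - lam) * below (s + L i)) \<le> c i * ((1 - q i) * (L i * W0 i))"
      unfolding distrib_left[symmetric] using c_pos[OF i] by (intro mult_left_mono) auto
  qed
  also have "\<dots> = (\<Sum>i\<in>I. W * var i + c i * deficit i)"
  proof (intro sum.cong refl)
    fix i assume i: "i \<in> I"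
    have "(1 - q i) * L i = L i - c i" using q_L[OF i] by (simp add: algebra_simps)
    then have "c i * ((1 - q i) * (L i * W0 i)) = c i * ((L i - c i) * W0 i)"
      by (simp add: mult.assoc[symmetric])
    also have "(L i - c i) * W0 i = deficit i + (L i - c i) * W"
      using deficit_eq[OF i] by (simp add: algebra_simps)
    finally show "c i * ((1 - q i) * (L i * W0 i)) = W * var i + c i * deficit i"
      by (simp add: var_def algebra_simps)
  qed
  finally have "T + d * N \<le> W * (\<Sum>i\<in>I. var i) + (\<Sum>i\<in>I. c i * deficit i)"
    by (simp add: sum.distrib sum_distrib_left)
  then have "W * (T + d * N) \<le> W * (W * (\<Sum>i\<in>I. var i) + (\<Sum>i\<in>I. c i * deficit i))"
    using W_pos by (intro mult_left_mono) auto
  moreover have "N * (N + d * W) \<le> W * (T + d * N)"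
    using 1 by (simp add: algebra_simps power2_eq_square)
  ultimately show ?thesis by simp
qed

text \<open>
  The density of the tilted law of \<open>X\<^sub>i\<close> is \<open>1 - tilt p i * (X\<^sub>i - c i)\<close>. The choice of \<open>tilt\<close> makes
  its value at \<open>X\<^sub>i = 0\<close> equal to \<open>(1 - p) powr - c i\<close>, see \<open>tilt_eq\<close>.
\<close>

definition tilt :: "real \<Rightarrow> 'i \<Rightarrow> real" where "tilt p i = ((1 - p) powr (- c i) - 1) / c i"
definition r :: "real \<Rightarrow> 'i \<Rightarrow> real" where "r p i = q i * (1 - tilt p i * (L i - c i))"
definition f :: "real \<Rightarrow> real" where "f p = texp (r p) L I below"
definition u :: "real \<Rightarrow> real" where "u p = (1 - p) * texp (r p) L I (\<lambda>s. max 0 (s - lam))"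

lemma r_0: "i \<in> I \<Longrightarrow> r 0 i = q i"
  by (simp add: r_def tilt_def)

lemma f_0: "f 0 = W"
  unfolding f_def W_def by (intro texp_cong) (auto simp: r_0)

lemma u_0: "u 0 = N + d * W - d"
  unfolding u_def overshoot_eq[symmetric] by (simp add: texp_cong[OF r_0 refl])

lemma tilt_eq: "i \<in> I \<Longrightarrow> 1 + c i * tilt p i = (1 - p) powr (- c i)"
  using c_pos[of i] by (simp add: tilt_def)

lemma tilt_nonneg:
  assumes "i \<in> I" "0 \<le> p" "p < 1"
  shows "0 \<le> tilt p i"
proof -
  have "(1 - p) powr 0 \<le> (1 - p) powr (- c i)"
    using assms c_pos[of i] by (intro powr_mono') auto
  then show ?thesis using assms c_pos[of i] by (simp add: tilt_def)
qed

text \<open>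
  Bernoulli's inequality for the exponent \<open>c i \<le> 1\<close>.
\<close>

lemma tilt_le:
  assumes "i \<in> I" "0 \<le> p" "p < 1"
  shows "tilt p i \<le> p / (1 - p)"
proof -
  have "(1 + p / (1 - p)) powr c i \<le> 1 + c i * (p / (1 - p))"
    using assms c_pos[of i] c_le_1[of i] by (intro Bernoulli_powr_le) (auto simp: less_imp_le intro: less_le_trans[of _ 0])
  moreover have "1 + p / (1 - p) = inverse (1 - p)"
    using assms by (simp add: field_simps)
  ultimately have "(1 - p) powr (- c i) \<le> 1 + c i * (p / (1 - p))"
    using assms by (simp add: powr_minus inverse_powr)
  then have "(1 - p) powr (- c i) - 1 \<le> p / (1 - p) * c i"
    by (simp add: mult.commute)
  then show ?thesis
    unfolding tilt_def using c_pos[OF assms(1)] by (simp only: pos_divide_le_eq)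
qed

lemma tilt_mono:
  assumes "i \<in> I" "0 \<le> p" "p \<le> p'" "p' < 1"
  shows "tilt p i \<le> tilt p' i"
proof -
  have "(1 - p) powr (- c i) \<le> (1 - p') powr (- c i)"
    using assms c_pos[of i] by (intro powr_mono2') auto
  then show ?thesis using c_pos[OF assms(1)] by (simp add: tilt_def divide_right_mono)
qed

lemma one_minus_r: "i \<in> I \<Longrightarrow> 1 - r p i = (1 - q i) * (1 - p) powr (- c i)"
  using q_var[of i] by (simp add: r_def tilt_eq[symmetric]) algebra

text \<open>
  The probabilities of the tilted law are in \<open>[0, 1]\<close>.
\<close>

definition tiltable :: "real \<Rightarrow> bool" where
  "tiltable p \<longleftrightarrow> 0 \<le> p \<and> p < 1 \<and> (\<forall>i\<in>I. tilt p i * (L i - c i) \<le> 1)"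

lemma tiltable_mono:
  assumes "tiltable p" "0 \<le> p'" "p' \<le> p"
  shows "tiltable p'"
  unfolding tiltable_def
proof (intro conjI ballI)
  fix i assume i: "i \<in> I"
  have "tilt p' i * (L i - c i) \<le> tilt p i * (L i - c i)"
    using assms i tilt_mono[of i p' p] c_less_L[OF i] by (intro mult_right_mono) (auto simp: tiltable_def)
  also have "\<dots> \<le> 1" using assms i by (simp add: tiltable_def)
  finally show "tilt p' i * (L i - c i) \<le> 1" .
qed (use assms in \<open>auto simp: tiltable_def\<close>)

lemma r_range:
  assumes "tiltable p" "i \<in> I"
  shows "0 \<le> r p i" "r p i \<le> 1"
proof -
  show "0 \<le> r p i"
    using assms q_range[of i] by (simp add: r_def tiltable_def)
  have "0 \<le> (1 - q i) * (1 - p) powr (- c i)"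
    using q_range[OF assms(2)] by simp
  then show "r p i \<le> 1" using one_minus_r[OF assms(2), of p] by simp
qed

lemma r_le:
  assumes "tiltable p" "i \<in> I"
  shows "r p i \<le> q i * (1 / (1 - p)) powr (c i - L i)"
proof -
  let ?a = "L i - c i"
  have p: "0 \<le> p" "p < 1" using assms by (auto simp: tiltable_def)
  have "1 + - c i * ln (1 - p) \<le> exp (- c i * ln (1 - p))"
    by (rule exp_ge_add_one_self)
  then have "- ln (1 - p) \<le> tilt p i"
    using p c_pos[OF assms(2)] by (simp add: tilt_def powr_def divide_simps mult.commute)
  then have "(- ln (1 - p)) * ?a \<le> tilt p i * ?a"
    using c_less_L[OF assms(2)] by (intro mult_right_mono) auto
  then have "1 - tilt p i * ?a \<le> 1 + ln (1 - p) * ?a"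
    by simp
  also have "\<dots> \<le> exp (ln (1 - p) * ?a)"
    by (rule exp_ge_add_one_self)
  also have "\<dots> = (1 / (1 - p)) powr (c i - L i)"
    using p by (simp add: powr_def ln_div algebra_simps)
  finally show ?thesis
    unfolding r_def using q_range[OF assms(2)] by (intro mult_left_mono) auto
qed

lemma r_has_real_derivative:
  assumes "i \<in> I" "p < 1"
  shows "((\<lambda>p. r p i) has_real_derivative - (q i * (L i - c i)) * (1 - p) powr (- c i - 1)) (at p)"
  unfolding r_def tilt_def using assms c_pos[OF assms(1)]
  by (auto intro!: derivative_eq_intros)

lemma f_has_real_derivative:
  assumes "p < 1"
  shows "(f has_real_derivative (\<Sum>i\<in>I. (q i * (L i - c i)) * (1 - p) powr (- c i - 1) *
    texp (r p) L (I - {i}) (\<lambda>s. below s - below (s + L i)))) (at p)"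
proof -
  have "((\<lambda>p. texp (r p) L I below) has_real_derivative
    (\<Sum>i\<in>I. (- (q i * (L i - c i)) * (1 - p) powr (- c i - 1)) *
      (texp (r p) L (I - {i}) (\<lambda>s. below (s + L i)) - texp (r p) L (I - {i}) below))) (at p)"
    using assms finite_I by (intro texp_has_real_derivative r_has_real_derivative) auto
  also have "(\<Sum>i\<in>I. (- (q i * (L i - c i)) * (1 - p) powr (- c i - 1)) *
      (texp (r p) L (I - {i}) (\<lambda>s. below (s + L i)) - texp (r p) L (I - {i}) below)) =
    (\<Sum>i\<in>I. (q i * (L i - c i)) * (1 - p) powr (- c i - 1) *
      texp (r p) L (I - {i}) (\<lambda>s. below s - below (s + L i)))"
    unfolding texp_diff by (intro sum.cong refl) algebra
  finally show ?thesis unfolding f_def[abs_def] .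
qed

text \<open>
  The derivative of \<open>f\<close> is carried by the event that \<open>X\<^sub>i\<close> is pivotal, that is, that the other
  variables have a sum \<open>s\<close> with \<open>lam - L i \<le> s < lam\<close>. There the density of the tilted law of the
  other variables is at most \<open>(1 / (1 - p)) powr (L i - c i - d)\<close>, and the probability of the event
  under the original law is a multiple of \<open>deficit i\<close>.
\<close>

lemma f_derivative_bound:
  assumes "tiltable p" "\<And>i. i \<in> I \<Longrightarrow> L i \<le> e + d"
  shows "(\<Sum>i\<in>I. (q i * (L i - c i)) * (1 - p) powr (- c i - 1) *
    texp (r p) L (I - {i}) (\<lambda>s. below s - below (s + L i))) \<le> N * (1 - p) powr (- e - 1)"
  unfolding N_def sum_distrib_right
proof (intro sum_mono)
  fix i assume i: "i \<in> I"
  have p: "0 \<le> p" "p < 1" using assms by (auto simp: tiltable_def)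
  define v where "v = 1 / (1 - p)"
  have v: "1 \<le> v" using p by (simp add: v_def)
  have vp: "(1 - p) powr x = v powr (- x)" for x
    using p by (simp add: v_def powr_divide powr_minus divide_simps)
  let ?g = "\<lambda>s. below s - below (s + L i)"
  have g: "0 \<le> ?g s" for s using L_pos[OF i] by (auto simp: below_def)
  have C: "sum c (I - {i}) = lam - d - c i" using finite_I i by (simp add: lam_def sum_diff1)
  have "texp (r p) L (I - {i}) ?g \<le> v powr (sum c (I - {i})) * texp q L (I - {i}) (\<lambda>s. v powr (- s) * ?g s)"
  proof (intro texp_change_of_measure)
    fix j assume "j \<in> I - {i}"
    then have j: "j \<in> I" by simp
    show "0 \<le> q j \<and> q j \<le> 1 \<and> 0 \<le> r p j \<and> r p j \<le> 1"
      using r_range[OF assms(1) j] q_range[OF j] by simp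
    show "r p j \<le> q j * v powr (c j - L j)"
      unfolding v_def using assms(1) j by (rule r_le)
    show "1 - r p j \<le> (1 - q j) * v powr c j"
      using one_minus_r[OF j, of p] by (simp add: vp)
  qed (use finite_I v g in auto)
  also have "\<dots> \<le> v powr (sum c (I - {i})) * texp q L (I - {i}) (\<lambda>s. v powr (L i - lam) * ?g s)"
  proof (intro mult_left_mono texp_mono)
    fix s
    show "v powr (- s) * ?g s \<le> v powr (L i - lam) * ?g s"
    proof (cases "?g s = 0")
      case False
      then have "lam - L i \<le> s" using L_pos[OF i] by (auto simp: below_def split: if_splits)
      then show ?thesis using v g by (intro mult_right_mono powr_mono) auto
    qed simp
  qed (use finite_I q_range in \<open>auto simp: less_imp_le\<close>)
  also have "\<dots> = v powr (L i - c i - d) * (W0 i - W1 i)"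
  proof -
    have "v powr (sum c (I - {i})) * v powr (L i - lam) = v powr (L i - c i - d)"
      unfolding powr_add[symmetric] C by (simp add: algebra_simps)
    then show ?thesis by (simp add: texp_cmult texp_diff W0_def W1_def mult.assoc[symmetric])
  qed
  finally have *: "texp (r p) L (I - {i}) ?g \<le> v powr (L i - c i - d) * (W0 i - W1 i)" .
  have "(q i * (L i - c i)) * (1 - p) powr (- c i - 1) * texp (r p) L (I - {i}) ?g
      \<le> (q i * (L i - c i)) * (1 - p) powr (- c i - 1) * (v powr (L i - c i - d) * (W0 i - W1 i))"
    using * q_range[OF i] c_less_L[OF i] by (intro mult_left_mono) auto
  also have "\<dots> = deficit i * v powr (L i - d + 1)"
  proof -
    have "v powr (c i + 1) * v powr (L i - c i - d) = v powr (L i - d + 1)"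
      unfolding powr_add[symmetric] by (simp add: algebra_simps)
    moreover have "(q i * (L i - c i)) * (W0 i - W1 i) = deficit i"
      using q_var[OF i] W_minus_W1[OF i] by (simp add: deficit_def)
    moreover have "v powr (- (- c i - 1)) = v powr (c i + 1)" by (simp add: add.commute)
    moreover have "x * y = z \<Longrightarrow> k * w = t \<Longrightarrow> x' = x \<Longrightarrow> k * x' * (y * w) = t * z"
      for k t w x x' y z :: real by (auto simp: mult_ac)
    ultimately show ?thesis unfolding vp by blast
  qed
  also have "\<dots> \<le> deficit i * v powr (e + 1)"
    using assms(2)[OF i] v deficit_nonneg[OF i] by (intro mult_left_mono powr_mono) auto
  finally show "(q i * (L i - c i)) * (1 - p) powr (- c i - 1) * texp (r p) L (I - {i}) ?g
      \<le> deficit i * (1 - p) powr (- e - 1)"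
    unfolding vp by (simp add: add.commute)
qed

lemma f_le:
  assumes "tiltable p" "\<And>i. i \<in> I \<Longrightarrow> L i \<le> e + d" "0 < e"
  shows "f p \<le> W + N * ((1 - p) powr (- e) - 1) / e"
proof -
  define \<phi> where "\<phi> = (\<lambda>p. f p - N * (1 - p) powr (- e) / e)"
  have "\<phi> p \<le> \<phi> 0"
  proof (rule DERIV_nonpos_imp_nonincreasing[of 0 p \<phi>])
    fix x assume x: "0 \<le> x" "x \<le> p"
    have t: "tiltable x" using tiltable_mono[OF assms(1) x] .
    then have x1: "x < 1" by (simp add: tiltable_def)
    have "((\<lambda>p. N * (1 - p) powr (- e) / e) has_real_derivative N * (1 - x) powr (- e - 1)) (at x)"
      using x1 assms(3) by (auto intro!: derivative_eq_intros)
    then have "(\<phi> has_real_derivative (\<Sum>i\<in>I. (q i * (L i - c i)) * (1 - x) powr (- c i - 1) *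
      texp (r x) L (I - {i}) (\<lambda>s. below s - below (s + L i))) - N * (1 - x) powr (- e - 1)) (at x)"
      unfolding \<phi>_def using x1 by (intro DERIV_diff f_has_real_derivative)
    moreover note f_derivative_bound[OF t assms(2)]
    ultimately show "\<exists>y. (\<phi> has_real_derivative y) (at x) \<and> y \<le> 0"
      by (smt (verit))
  qed (use assms in \<open>simp add: tiltable_def\<close>)
  then show ?thesis by (simp add: \<phi>_def f_0 diff_divide_distrib right_diff_distrib)
qed

lemma u_has_real_derivative:
  assumes "p < 1"
  shows "(u has_real_derivative (- texp (r p) L I (\<lambda>s. max 0 (s - lam)) -
    (\<Sum>i\<in>I. (q i * (L i - c i)) * (1 - p) powr (- c i) *
      texp (r p) L (I - {i}) (\<lambda>s. max 0 (s + L i - lam) - max 0 (s - lam))))) (at p)"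
proof -
  let ?h = "\<lambda>s. max 0 (s - lam)"
  have "((\<lambda>p. texp (r p) L I ?h) has_real_derivative
    (\<Sum>i\<in>I. (- (q i * (L i - c i)) * (1 - p) powr (- c i - 1)) *
      (texp (r p) L (I - {i}) (\<lambda>s. ?h (s + L i)) - texp (r p) L (I - {i}) ?h))) (at p)"
    using assms finite_I by (intro texp_has_real_derivative r_has_real_derivative) auto
  also have "(\<Sum>i\<in>I. (- (q i * (L i - c i)) * (1 - p) powr (- c i - 1)) *
      (texp (r p) L (I - {i}) (\<lambda>s. ?h (s + L i)) - texp (r p) L (I - {i}) ?h)) =
    - (\<Sum>i\<in>I. (q i * (L i - c i)) * (1 - p) powr (- c i - 1) *
      texp (r p) L (I - {i}) (\<lambda>s. ?h (s + L i) - ?h s))"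
    unfolding texp_diff sum_negf[symmetric] by (intro sum.cong refl) algebra
  finally have "((\<lambda>p. (1 - p) * texp (r p) L I ?h) has_real_derivative
      ((0 - 1) * texp (r p) L I ?h + (- (\<Sum>i\<in>I. (q i * (L i - c i)) * (1 - p) powr (- c i - 1) *
      texp (r p) L (I - {i}) (\<lambda>s. ?h (s + L i) - ?h s))) * (1 - p))) (at p)"
    by (intro DERIV_mult DERIV_diff DERIV_const DERIV_ident)
  moreover have "(\<Sum>i\<in>I. (q i * (L i - c i)) * (1 - p) powr (- c i) *
      texp (r p) L (I - {i}) (\<lambda>s. ?h (s + L i) - ?h s)) =
    (\<Sum>i\<in>I. (q i * (L i - c i)) * (1 - p) powr (- c i - 1) *
      texp (r p) L (I - {i}) (\<lambda>s. ?h (s + L i) - ?h s)) * (1 - p)"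
    unfolding sum_distrib_right
  proof (intro sum.cong refl)
    fix i
    have "(1 - p) powr (- c i) = (1 - p) powr (- c i - 1) * (1 - p)"
      using assms by (simp add: powr_diff)
    then show "(q i * (L i - c i)) * (1 - p) powr (- c i) *
        texp (r p) L (I - {i}) (\<lambda>s. ?h (s + L i) - ?h s) =
      (q i * (L i - c i)) * (1 - p) powr (- c i - 1) *
        texp (r p) L (I - {i}) (\<lambda>s. ?h (s + L i) - ?h s) * (1 - p)"
      by (simp only: mult_ac)
  qed
  ultimately show ?thesis
    unfolding u_def[abs_def] by simp
qed

text \<open>
  The left side is \<open>1 - f p\<close> times the value that the right side has for the untruncated \<open>S - lam\<close> in
  place of \<open>max 0 (S - lam)\<close>. A jump of \<open>X\<^sub>i\<close> increases the expectation of \<open>max 0 (S - lam)\<close> by at least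
  \<open>L i * P(S - X\<^sub>i \<ge> lam)\<close>. If this lower bound is inserted, the difference of the two sides is,
  variable by variable, a nonnegative multiple of the increase of the probability of \<open>S \<ge> lam\<close> that
  the jump causes.
\<close>

lemma u_derivative_bound:
  assumes "tiltable p"
  shows "(1 - f p) * ((\<Sum>i\<in>I. var i) - d - (\<Sum>i\<in>I. (1 - c i) * var i * tilt p i)) \<le>
    texp (r p) L I (\<lambda>s. max 0 (s - lam)) +
    (\<Sum>i\<in>I. (q i * (L i - c i)) * (1 - p) powr (- c i) *
      texp (r p) L (I - {i}) (\<lambda>s. max 0 (s + L i - lam) - max 0 (s - lam)))"
proof -
  have p: "0 \<le> p" "p < 1" using assms by (auto simp: tiltable_def)
  let ?b = "\<lambda>s. 1 - below s"
  define \<alpha>0 where "\<alpha>0 = (\<lambda>i. texp (r p) L (I - {i}) ?b)"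
  define \<alpha>1 where "\<alpha>1 = (\<lambda>i. texp (r p) L (I - {i}) (\<lambda>s. ?b (s + L i)))"
  define \<Delta> where "\<Delta> = (\<lambda>i. texp (r p) L (I - {i}) (\<lambda>s. max 0 (s + L i - lam) - max 0 (s - lam)))"
  have rr: "0 \<le> r p j" "r p j \<le> 1" if "j \<in> I" for j
    using r_range[OF assms that] .
  have fb: "texp (r p) L I ?b = 1 - f p"
    by (simp add: f_def texp_diff texp_const[OF finite_I])
  have "max 0 (s - lam) = s * ?b s - lam * ?b s" for s by (simp add: below_def)
  then have "texp (r p) L I (\<lambda>s. max 0 (s - lam)) = texp (r p) L I (\<lambda>s. s * ?b s - lam * ?b s)"
    by (simp only:)
  also have "\<dots> = texp (r p) L I (\<lambda>s. s * ?b s) - texp (r p) L I (\<lambda>s. lam * ?b s)"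
    by (rule texp_diff)
  also have "texp (r p) L I (\<lambda>s. lam * ?b s) = lam * (1 - f p)"
    unfolding fb[symmetric] by (rule texp_cmult)
  also have "texp (r p) L I (\<lambda>s. s * ?b s) = (\<Sum>i\<in>I. r p i * L i * \<alpha>1 i)"
    unfolding \<alpha>1_def by (rule texp_times_sum[OF finite_I])
  finally have h: "texp (r p) L I (\<lambda>s. max 0 (s - lam)) = (\<Sum>i\<in>I. r p i * L i * \<alpha>1 i) - lam * (1 - f p)" .
  have summand: "(1 - f p) * (var i - (1 - c i) * var i * tilt p i) + c i * (1 - f p) \<le>
      r p i * L i * \<alpha>1 i + (q i * (L i - c i)) * (1 - p) powr (- c i) * \<Delta> i" if i: "i \<in> I" for i
  proof -
    let ?t = "tilt p i" and ?r = "r p i"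
    have split: "1 - f p = ?r * \<alpha>1 i + (1 - ?r) * \<alpha>0 i"
      unfolding fb[symmetric] \<alpha>0_def \<alpha>1_def by (rule texp_remove[OF finite_I i])
    have mono: "\<alpha>0 i \<le> \<alpha>1 i"
      unfolding \<alpha>0_def \<alpha>1_def using finite_I rr L_pos[OF i]
      by (intro texp_mono) (auto simp: below_def)
    have "L i * \<alpha>0 i \<le> \<Delta> i"
      unfolding \<alpha>0_def \<Delta>_def texp_cmult[symmetric] using finite_I rr L_pos[OF i]
      by (intro texp_mono) (auto simp: below_def)
    then have "(q i * (L i - c i)) * (1 - p) powr (- c i) * (L i * \<alpha>0 i)
        \<le> (q i * (L i - c i)) * (1 - p) powr (- c i) * \<Delta> i"
      using q_range[OF i] c_less_L[OF i] by (intro mult_left_mono) auto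
    moreover have "(q i * (L i - c i)) * (1 - p) powr (- c i) * (L i * \<alpha>0 i) =
        var i * (1 + c i * ?t) * \<alpha>0 i"
    proof -
      have "(q i * (L i - c i)) * (1 - p) powr (- c i) * (L i * \<alpha>0 i) =
          (q i * L i) * (L i - c i) * (1 - p) powr (- c i) * \<alpha>0 i"
        by (simp only: mult_ac)
      then show ?thesis unfolding q_L[OF i] tilt_eq[OF i] var_def .
    qed
    moreover have "?r * L i * \<alpha>1 i + var i * (1 + c i * ?t) * \<alpha>0 i
        - ((1 - f p) * (var i - (1 - c i) * var i * ?t) + c i * (1 - f p)) =
        ?r * (L i - c i) * (1 - c i * (1 - (1 - c i) * ?t)) * (\<alpha>1 i - \<alpha>0 i)"
    proof -
      have "?r * L i = c i - ?t * var i"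
      proof -
        have "?r * L i = (q i * L i) * (1 - ?t * (L i - c i))"
          unfolding r_def by (simp only: mult_ac)
        then show ?thesis unfolding q_L[OF i] var_def by (simp add: algebra_simps)
      qed
      then show ?thesis unfolding split by (rule tilt_identity) (rule var_def)
    qed
    moreover have "0 \<le> ?r * (L i - c i) * (1 - c i * (1 - (1 - c i) * ?t)) * (\<alpha>1 i - \<alpha>0 i)"
    proof -
      have "0 \<le> (1 - c i) * ?t" using c_le_1[OF i] tilt_nonneg[OF i p] by simp
      then have "0 \<le> c i * ((1 - c i) * ?t)" using c_pos[OF i] by simp
      then have "c i * (1 - (1 - c i) * ?t) \<le> 1"
        using c_le_1[OF i] by (simp add: right_diff_distrib)
      then show ?thesis using rr[OF i] c_less_L[OF i] mono by simp
    qed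
    ultimately show ?thesis by linarith
  qed
  have "(1 - f p) * ((\<Sum>i\<in>I. var i) - d - (\<Sum>i\<in>I. (1 - c i) * var i * tilt p i)) =
      (\<Sum>i\<in>I. (1 - f p) * (var i - (1 - c i) * var i * tilt p i) + c i * (1 - f p)) - lam * (1 - f p)"
  proof -
    have "(\<Sum>i\<in>I. (1 - f p) * (var i - (1 - c i) * var i * tilt p i) + c i * (1 - f p)) =
        (1 - f p) * ((\<Sum>i\<in>I. var i) - (\<Sum>i\<in>I. (1 - c i) * var i * tilt p i)) + sum c I * (1 - f p)"
      by (simp only: sum.distrib sum_distrib_left[symmetric] sum_distrib_right[symmetric] sum_subtractf)
    then show ?thesis unfolding lam_def by (simp only:) (rule threshold_identity)
  qed
  also have "\<dots> \<le> (\<Sum>i\<in>I. r p i * L i * \<alpha>1 i + (q i * (L i - c i)) * (1 - p) powr (- c i) * \<Delta> i) - lam * (1 - f p)"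
    by (intro diff_right_mono sum_mono summand)
  finally show ?thesis
    unfolding h sum.distrib \<Delta>_def by simp
qed

definition Y :: real where "Y = (\<Sum>i\<in>I. var i)"

text \<open>
  The loss term of \<open>u_derivative_bound\<close> is at most \<open>D * (p / (1 - p))\<close>, by \<open>tilt_le\<close>.
\<close>

definition D :: real where "D = (\<Sum>i\<in>I. (1 - c i) * var i)"

lemma D_nonneg: "0 \<le> D"
  unfolding D_def using c_le_1 var_pos by (intro sum_nonneg mult_nonneg_nonneg) (auto simp: less_imp_le)

text \<open>
  \<open>second_moment_bound\<close> with \<open>c i \<le> 1\<close> gives \<open>x (x + d - 1) \<le> Y\<close> for \<open>x = N / W\<close>.
\<close>

lemma N_over_W_le:
  assumes "1 \<le> e + d" "0 \<le> e" "Y \<le> e * (e + d - 1)"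
  shows "N \<le> e * W"
proof (rule ccontr)
  assume "\<not> N \<le> e * W"
  then have N: "e * W < N" by simp
  have "(\<Sum>i\<in>I. c i * deficit i) \<le> N"
    unfolding N_def using c_le_1 deficit_nonneg by (intro sum_mono) (simp add: mult_left_le_one_le c_pos less_imp_le)
  then have "N * (N + d * W) \<le> W * (W * Y + N)"
    using second_moment_bound W_pos by (smt (verit) Y_def mult_left_mono)
  also have "\<dots> \<le> W * (W * (e * (e + d - 1)) + N)"
    using assms(3) W_pos by (intro mult_left_mono add_mono) auto
  finally have "N * (N + d * W - W) \<le> (e * W) * (W * (e + d - 1))"
    by (simp add: algebra_simps)
  moreover have "(e * W) * (W * (e + d - 1)) < N * (N + d * W - W)"
  proof (rule mult_strict_mono)
    show "W * (e + d - 1) < N + d * W - W" using N by (simp add: algebra_simps)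
    show "0 < N" using N assms(2) W_pos by (smt (verit) mult_nonneg_nonneg)
  qed (use N assms W_pos in \<open>auto simp: less_imp_le\<close>)
  ultimately show False by simp
qed

text \<open>
  Markov's inequality in the form \<open>Markov_bound\<close>, with \<open>N \<le> e * W\<close>.
\<close>

lemma W_ge_of_le:
  assumes "1 \<le> e + d" "0 \<le> e" "Y \<le> e * (e + d - 1)"
  shows "d / (e + d) \<le> W"
proof -
  have "d \<le> (e + d) * W" using Markov_bound N_over_W_le[OF assms] by (simp add: algebra_simps)
  then show ?thesis using assms d_pos by (simp add: divide_simps mult.commute)
qed

lemma u_nonneg:
  assumes "tiltable p"
  shows "0 \<le> u p"
proof -
  have "0 \<le> texp (r p) L I (\<lambda>s. max 0 (s - lam))"
    using finite_I r_range[OF assms] by (intro texp_nonneg) auto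
  then show ?thesis using assms by (simp add: u_def tiltable_def)
qed

lemma f_le_1:
  assumes "tiltable p"
  shows "f p \<le> 1"
proof -
  have "f p \<le> texp (r p) L I (\<lambda>_. 1)"
    unfolding f_def using finite_I r_range[OF assms] below_range by (intro texp_mono) auto
  then show ?thesis by (simp add: texp_const[OF finite_I])
qed

lemma tilt_loss_le:
  assumes "0 \<le> p" "p \<le> p'" "p' < 1"
  shows "(\<Sum>i\<in>I. (1 - c i) * var i * tilt p i) \<le> D * (p / (1 - p'))"
  unfolding D_def sum_distrib_right
proof (intro sum_mono mult_left_mono)
  fix i assume i: "i \<in> I"
  have "tilt p i \<le> p / (1 - p)" using assms i by (intro tilt_le) auto
  also have "\<dots> \<le> p / (1 - p')" using assms by (intro divide_left_mono) auto
  finally show "tilt p i \<le> p / (1 - p')" .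
  show "0 \<le> (1 - c i) * var i" using c_le_1[OF i] var_pos[OF i] by simp
qed

text \<open>
  The hypothesis on \<open>W0\<close> bounds \<open>deficit i\<close> from below by \<open>\<gamma> * var i * W\<close>. Hence \<open>\<gamma> * D\<close> is at most the
  weighted sum of deficits that was given away when \<open>c i\<close> was replaced by \<open>1\<close> in the second moment
  estimate.
\<close>

lemma D_le:
  assumes "0 < \<gamma>" "\<And>i. i \<in> I \<Longrightarrow> W * (1 + \<gamma> * c i) \<le> W0 i" "Y = e * (e + d - 1)"
  defines "x \<equiv> N / W"
  shows "\<gamma> * D \<le> (e - x) * (e + x + d - 1)"
proof -
  define K where "K = (\<Sum>i\<in>I. (1 - c i) * deficit i)"
  have Nx: "N = x * W" using W_pos by (simp add: x_def)
  have "W * (\<gamma> * D) \<le> K"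
    unfolding D_def K_def sum_distrib_left
  proof (intro sum_mono)
    fix i assume i: "i \<in> I"
    have "(L i - c i) * (W * \<gamma> * c i) \<le> (L i - c i) * (W0 i - W)"
      using assms(2)[OF i] c_less_L[OF i] by (intro mult_left_mono) (auto simp: algebra_simps)
    then have "W * \<gamma> * var i \<le> deficit i"
      unfolding deficit_eq[OF i] var_def by (simp add: mult_ac)
    then have "(1 - c i) * (W * \<gamma> * var i) \<le> (1 - c i) * deficit i"
      using c_le_1[OF i] by (intro mult_left_mono) auto
    then show "W * (\<gamma> * ((1 - c i) * var i)) \<le> (1 - c i) * deficit i"
      by (simp add: mult_ac)
  qed
  moreover have "K \<le> W * ((e - x) * (e + x + d - 1))"
  proof -
    have "(\<Sum>i\<in>I. c i * deficit i) = N - K"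
      by (simp add: K_def N_def left_diff_distrib sum_subtractf)
    then have "x * W * (x * W + d * W) \<le> W * (W * Y + (x * W - K))"
      using second_moment_bound unfolding Y_def[symmetric] Nx by simp
    then have "W * (x * (x * W + d * W)) \<le> W * (W * Y + (x * W - K))"
      by (simp only: mult_ac)
    then have "x * (x * W + d * W) \<le> W * Y + (x * W - K)"
      using W_pos by simp
    then show ?thesis unfolding assms(3) by (simp add: algebra_simps)
  qed
  ultimately have "W * (\<gamma> * D) \<le> W * ((e - x) * (e + x + d - 1))" by simp
  then show ?thesis using W_pos by simp
qed

text \<open>
  Integration of \<open>u_derivative_bound\<close>. The loss is replaced by its chord \<open>D * (p / (1 - ps))\<close>, and
  since \<open>fb\<close> is monotone, the integral of \<open>(1 - fb p) * (p / (1 - ps))\<close> is at most the one with the mean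
  value \<open>ps / (2 * (1 - ps))\<close> of the second factor: this is Chebyshev's inequality for integrals. The
  integration stops at \<open>p1\<close>, where the drift \<open>Z\<close> would become negative.
\<close>

lemma overshoot_ge_integral:
  fixes fb G :: "real \<Rightarrow> real" and A ps :: real
  assumes ps: "0 < ps" "tiltable ps"
    and Y: "Y - d = A" "0 \<le> A"
    and fb: "\<And>p. 0 \<le> p \<Longrightarrow> p \<le> ps \<Longrightarrow> f p \<le> fb p"
      "\<And>p. 0 \<le> p \<Longrightarrow> p \<le> ps \<Longrightarrow> fb p \<le> 1"
      "\<And>p p'. 0 \<le> p \<Longrightarrow> p \<le> p' \<Longrightarrow> p' \<le> ps \<Longrightarrow> fb p \<le> fb p'"
    and G: "\<And>p. 0 \<le> p \<Longrightarrow> p \<le> ps \<Longrightarrow> (G has_real_derivative (1 - fb p)) (at p)" "G 0 = 0"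
  shows "(A - ps / (2 * (1 - ps)) * D) * G ps \<le> N + d * W - d"
proof -
  have ps1: "ps < 1" using ps by (simp add: tiltable_def)
  define \<theta> where "\<theta> = ps / (2 * (1 - ps))"
  (* Chebyshev's inequality is obtained pointwise: 1 - fb is compared with its value \<kappa> at the
     midpoint, where the chord takes its mean value \<theta> * D. The polynomial in B vanishes at ps. *)
  define \<kappa> where "\<kappa> = 1 - fb (ps / 2)"
  define Z where "Z = (\<lambda>p. A - D * (p / (1 - ps)))"
  define B where "B = (\<lambda>p. (A - \<theta> * D) * G p - D * \<kappa> / (1 - ps) * (p\<^sup>2 / 2 - ps * p / 2))"
  define B' where "B' = (\<lambda>p. (A - \<theta> * D) * (1 - fb p) - D * \<kappa> / (1 - ps) * (p - ps / 2))"
  have dB: "(B has_real_derivative B' p) (at p)" if "0 \<le> p" "p \<le> ps" for p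
  proof -
    have "((\<lambda>p. p\<^sup>2 / 2 - ps * p / 2) has_real_derivative (p - ps / 2)) (at p)"
      by (auto intro!: derivative_eq_intros)
    from DERIV_diff[OF DERIV_cmult[OF G(1)[OF that]] DERIV_cmult[OF this]] show ?thesis
      unfolding B_def B'_def .
  qed
  have B'_le: "B' p \<le> (1 - fb p) * Z p" if p: "0 \<le> p" "p \<le> ps" for p
  proof -
    have "(1 - fb p) * Z p - B' p = D / (1 - ps) * ((p - ps / 2) * (fb p - fb (ps / 2)))"
    proof -
      define t where "t = 1 / (1 - ps)"
      have eqs: "p / (1 - ps) = t * p" "D * \<kappa> / (1 - ps) = D * \<kappa> * t" "D / (1 - ps) = D * t" "\<theta> = ps * t / 2"
        by (simp_all add: t_def \<theta>_def)
      show ?thesis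
        unfolding Z_def B'_def eqs unfolding \<kappa>_def by (simp add: field_simps)
    qed
    moreover have "0 \<le> (p - ps / 2) * (fb p - fb (ps / 2))"
    proof (cases "ps / 2 \<le> p")
      case True
      then show ?thesis using fb(3)[of "ps / 2" p] p ps by simp
    next
      case False
      then show ?thesis using fb(3)[of p "ps / 2"] p ps by (intro mult_nonpos_nonpos) auto
    qed
    ultimately show ?thesis
      using D_nonneg ps1 by (smt (verit) mult_nonneg_nonneg divide_nonneg_pos)
  qed
  (* Beyond p1 the drift Z is negative, and B does not increase there. *)
  obtain p1 where p1: "0 \<le> p1" "p1 \<le> ps" "\<forall>p\<le>p1. 0 \<le> Z p"
    "p1 < ps \<longrightarrow> (\<forall>p\<ge>p1. Z p \<le> 0)"
  proof (cases "0 \<le> Z ps")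
    case True
    have "0 \<le> Z p" if "p \<le> ps" for p
    proof -
      have "D * (p / (1 - ps)) \<le> D * (ps / (1 - ps))"
        using that D_nonneg ps1 by (intro mult_left_mono divide_right_mono) auto
      then show ?thesis using True by (simp add: Z_def)
    qed
    then show ?thesis using that[of ps] ps by auto
  next
    case False
    then have D: "0 < D" using Y(2) D_nonneg by (cases "D = 0") (auto simp: Z_def)
    define p1 where "p1 = A * (1 - ps) / D"
    have Zp: "Z p = D * ((p1 - p) / (1 - ps))" for p
    proof -
      have "D * p1 = A * (1 - ps)" using D by (simp add: p1_def)
      then have "D * ((p1 - p) / (1 - ps)) = (A * (1 - ps) - D * p) / (1 - ps)"
        by (simp add: right_diff_distrib)
      also have "\<dots> = Z p" using ps1 by (simp add: Z_def diff_divide_distrib)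
      finally show ?thesis by simp
    qed
    have "p1 < ps" using False D ps1 unfolding Zp
      by (auto simp: zero_le_mult_iff zero_le_divide_iff)
    moreover have "0 \<le> p1" using Y(2) D ps1 by (simp add: p1_def)
    moreover have "0 \<le> Z p" if "p \<le> p1" for p using that D ps1 by (simp add: Zp)
    moreover have "Z p \<le> 0" if "p1 \<le> p" for p
      using that D ps1 by (simp add: Zp mult_le_0_iff divide_le_0_iff)
    ultimately show ?thesis using that[of p1] by auto
  qed
  have "u p1 + B p1 \<le> u 0 + B 0"
  proof (rule DERIV_nonpos_imp_nonincreasing[of 0 p1 "\<lambda>p. u p + B p"])
    fix x assume x: "0 \<le> x" "x \<le> p1"
    have xps: "x \<le> ps" using x p1 by simp
    have t: "tiltable x" using tiltable_mono[OF ps(2) x(1) xps] .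
    have x1: "x < 1" using t by (simp add: tiltable_def)
    let ?T = "texp (r x) L I (\<lambda>s. max 0 (s - lam)) +
      (\<Sum>i\<in>I. (q i * (L i - c i)) * (1 - x) powr (- c i) *
        texp (r x) L (I - {i}) (\<lambda>s. max 0 (s + L i - lam) - max 0 (s - lam)))"
    have "((\<lambda>p. u p + B p) has_real_derivative (- ?T + B' x)) (at x)"
      using u_has_real_derivative[OF x1] dB[OF x(1) xps]
      by (intro DERIV_add) (simp_all add: algebra_simps)
    moreover have "B' x \<le> ?T"
    proof -
      have "B' x \<le> (1 - fb x) * Z x" by (rule B'_le[OF x(1) xps])
      also have "\<dots> \<le> (1 - f x) * Z x"
        using fb(1)[OF x(1) xps] p1(3) x(2) by (intro mult_right_mono) auto
      also have "\<dots> \<le> (1 - f x) * ((\<Sum>i\<in>I. var i) - d - (\<Sum>i\<in>I. (1 - c i) * var i * tilt x i))"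
        using tilt_loss_le[OF x(1) xps ps1] f_le_1[OF t] Y(1)
        by (intro mult_left_mono) (auto simp: Z_def Y_def)
      also have "\<dots> \<le> ?T" by (rule u_derivative_bound[OF t])
      finally show ?thesis .
    qed
    ultimately show "\<exists>y. ((\<lambda>p. u p + B p) has_real_derivative y) (at x) \<and> y \<le> 0"
      by (intro exI[of _ "- ?T + B' x"]) simp
  qed (use p1 in auto)
  moreover have "0 \<le> u p1" using u_nonneg tiltable_mono[OF ps(2) p1(1,2)] .
  moreover have "B ps \<le> B p1"
  proof (cases "p1 < ps")
    case True
    show ?thesis
    proof (rule DERIV_nonpos_imp_nonincreasing[of p1 ps B])
      fix x assume x: "p1 \<le> x" "x \<le> ps"
      then have x0: "0 \<le> x" using p1 by simp
      have "B' x \<le> (1 - fb x) * Z x" by (rule B'_le[OF x0 x(2)])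
      also have "\<dots> \<le> 0"
        using fb(2)[OF x0 x(2)] p1(4) True x(1) by (intro mult_nonneg_nonpos) auto
      finally show "\<exists>y. (B has_real_derivative y) (at x) \<and> y \<le> 0"
        using dB[OF x0 x(2)] by blast
    qed (use p1 in auto)
  next
    case False
    then show ?thesis using p1(2) by simp
  qed
  moreover have "B 0 = 0" by (simp add: B_def G)
  moreover have "B ps = (A - \<theta> * D) * G ps" by (simp add: B_def power2_eq_square)
  ultimately show ?thesis unfolding \<theta>_def u_0 by linarith
qed

text \<open>
  The case without large variables. Under the assumption \<open>W < tail_bound d e\<close>, the bound \<open>fb\<close> on \<open>f\<close>
  and its integral \<open>G\<close> turn \<open>overshoot_ge_integral\<close> into the negation of \<open>final_inequality\<close>, for
  \<open>s = e - N / W\<close>.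
\<close>

lemma tail_bound_le_of_tiltable:
  assumes e: "1 < e" and Y: "Y = e * (e + d - 1)"
    and L: "\<And>i. i \<in> I \<Longrightarrow> L i \<le> e + d"
    and t: "tiltable (min 1 d / (e + d))"
    and IH: "\<And>i. i \<in> I \<Longrightarrow> tail_bound (d + c i) e \<le> W0 i"
  shows "tail_bound d e \<le> W"
proof (rule ccontr)
  assume "\<not> tail_bound d e \<le> W"
  define m where "m = min 1 d"
  define l where "l = e + d"
  define ps where "ps = m / l"
  define b where "b = tail_bound d e"
  have Wb: "W < b" using \<open>\<not> tail_bound d e \<le> W\<close> by (simp add: b_def)
  have m: "0 < m" "m \<le> 1" "m \<le> d" using d_pos unfolding m_def by simp_all
  have md: "m = 1 \<or> m = d" unfolding m_def by (simp add: min_def)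
  have l: "1 < l" "m < l" "0 < l - m" using e m d_pos unfolding l_def by linarith+
  have ps: "0 < ps" "ps < 1" using m l by (auto simp: ps_def)
  have b_eq: "b = m * (1 - ps) powr e"
    using e d_pos by (simp add: b_def tail_bound_ge_1 m_def[symmetric] ps_def l_def)
  define x where "x = N / W"
  have Nx: "N = x * W" using W_pos by (simp add: x_def)
  have x: "0 \<le> x" "x \<le> e"
    using N_nonneg W_pos N_over_W_le[of e] Y e d_pos by (auto simp: x_def divide_simps)
  (* the relative increment of the bound, per unit of slack, from tail_bound_increment *)
  define \<gamma> where "\<gamma> = e / ((l + 1) * (l - m))"
  have \<gamma>: "0 < \<gamma>" using e l by (simp add: \<gamma>_def)
  have D: "\<gamma> * D \<le> (e - x) * (e + x + d - 1)"
    unfolding x_def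
  proof (rule D_le[OF \<gamma> _ Y])
    fix i assume i: "i \<in> I"
    have "W * (1 + \<gamma> * c i) \<le> b * (1 + \<gamma> * c i)"
      using Wb \<gamma> c_pos[OF i] by (intro mult_right_mono) auto
    also have "\<dots> \<le> tail_bound (d + c i) e"
      unfolding b_def \<gamma>_def l_def m_def
      using d_pos e c_pos[OF i] c_le_1[OF i] by (intro tail_bound_increment) auto
    also have "\<dots> \<le> W0 i" using IH[OF i] .
    finally show "W * (1 + \<gamma> * c i) \<le> W0 i" .
  qed
  define v where "v = (\<lambda>p. (1 - p) powr (- e))"
  define fb where "fb = (\<lambda>p. b * (1 + x * (v p - 1) / e))"
  have v: "1 \<le> v p" "v p \<le> v p'" if "0 \<le> p" "p \<le> p'" "p' < 1" for p p'
  proof -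
    have "(1 - p) powr 0 \<le> (1 - p) powr (- e)"
      using that e by (intro powr_mono') auto
    then show "1 \<le> v p" using that by (simp add: v_def)
    show "v p \<le> v p'" unfolding v_def using that e by (intro powr_mono2') auto
  qed
  have b_pos: "0 < b" using Wb W_pos by simp
  have f_fb: "f p \<le> fb p" if p: "0 \<le> p" "p \<le> ps" for p
  proof -
    have tp: "tiltable p"
      using t p unfolding m_def[symmetric] l_def[symmetric] ps_def[symmetric] by (rule tiltable_mono)
    have "f p \<le> W + N * (v p - 1) / e"
      unfolding v_def using tp L e by (intro f_le) auto
    also have "\<dots> = W * (1 + x * (v p - 1) / e)"
      unfolding Nx by (simp add: distrib_left mult_ac)
    also have "\<dots> \<le> fb p"
      unfolding fb_def using Wb x v(1)[of p ps] p ps e by (intro mult_right_mono add_nonneg_nonneg) auto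
    finally show ?thesis .
  qed
  have fb_mono: "fb p \<le> fb p'" if "0 \<le> p" "p \<le> p'" "p' \<le> ps" for p p'
    unfolding fb_def using v(2)[of p p'] that ps x e b_pos
    by (intro mult_left_mono add_left_mono divide_right_mono) auto
  have fb_1: "fb p \<le> 1" if p: "0 \<le> p" "p \<le> ps" for p
  proof -
    have "fb p \<le> fb ps" using p by (intro fb_mono) auto
    also have "fb ps \<le> b * v ps"
    proof -
      have "x * (v ps - 1) \<le> e * (v ps - 1)"
        using x v(1)[of ps ps] ps by (intro mult_right_mono) auto
      then have "x * (v ps - 1) / e \<le> v ps - 1" using e by (simp add: divide_simps mult.commute)
      then show ?thesis unfolding fb_def using b_pos by (intro mult_left_mono) auto
    qed
    also have "b * v ps = m"
      unfolding b_eq v_def using ps by (simp add: mult.assoc powr_add[symmetric])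
    finally show ?thesis using m by simp
  qed
  (* an antiderivative of 1 - fb *)
  define G where "G = (\<lambda>p. p - b * ((1 - x / e) * p + x / e * (((1 - p) powr (1 - e) - 1) / (e - 1))))"
  have dG: "(G has_real_derivative (1 - fb p)) (at p)" if p: "0 \<le> p" "p \<le> ps" for p
  proof -
    have p1: "p < 1" using p ps by simp
    have "((\<lambda>p. ((1 - p) powr (1 - e) - 1) / (e - 1)) has_real_derivative v p) (at p)"
    proof -
      have "((\<lambda>p. (1 - p) powr (1 - e)) has_real_derivative (e - 1) * v p) (at p)"
        unfolding v_def using p1 by (auto intro!: derivative_eq_intros simp: algebra_simps)
      then have "((\<lambda>p. ((1 - p) powr (1 - e) - 1) / (e - 1)) has_real_derivative ((e - 1) * v p - 0) / (e - 1)) (at p)"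
        by (intro DERIV_cdivide DERIV_diff DERIV_const)
      then show ?thesis using e by simp
    qed
    then have "(G has_real_derivative 1 - b * ((1 - x / e) * 1 + x / e * v p)) (at p)"
      unfolding G_def by (intro DERIV_diff DERIV_ident DERIV_cmult DERIV_add)
    moreover have "1 - b * ((1 - x / e) * 1 + x / e * v p) = 1 - fb p"
      unfolding fb_def by (simp add: algebra_simps diff_divide_distrib)
    ultimately show ?thesis by simp
  qed
  have G0: "G 0 = 0" by (simp add: G_def)
  have Gps: "0 \<le> G ps"
  proof -
    have "G 0 \<le> G ps"
    proof (rule DERIV_nonneg_imp_nondecreasing[of 0 ps G])
      fix p assume p: "0 \<le> p" "p \<le> ps"
      show "\<exists>y. (G has_real_derivative y) (at p) \<and> 0 \<le> y"
        using dG[OF p] fb_1[OF p] by (intro exI[of _ "1 - fb p"]) simp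
    qed (use ps in simp)
    then show ?thesis using G0 by simp
  qed
  define A where "A = (e - 1) * l"
  have A: "Y - d = A" "0 \<le> A"
  proof -
    show "Y - d = A" unfolding A_def Y l_def by (simp add: algebra_simps)
    show "0 \<le> A" unfolding A_def using e l(1) by simp
  qed
  have main: "(A - ps / (2 * (1 - ps)) * D) * G ps \<le> N + d * W - d"
    using ps(1) t A f_fb fb_1 fb_mono dG G0
    unfolding m_def[symmetric] l_def[symmetric] ps_def[symmetric]
    by (rule overshoot_ge_integral)
  define s where "s = e - x"
  define \<tau> where "\<tau> = m * (l + 1) / (2 * e)"
  define R where "R = 2 * e + d - 1 - s"
  have \<theta>D: "ps / (2 * (1 - ps)) * D \<le> \<tau> * (s * R)"
  proof -
    have "ps / (2 * (1 - ps)) = \<tau> * \<gamma>"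
    proof -
      have "1 - ps = (l - m) / l" using l(1) by (simp add: ps_def diff_divide_distrib)
      then have "ps / (2 * (1 - ps)) = m / (2 * (l - m))"
        unfolding ps_def using l by simp
      also have "\<dots> = \<tau> * \<gamma>"
        unfolding \<tau>_def \<gamma>_def using e l by simp
      finally show ?thesis .
    qed
    then have "ps / (2 * (1 - ps)) * D = \<tau> * (\<gamma> * D)" by simp
    also have "\<dots> \<le> \<tau> * ((e - x) * (e + x + d - 1))"
      using D m l e by (intro mult_left_mono) (auto simp: \<tau>_def)
    also have "(e - x) * (e + x + d - 1) = s * R"
      by (simp add: s_def R_def algebra_simps)
    finally show ?thesis .
  qed
  define J where "J = (b - d / l) / (e - 1)"
  define b2 where "b2 = (m / l * (1 - b) - J) / e"
  have GJ: "G ps = J + b2 * s"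
  proof -
    (* m is 1 or d, so that m * (d + 1 - m) = d *)
    have J: "J = ps - (m * (1 - ps) - b) / (e - 1)"
    proof -
      have "ps * (e - 1 + m) = m - d / l"
      proof -
        have "m * (e - 1 + m) = m * l - d" using md unfolding l_def by (auto simp: algebra_simps)
        then have "m * (e - 1 + m) / l = (m * l - d) / l" by simp
        then show ?thesis using l(1) by (simp add: ps_def diff_divide_distrib)
      qed
      then have eq: "b - d / l = ps * (e - 1) - (m * (1 - ps) - b)"
        by (simp add: algebra_simps)
      show ?thesis unfolding J_def eq using e by (simp add: diff_divide_distrib)
    qed
    have bv: "b * ((1 - ps) powr (1 - e) - 1) = m * (1 - ps) - b"
    proof -
      have "b * (1 - ps) powr (1 - e) = m * (1 - ps)"
        unfolding b_eq using ps by (simp add: mult.assoc powr_add[symmetric])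
      then show ?thesis by (simp add: right_diff_distrib)
    qed
    have "G ps = ps - ((1 - x / e) * (b * ps) + x / e * (b * ((1 - ps) powr (1 - e) - 1) / (e - 1)))"
      unfolding G_def by (simp add: distrib_left mult_ac)
    also have "\<dots> = ps - ((1 - x / e) * (b * ps) + x / e * (ps - J))"
      unfolding bv using J by simp
    also have "\<dots> = J + b2 * s"
    proof -
      have "b2 * s = (ps * (1 - b) - J) * (1 - x / e)"
      proof -
        have "k / e * (e - x) = k * (1 - x / e)" for k :: real
          using e by (simp add: field_simps)
        then show ?thesis unfolding b2_def s_def ps_def by blast
      qed
      moreover have "ps - ((1 - k) * (b * ps) + k * (ps - J)) = J + (ps * (1 - b) - J) * (1 - k)" for k
        by (simp add: algebra_simps)
      ultimately show ?thesis by (simp only:)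
    qed
    finally show ?thesis .
  qed
  have fin: "0 \<le> b + b2 * (e - 1) * l - R * \<tau> * (J + b2 * s)"
    unfolding R_def \<tau>_def
    using final_inequality[OF d_pos e, of s] x
    unfolding m_def[symmetric] l_def[symmetric] ps_def[symmetric] b_eq[symmetric] J_def[symmetric]
    unfolding ps_def b2_def[symmetric] by (simp add: s_def)
  have "(A - \<tau> * (s * R)) * G ps \<le> (A - ps / (2 * (1 - ps)) * D) * G ps"
    using \<theta>D Gps by (intro mult_right_mono) auto
  also note main
  also have "N + d * W - d < (x + d) * b - d"
  proof -
    have "(x + d) * W < (x + d) * b" using Wb x d_pos by (intro mult_strict_left_mono) auto
    then show ?thesis unfolding Nx by (simp add: algebra_simps)
  qed
  also have "(x + d) * b - d = A * J - s * b"
  proof -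
    have "A * J = l * (b - d / l)" unfolding A_def J_def using e by simp
    then have "A * J = l * b - d" using l(1) by (simp add: right_diff_distrib)
    then show ?thesis by (simp add: l_def s_def algebra_simps)
  qed
  finally have "s * (b + b2 * (e - 1) * l - R * \<tau> * (J + b2 * s)) < 0"
    unfolding GJ A_def by (simp add: algebra_simps)
  moreover have "0 \<le> s * (b + b2 * (e - 1) * l - R * \<tau> * (J + b2 * s))"
    using fin x by (simp add: s_def)
  ultimately show False by simp
qed

end

section \<open>The tail bound for two-point variables\<close>

lemma two_point_sum_remove:
  assumes "two_point_sum I L c d" "j \<in> I"
  shows "two_point_sum (I - {j}) L c (d + c j)"
    and "two_point_sum.W0 I L c d j = two_point_sum.W (I - {j}) L c (d + c j)"
proof -
  interpret two_point_sum I L c d by fact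
  show *: "two_point_sum (I - {j}) L c (d + c j)"
    using finite_I d_pos c_pos c_le_1 c_less_L assms(2)
    by unfold_locales (auto simp: add_pos_pos)
  interpret R: two_point_sum "I - {j}" L c "d + c j" by fact
  have "R.lam = lam"
    using finite_I assms(2) by (simp add: lam_def R.lam_def sum_diff1)
  then have "R.below = below" by (simp add: below_def[abs_def] R.below_def[abs_def])
  moreover have "R.q = q" by (simp add: q_def[abs_def] R.q_def[abs_def])
  ultimately show "W0 j = R.W" by (simp add: W0_def R.W_def)
qed

context two_point_sum
begin

text \<open>
  A variable that is too large for the tilting vanishes with probability at least
  \<open>(1 - 1 / (e + d)) powr c j\<close>, and then the other variables have the slack \<open>d + c j\<close>.
\<close>

lemma W_ge_remove:
  assumes "j \<in> I" "1 < e"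
    and big: "e + d < L j \<or> 1 < tilt (min 1 d / (e + d)) j * (L j - c j)"
    and IH: "tail_bound (d + c j) (e - c j) \<le> W0 j"
  shows "tail_bound d e \<le> W"
proof -
  define l where "l = e + d"
  have l: "1 < l" using assms(2) d_pos by (simp add: l_def)
  have y: "-1 < - (1 / l)" "0 < 1 - 1 / l" "1 / l < 1" using l by (auto simp: divide_simps)
  have Lj: "0 < L j" and cj: "0 < c j" "c j \<le> 1" "c j < L j"
    using L_pos c_pos c_le_1 c_less_L assms(1) by auto
  have "(1 - 1 / l) powr c j \<le> 1 - q j"
    using big
  proof
    assume "e + d < L j"
    have "(1 + - (1 / l)) powr c j \<le> 1 + c j * (- (1 / l))"
      using y cj by (intro Bernoulli_powr_le) auto
    also have "\<dots> \<le> 1 - q j"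
      using \<open>e + d < L j\<close> cj l unfolding q_def l_def[symmetric]
      by (simp add: frac_le)
    finally show ?thesis by simp
  next
    assume big': "1 < tilt (min 1 d / (e + d)) j * (L j - c j)"
    have "min 1 d / l \<le> 1 / l" using l by (intro divide_right_mono) auto
    then have "tilt (min 1 d / l) j \<le> tilt (1 / l) j"
      using d_pos l y(3) assms(1) by (intro tilt_mono) (simp_all del: divide_less_eq_1)
    then have "tilt (min 1 d / l) j * (L j - c j) \<le> tilt (1 / l) j * (L j - c j)"
      using cj by (intro mult_right_mono) auto
    then have t: "1 < tilt (1 / l) j * (L j - c j)"
      using big' unfolding l_def by simp
    define w where "w = (1 - 1 / l) powr c j"
    have w: "0 < w" unfolding w_def powr_gt_zero using y(2) by linarith
    have ct: "c j * tilt (1 / l) j = 1 / w - 1"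
      unfolding tilt_def w_def using cj by (simp add: powr_minus divide_inverse)
    have "c j * 1 < c j * (tilt (1 / l) j * (L j - c j))"
      using t cj by (intro mult_strict_left_mono) auto
    then have "c j < (1 / w - 1) * (L j - c j)"
      unfolding mult.assoc[symmetric] ct by simp
    then have "c j * w < (1 - w) * (L j - c j)"
      using w by (simp add: field_simps)
    then have "w * L j < L j - c j" by (simp add: algebra_simps)
    then have "w < (L j - c j) / L j" using Lj by (simp add: pos_less_divide_eq)
    also have "(L j - c j) / L j = 1 - q j" using Lj by (simp add: q_def diff_divide_distrib)
    finally show ?thesis by (simp add: w_def)
  qed
  moreover have "0 \<le> W0 j"
    using IH tail_bound_pos[of "d + c j" "e - c j"] d_pos cj assms(2) by simp
  ultimately have "(1 - 1 / l) powr c j * W0 j \<le> (1 - q j) * W0 j"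
    by (rule mult_right_mono)
  also have "\<dots> \<le> W"
    using W_split[OF assms(1)] W1_nonneg[of j] q_range[OF assms(1)] by simp
  finally have "(1 - 1 / l) powr c j * W0 j \<le> W" .
  moreover have "(1 - 1 / l) powr c j * tail_bound (d + c j) (e - c j) \<le> (1 - 1 / l) powr c j * W0 j"
    using IH by (intro mult_left_mono) auto
  moreover have "tail_bound d e \<le> (1 - 1 / l) powr c j * tail_bound (d + c j) (e - c j)"
  proof (cases "1 \<le> d + c j")
    case True
    then show ?thesis unfolding l_def using d_pos assms(2) cj by (intro tail_bound_remove_ge1) auto
  next
    case False
    then show ?thesis unfolding l_def using d_pos assms(2) cj by (intro tail_bound_remove_lt1) auto
  qed
  ultimately show ?thesis by simp
qed

text \<open>
  Hence the removal of such a variable decreases the variance enough for the size \<open>e - c j\<close>.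
\<close>

lemma big_imp_large_deviation:
  assumes "j \<in> I" "1 < e"
    and big: "e + d < L j \<or> 1 < tilt (min 1 d / (e + d)) j * (L j - c j)"
  shows "e + d - 1 < L j - c j"
  using big
proof
  assume "e + d < L j"
  then show ?thesis using c_le_1[OF assms(1)] by simp
next
  assume t: "1 < tilt (min 1 d / (e + d)) j * (L j - c j)"
  define l where "l = e + d"
  have l: "1 < l" using assms(2) d_pos by (simp add: l_def)
  have p: "0 < min 1 d / l" "min 1 d / l \<le> 1 / l" "1 / l < 1"
    using l d_pos by (auto intro!: divide_right_mono)
  have "tilt (min 1 d / l) j \<le> min 1 d / l / (1 - min 1 d / l)"
    using p assms(1) by (intro tilt_le) auto
  also have "\<dots> \<le> (1 / l) / (1 - 1 / l)"
    using p l by (intro frac_le) auto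
  also have "\<dots> = 1 / (l - 1)"
    using l by (simp add: divide_simps)
  finally have "tilt (min 1 d / l) j * (L j - c j) \<le> 1 / (l - 1) * (L j - c j)"
    using c_less_L[OF assms(1)] by (intro mult_right_mono) auto
  then have "1 < 1 / (l - 1) * (L j - c j)" using t unfolding l_def by simp
  then show ?thesis using l by (simp add: l_def)
qed

end

lemma quadratic_root_exists:
  fixes d e y :: real
  assumes "0 < d" "1 \<le> e" "d \<le> y" "y \<le> e * (e + d - 1)"
  obtains e0 where "1 \<le> e0" "e0 \<le> e" "y = e0 * (e0 + d - 1)"
proof -
  have "\<exists>e0. 1 \<le> e0 \<and> e0 \<le> e \<and> e0 * (e0 + d - 1) = y"
    using assms by (intro IVT') (auto intro!: continuous_intros)
  then show ?thesis using that by auto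
qed

text \<open>
  The tilting estimate needs the size \<open>e0\<close> for which the variance is exactly \<open>e0 * (e0 + d - 1)\<close>;
  \<open>tail_bound_antimono\<close> then passes to \<open>e\<close>. If \<open>e0\<close> would be at most \<open>1\<close>, Markov's inequality
  suffices.
\<close>

lemma two_point_sum_tail_bound:
  fixes I :: "'i set"
  assumes "two_point_sum I L c d" "0 \<le> e" "1 \<le> e + d"
    and "two_point_sum.Y I L c \<le> e * (e + d - 1)"
  shows "tail_bound d e \<le> two_point_sum.W I L c d"
  using assms
proof (induction "card I" arbitrary: I d e rule: less_induct)
  case less
  interpret two_point_sum I L c d by fact
  have smaller: "card (I - {j}) < card I" if "j \<in> I" for j
    using finite_I that by (rule card_Diff1_less)
  have Y_remove: "two_point_sum.Y (I - {j}) L c = Y - var j" if j: "j \<in> I" for j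
  proof -
    interpret R: two_point_sum "I - {j}" L c "d + c j"
      using less.prems(1) j by (rule two_point_sum_remove)
    have "R.var = var" by (simp add: var_def[abs_def] R.var_def[abs_def])
    then show ?thesis using finite_I j by (simp add: Y_def R.Y_def sum_diff1)
  qed
  show ?case
  proof (cases "e \<le> 1 \<or> Y \<le> d")
    case True
    show ?thesis
    proof (cases "e \<le> 1")
      case True
      then show ?thesis using W_ge_of_le[OF less.prems(3,2,4)] by (simp add: tail_bound_def)
    next
      case False
      then have "tail_bound d e \<le> tail_bound d 1"
        using d_pos by (intro tail_bound_antimono) auto
      also have "\<dots> \<le> W"
        using W_ge_of_le[of 1] True False d_pos by (simp add: tail_bound_def)
      finally show ?thesis .
    qed
  next
    case False
    (* The drift of the tilting estimate involves the variance itself, hence equality. *)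
    then obtain e0 where e0: "1 \<le> e0" "e0 \<le> e" "Y = e0 * (e0 + d - 1)"
      using quadratic_root_exists[of d e Y] d_pos less.prems(4) by auto
    have "e0 \<noteq> 1" using e0(3) False by auto
    then have e1: "1 < e0" using e0 by simp
    have "tail_bound d e0 \<le> W"
    proof (cases "\<exists>j\<in>I. e0 + d < L j \<or> 1 < tilt (min 1 d / (e0 + d)) j * (L j - c j)")
      case True
      then obtain j where j: "j \<in> I"
        and big: "e0 + d < L j \<or> 1 < tilt (min 1 d / (e0 + d)) j * (L j - c j)" by blast
      have "c j * (e0 + d - 1) \<le> var j"
        unfolding var_def using big_imp_large_deviation[OF j e1 big] c_pos[OF j]
        by (intro mult_left_mono) auto
      then have Y': "Y - var j \<le> (e0 - c j) * (e0 - c j + (d + c j) - 1)"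
        unfolding e0(3) by (simp add: algebra_simps)
      have "tail_bound (d + c j) (e0 - c j) \<le> two_point_sum.W (I - {j}) L c (d + c j)"
        using e1 c_le_1[OF j] d_pos Y' two_point_sum_remove(1)[OF less.prems(1) j]
        by (intro less.hyps smaller j) (auto simp: Y_remove[OF j])
      then have "tail_bound (d + c j) (e0 - c j) \<le> W0 j"
        using two_point_sum_remove(2)[OF less.prems(1) j] by simp
      then show ?thesis by (rule W_ge_remove[OF j e1 big])
    next
      case False
      show ?thesis
      proof (rule tail_bound_le_of_tiltable[OF e1 e0(3)])
        show "L i \<le> e0 + d" if "i \<in> I" for i using False that by force
        have "min 1 d / (e0 + d) < 1" using e1 d_pos by (simp add: divide_simps)
        then show "tiltable (min 1 d / (e0 + d))"
          unfolding tiltable_def using False e1 d_pos by force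
        fix j assume j: "j \<in> I"
        have "Y - var j \<le> e0 * (e0 + (d + c j) - 1)"
        proof -
          have "0 \<le> e0 * c j" using e1 c_pos[OF j] by simp
          then show ?thesis using var_pos[OF j] unfolding e0(3) by (simp add: algebra_simps)
        qed
        then have "tail_bound (d + c j) e0 \<le> two_point_sum.W (I - {j}) L c (d + c j)"
          using e1 c_pos[OF j] d_pos two_point_sum_remove(1)[OF less.prems(1) j]
          by (intro less.hyps smaller j) (auto simp: Y_remove[OF j])
        then show "tail_bound (d + c j) e0 \<le> W0 j"
          using two_point_sum_remove(2)[OF less.prems(1) j] by simp
      qed
    qed
    then show ?thesis
      using tail_bound_antimono[OF d_pos e0(1,2)] by simp
  qed
qed

text \<open>
  Without large variables the variance is at most \<open>card I * (e + d - 1)\<close>, because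
  \<open>c i * (L i - c i) \<le> e + d - 1\<close> as soon as \<open>e \<ge> 2\<close>. The removal of a variable decreases the
  cardinality by \<open>1\<close> and the size only by \<open>c j \<le> 1\<close>. A single variable is treated directly.
\<close>

lemma two_point_sum_tail_bound_card:
  fixes I :: "'i set"
  assumes "two_point_sum I L c d" "real (card I) \<le> e" "1 \<le> e + d"
  shows "tail_bound d e \<le> two_point_sum.W I L c d"
  using assms
proof (induction "card I" arbitrary: I d e rule: less_induct)
  case less
  interpret two_point_sum I L c d by fact
  consider "card I = 0" | "card I = 1" | "2 \<le> card I" by linarith
  then show ?case
  proof cases
    case 1
    then have I: "I = {}" using finite_I by simp
    have "W = 1" unfolding W_def below_def[abs_def] lam_def unfolding I using d_pos by simp
    then show ?thesis using tail_bound_le_1[of d e] d_pos less.prems(2) by simp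
  next
    case 2
    then obtain j where I: "I = {j}" by (auto simp: card_1_singleton_iff)
    have j: "j \<in> I" by (simp add: I)
    have W01: "W0 j = 1"
      unfolding W0_def below_def[abs_def] lam_def unfolding I using d_pos c_pos[OF j] by simp
    have "tail_bound d e \<le> tail_bound d 1"
      using d_pos less.prems(2) 2 by (intro tail_bound_antimono) auto
    also have "\<dots> = d / (1 + d)" by (simp add: tail_bound_def)
    also have "\<dots> \<le> W"
    proof (cases "d + c j \<le> L j")
      case True
      have "d / (1 + d) \<le> d / (c j + d)"
        using c_le_1[OF j] c_pos[OF j] d_pos by (intro divide_left_mono) auto
      also have "\<dots> = 1 - c j / (d + c j)"
        using c_pos[OF j] d_pos by (simp add: divide_simps)
      also have "\<dots> \<le> 1 - q j"
        unfolding q_def using True c_pos[OF j] d_pos by (intro diff_left_mono divide_left_mono) auto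
      also have "\<dots> \<le> W"
        using W_split[OF j] W1_nonneg[of j] q_range[OF j] W01 by simp
      finally show ?thesis .
    next
      case False
      then have "W1 j = 1"
        unfolding W1_def below_def[abs_def] lam_def unfolding I by simp
      then have "W = 1" using W_split[OF j] W01 by simp
      then show ?thesis using d_pos by simp
    qed
    finally show ?thesis .
  next
    case 3
    then have e2: "2 \<le> e" using less.prems(2) by linarith
    show ?thesis
    proof (cases "\<exists>j\<in>I. e + d < L j \<or> 1 < tilt (min 1 d / (e + d)) j * (L j - c j)")
      case True
      then obtain j where j: "j \<in> I"
        and big: "e + d < L j \<or> 1 < tilt (min 1 d / (e + d)) j * (L j - c j)" by blast
      have cd: "card (I - {j}) = card I - 1" using j finite_I by simp
      have "tail_bound (d + c j) (e - c j) \<le> two_point_sum.W (I - {j}) L c (d + c j)"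
      proof (rule less.hyps)
        show "card (I - {j}) < card I" using cd 3 by simp
        show "real (card (I - {j})) \<le> e - c j" using cd 3 less.prems(2) c_le_1[OF j] by simp
      qed (use less.prems two_point_sum_remove(1)[OF less.prems(1) j] in auto)
      then have "tail_bound (d + c j) (e - c j) \<le> W0 j"
        using two_point_sum_remove(2)[OF less.prems(1) j] by simp
      then show ?thesis using W_ge_remove[OF j _ big] e2 by simp
    next
      case False
      have "Y \<le> (\<Sum>i\<in>I. e + d - 1)"
        unfolding Y_def
      proof (rule sum_mono)
        fix i assume i: "i \<in> I"
        have "var i \<le> c i * (e + d - c i)"
          unfolding var_def using False i c_pos[OF i] by (intro mult_left_mono) force+
        also have "\<dots> \<le> e + d - 1"
        proof -
          have "0 \<le> (1 - c i) * (e + d - 1 - c i)"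
            using c_le_1[OF i] e2 d_pos by (intro mult_nonneg_nonneg) auto
          then show ?thesis by (simp add: algebra_simps)
        qed
        finally show "var i \<le> e + d - 1" .
      qed
      also have "\<dots> \<le> e * (e + d - 1)"
        using less.prems(2) e2 d_pos by (simp add: mult_right_mono)
      finally show ?thesis
        using less.prems(1,3) e2 by (intro two_point_sum_tail_bound) auto
    qed
  qed
qed

section \<open>Reduction of general variables to two-point variables\<close>

lemma texp_drop_null:
  assumes "finite Z" "Z \<inter> K = {}" "finite K" "\<And>i. i \<in> Z \<Longrightarrow> q i = 0"
  shows "texp q L (Z \<union> K) g = texp q L K g"
  using assms
proof (induction Z)
  case empty
  then show ?case by simp
next
  case (insert j Z)
  then have "texp q L (insert j (Z \<union> K)) g = texp q L (Z \<union> K) g"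
    by (subst texp_insert) auto
  then show ?case using insert by auto
qed

text \<open>
  The hypothesis says that the point \<open>(m, b)\<close> lies below all chords of \<open>\<phi>\<close> over \<open>m\<close>. Then every
  slope needed to stay below \<open>\<phi>\<close> on the left is at most every slope allowed on the right.
\<close>

lemma supporting_line:
  fixes \<phi> :: "real \<Rightarrow> real"
  assumes "0 < m"
    and two: "\<And>s l. 0 \<le> s \<Longrightarrow> s \<le> m \<Longrightarrow> m < l \<Longrightarrow>
      b \<le> (m - s) / (l - s) * \<phi> l + (1 - (m - s) / (l - s)) * \<phi> s"
  obtains a where "\<And>x. 0 \<le> x \<Longrightarrow> b + a * (x - m) \<le> \<phi> x"
proof -
  define h where "h = (\<lambda>s. (b - \<phi> s) / (m - s))"
  define a where "a = (SUP s\<in>{0..<m}. h s)"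
  have h_le: "h s \<le> (\<phi> l - b) / (l - m)" if "0 \<le> s" "s < m" "m < l" for s l
  proof -
    have "1 - (m - s) / (l - s) = (l - m) / (l - s)"
      using that by (simp add: divide_simps)
    then have "b \<le> ((m - s) * \<phi> l + (l - m) * \<phi> s) / (l - s)"
      using two[of s l] that by (simp add: add_divide_distrib)
    then have "b * (l - s) \<le> (m - s) * \<phi> l + (l - m) * \<phi> s"
      using that by (simp add: pos_le_divide_eq)
    then have "(b - \<phi> s) * (l - m) \<le> (\<phi> l - b) * (m - s)"
      by (simp add: algebra_simps)
    then show ?thesis
      using that by (simp add: h_def pos_divide_le_eq pos_le_divide_eq)
  qed
  have ne: "{0..<m} \<noteq> {}" using assms(1) by simp
  have bdd: "bdd_above (h ` {0..<m})"
    using h_le[of _ "m + 1"] by (intro bdd_aboveI2[where M = "(\<phi> (m + 1) - b) / (m + 1 - m)"]) auto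
  have "b + a * (x - m) \<le> \<phi> x" if "0 \<le> x" for x
  proof (cases x m rule: linorder_cases)
    case less
    then have "h x \<le> a" unfolding a_def using bdd that by (intro cSUP_upper) auto
    then have "b - \<phi> x \<le> a * (m - x)" using less by (simp add: h_def pos_divide_le_eq)
    then show ?thesis by (simp add: algebra_simps)
  next
    case equal
    then show ?thesis using two[of m "m + 1"] assms(1) by simp
  next
    case greater
    have "a \<le> (\<phi> x - b) / (x - m)"
      unfolding a_def using greater ne by (intro cSUP_least h_le) auto
    then show ?thesis using greater by (simp add: pos_le_divide_eq algebra_simps)
  qed
  then show ?thesis using that by blast
qed

context prob_space
begin

text \<open>
  The expectation of a supporting line at the mean is its value there. If the mean is \<open>0\<close>, there is no
  point to the left of it, but then \<open>X = 0\<close> almost surely.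
\<close>

lemma expectation_ge_of_two_point:
  fixes X :: "'a \<Rightarrow> real" and \<phi> :: "real \<Rightarrow> real"
  assumes X: "integrable M X" "\<And>\<omega>. \<omega> \<in> space M \<Longrightarrow> 0 \<le> X \<omega>"
    and \<phi>: "integrable M (\<lambda>\<omega>. \<phi> (X \<omega>))"
    and two: "\<And>s l. 0 \<le> s \<Longrightarrow> s \<le> expectation X \<Longrightarrow> expectation X < l \<Longrightarrow>
      b \<le> (expectation X - s) / (l - s) * \<phi> l + (1 - (expectation X - s) / (l - s)) * \<phi> s"
  shows "b \<le> expectation (\<lambda>\<omega>. \<phi> (X \<omega>))"
proof (cases "expectation X = 0")
  case True
  have "AE \<omega> in M. X \<omega> = 0"
    using integral_nonneg_eq_0_iff_AE[OF X(1)] X(2) True by auto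
  then have "expectation (\<lambda>\<omega>. \<phi> (X \<omega>)) = expectation (\<lambda>_. \<phi> 0)"
    using \<phi> by (intro integral_cong_AE) auto
  then show ?thesis using two[of 0 1] True by (simp add: prob_space)
next
  case False
  have "0 \<le> expectation X" using X(2) by (intro Bochner_Integration.integral_nonneg) auto
  then have "0 < expectation X" using False by simp
  then obtain a where a: "\<And>x. 0 \<le> x \<Longrightarrow> b + a * (x - expectation X) \<le> \<phi> x"
    using supporting_line[OF _ two] by metis
  have "b = expectation (\<lambda>\<omega>. b + a * (X \<omega> - expectation X))"
    using X(1) by (simp add: prob_space)
  also have "\<dots> \<le> expectation (\<lambda>\<omega>. \<phi> (X \<omega>))"
    using X \<phi> a by (intro integral_mono) auto
  finally show ?thesis .
qed

text \<open>
  Fubini's theorem for the product of the laws of \<open>X\<close> and \<open>S\<close>.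
\<close>

lemma expectation_indep_sum:
  fixes X S :: "'a \<Rightarrow> real" and g :: "real \<Rightarrow> real"
  assumes ind: "indep_var borel X borel S"
    and g: "g \<in> borel_measurable borel" "\<And>x. 0 \<le> g x" "\<And>x. g x \<le> 1"
  shows "expectation (\<lambda>\<omega>. g (X \<omega> + S \<omega>)) = expectation (\<lambda>\<omega>. expectation (\<lambda>\<omega>'. g (X \<omega> + S \<omega>')))"
    and "integrable M (\<lambda>\<omega>. expectation (\<lambda>\<omega>'. g (X \<omega> + S \<omega>')))"
proof -
  have rv [measurable]: "X \<in> borel_measurable M" "S \<in> borel_measurable M"
    using indep_var_rv1[OF ind] indep_var_rv2[OF ind] by auto
  note g(1) [measurable]
  let ?P = "distr M borel X" and ?Q = "distr M borel S"
  interpret P: prob_space ?P by (rule prob_space_distr) simp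
  interpret Q: prob_space ?Q by (rule prob_space_distr) simp
  interpret PQ: pair_prob_space ?P ?Q ..
  have dist: "distr M (borel \<Otimes>\<^sub>M borel) (\<lambda>\<omega>. (X \<omega>, S \<omega>)) = ?P \<Otimes>\<^sub>M ?Q"
    using ind indep_var_distribution_eq[of borel X borel S] by simp
  have gb: "norm (g x) \<le> 1" for x using g(2,3)[of x] by simp
  have int: "integrable (?P \<Otimes>\<^sub>M ?Q) (\<lambda>(x, s). g (x + s))"
    using gb by (intro PQ.integrable_const_bound[where B = 1]) (auto simp: split_beta')
  have in_eq: "(\<integral>s. g (x + s) \<partial>?Q) = expectation (\<lambda>\<omega>'. g (x + S \<omega>'))" for x
    by (rule integral_distr) measurable
  have "expectation (\<lambda>\<omega>. g (X \<omega> + S \<omega>)) =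
      (\<integral>z. (\<lambda>(x, s). g (x + s)) z \<partial>(distr M (borel \<Otimes>\<^sub>M borel) (\<lambda>\<omega>. (X \<omega>, S \<omega>))))"
    by (subst integral_distr) auto
  also have "\<dots> = (\<integral>z. (\<lambda>(x, s). g (x + s)) z \<partial>(?P \<Otimes>\<^sub>M ?Q))"
    by (simp only: dist)
  also have "\<dots> = (\<integral>x. (\<integral>s. g (x + s) \<partial>?Q) \<partial>?P)"
    using PQ.integral_fst'[OF int] by simp
  also have "\<dots> = (\<integral>x. expectation (\<lambda>\<omega>'. g (x + S \<omega>')) \<partial>?P)"
    by (simp only: in_eq)
  also have "\<dots> = expectation (\<lambda>\<omega>. expectation (\<lambda>\<omega>'. g (X \<omega> + S \<omega>')))"
    by (rule integral_distr) measurable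
  finally show "expectation (\<lambda>\<omega>. g (X \<omega> + S \<omega>)) = expectation (\<lambda>\<omega>. expectation (\<lambda>\<omega>'. g (X \<omega> + S \<omega>')))" .
  have "integrable ?P (\<lambda>x. \<integral>s. g (x + s) \<partial>?Q)"
    using PQ.integrable_fst'[OF int] by simp
  then have "integrable ?P (\<lambda>x. expectation (\<lambda>\<omega>'. g (x + S \<omega>')))"
    by (simp only: in_eq)
  then show "integrable M (\<lambda>\<omega>. expectation (\<lambda>\<omega>'. g (X \<omega> + S \<omega>')))"
    by (rule integrable_distr[rotated]) simp
qed

text \<open>
  The variables are replaced one at a time. In the induction step the replaced variable is integrated
  out, which turns \<open>g\<close> into a mixture of two of its translates; this is why \<open>g\<close> is an arbitrary
  measurable function with values in \<open>[0, 1]\<close>.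
\<close>

lemma two_point_reduction:
  fixes X :: "'i \<Rightarrow> 'a \<Rightarrow> real" and g :: "real \<Rightarrow> real"
  assumes "finite I" "indep_vars (\<lambda>_. borel) X I"
    and "\<And>i. i \<in> I \<Longrightarrow> integrable M (X i)"
    and "\<And>i \<omega>. i \<in> I \<Longrightarrow> \<omega> \<in> space M \<Longrightarrow> 0 \<le> X i \<omega>"
    and "g \<in> borel_measurable borel" "\<And>x. 0 \<le> g x" "\<And>x. g x \<le> 1"
    and "\<And>s l. (\<And>i. i \<in> I \<Longrightarrow> 0 \<le> s i \<and> s i \<le> expectation (X i) \<and> expectation (X i) < l i) \<Longrightarrow>
      b \<le> texp (\<lambda>i. (expectation (X i) - s i) / (l i - s i)) (\<lambda>i. l i - s i) I (\<lambda>t. g (t + sum s I))"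
  shows "b \<le> expectation (\<lambda>\<omega>. g (\<Sum>i\<in>I. X i \<omega>))"
  using assms
proof (induction I arbitrary: g)
  case empty
  then show ?case by (simp add: prob_space)
next
  case (insert j I)
  let ?S = "\<lambda>\<omega>. \<Sum>i\<in>I. X i \<omega>"
  let ?\<mu> = "\<lambda>i. expectation (X i)"
  note g = insert.prems(4-6)
  note g(1) [measurable]
  have rv [measurable]: "X i \<in> borel_measurable M" if "i \<in> insert j I" for i
    using insert.prems(2)[OF that] by auto
  have S [measurable]: "?S \<in> borel_measurable M" by (intro borel_measurable_sum rv) auto
  have ind: "indep_var borel (X j) borel ?S"
    using insert.hyps insert.prems(1) by (intro indep_vars_sum) auto
  have bounded_int: "integrable M (\<lambda>\<omega>. g (x + ?S \<omega>))" for x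
    using g(2,3) by (intro integrable_const_bound[where B = 1]) (auto simp: abs_le_iff intro: order_trans)
  let ?\<phi> = "\<lambda>x. expectation (\<lambda>\<omega>'. g (x + ?S \<omega>'))"
  have "b \<le> expectation (\<lambda>\<omega>. ?\<phi> (X j \<omega>))"
  proof (rule expectation_ge_of_two_point[of "X j" ?\<phi>])
    fix s0 l0 assume sl: "0 \<le> s0" "s0 \<le> ?\<mu> j" "?\<mu> j < l0"
    define q where "q = (?\<mu> j - s0) / (l0 - s0)"
    have q: "0 \<le> q" "q \<le> 1" using sl by (auto simp: q_def divide_simps)
    define h where "h = (\<lambda>t. q * g (l0 + t) + (1 - q) * g (s0 + t))"
    have "b \<le> expectation (\<lambda>\<omega>. h (?S \<omega>))"
    proof (rule insert.IH)
      show "indep_vars (\<lambda>_. borel) X I"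
        using insert.prems(1) by (rule indep_vars_subset) auto
      show "h \<in> borel_measurable borel" unfolding h_def by measurable
      show "0 \<le> h x" for x unfolding h_def using q g(2) by simp
      show "h x \<le> 1" for x
        unfolding h_def using q g(3) convex_bound_le[of "g (l0 + x)" 1 "g (s0 + x)" q "1 - q"] by simp
    next
      fix s l assume sl': "\<And>i. i \<in> I \<Longrightarrow> 0 \<le> s i \<and> s i \<le> ?\<mu> i \<and> ?\<mu> i < l i"
      define s' where "s' = s(j := s0)"
      define l' where "l' = l(j := l0)"
      have eqI: "s' i = s i" "l' i = l i" if "i \<in> I" for i
        using that insert.hyps by (auto simp: s'_def l'_def)
      have eqj: "s' j = s0" "l' j = l0" by (auto simp: s'_def l'_def)
      have sum_s: "sum s' I = sum s I" using eqI by (intro sum.cong) auto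
      let ?q' = "\<lambda>i. (?\<mu> i - s' i) / (l' i - s' i)" and ?L' = "\<lambda>i. l' i - s' i"
      have "b \<le> texp ?q' ?L' (insert j I) (\<lambda>t. g (t + sum s' (insert j I)))"
        using sl sl' eqI eqj by (intro insert.prems(7)) auto
      also have "\<dots> = q * texp ?q' ?L' I (\<lambda>t. g (l0 + (t + sum s I))) +
          (1 - q) * texp ?q' ?L' I (\<lambda>t. g (s0 + (t + sum s I)))"
        using insert.hyps by (simp add: texp_insert eqj sum_s q_def algebra_simps)
      also have "\<dots> = texp ?q' ?L' I (\<lambda>t. h (t + sum s I))"
        unfolding h_def texp_add texp_cmult by simp
      also have "\<dots> = texp (\<lambda>i. (?\<mu> i - s i) / (l i - s i)) (\<lambda>i. l i - s i) I (\<lambda>t. h (t + sum s I))"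
        using eqI by (intro texp_cong) auto
      finally show "b \<le> texp (\<lambda>i. (?\<mu> i - s i) / (l i - s i)) (\<lambda>i. l i - s i) I (\<lambda>t. h (t + sum s I))" .
    qed (use insert.prems in auto)
    also have "\<dots> = q * expectation (\<lambda>\<omega>. g (l0 + ?S \<omega>)) + (1 - q) * expectation (\<lambda>\<omega>. g (s0 + ?S \<omega>))"
      unfolding h_def using bounded_int by simp
    finally show "b \<le> (?\<mu> j - s0) / (l0 - s0) * expectation (\<lambda>\<omega>. g (l0 + ?S \<omega>)) +
        (1 - (?\<mu> j - s0) / (l0 - s0)) * expectation (\<lambda>\<omega>. g (s0 + ?S \<omega>))"
      unfolding q_def .
  next
    show "integrable M (\<lambda>\<omega>. expectation (\<lambda>\<omega>'. g (X j \<omega> + ?S \<omega>')))"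
      using expectation_indep_sum(2)[OF ind g] .
  qed (use insert.prems in auto)
  also have "\<dots> = expectation (\<lambda>\<omega>. g (X j \<omega> + ?S \<omega>))"
    using expectation_indep_sum(1)[OF ind g] by simp
  finally show ?case using insert.hyps by simp
qed

end

text \<open>
  Variables with \<open>c i = 0\<close>, which arise from one-point laws, vanish almost surely and are dropped.
\<close>

lemma two_point_family_bound:
  fixes I :: "'i set" and c L :: "'i \<Rightarrow> real"
  assumes "finite I" "0 < d" "real (card I) \<le> e" "1 \<le> e + d"
    and c: "\<And>i. i \<in> I \<Longrightarrow> 0 \<le> c i \<and> c i \<le> 1 \<and> c i < L i"
  shows "tail_bound d e \<le> texp (\<lambda>i. c i / L i) L I (\<lambda>t. if t < d + sum c I then 1 else 0)"
proof -
  define K where "K = {i\<in>I. c i \<noteq> 0}"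
  define Z where "Z = {i\<in>I. c i = 0}"
  have KZ: "I = Z \<union> K" "Z \<inter> K = {}" "finite Z" "finite K" "K \<subseteq> I"
    using assms(1) by (auto simp: K_def Z_def)
  interpret two_point_sum K L c d
    using assms(2) KZ c by unfold_locales (auto simp: K_def less_le)
  have "sum c I = sum c K" using assms(1) KZ(5) by (intro sum.mono_neutral_right) (auto simp: K_def)
  then have "below = (\<lambda>t. if t < d + sum c I then 1 else 0)"
    by (simp add: below_def[abs_def] lam_def)
  then have "texp (\<lambda>i. c i / L i) L I (\<lambda>t. if t < d + sum c I then 1 else 0) = texp (\<lambda>i. c i / L i) L (Z \<union> K) below"
    using KZ(1) by simp
  also have "\<dots> = texp (\<lambda>i. c i / L i) L K below"
    using KZ by (intro texp_drop_null) (auto simp: Z_def)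
  also have "\<dots> = W" by (simp add: W_def q_def[abs_def])
  finally show ?thesis
    using two_point_sum_tail_bound_card[OF two_point_sum_axioms _ assms(4)] assms(3)
      card_mono[OF assms(1) KZ(5)] by simp
qed

lemma prob_sum_less_ge_feige_bound:
  assumes "1 \<le> n" "0 < \<delta>" "admissible n M X"
  shows "feige_bound n \<delta> \<le> prob_sum_less n M X \<delta>"
proof -
  interpret prob_space M using assms(3) by (simp add: admissible_def)
  have ind: "indep_vars (\<lambda>_. borel) X {1..n}"
    and X: "\<And>i. i \<in> {1..n} \<Longrightarrow> integrable M (X i)"
      "\<And>i \<omega>. i \<in> {1..n} \<Longrightarrow> \<omega> \<in> space M \<Longrightarrow> 0 \<le> X i \<omega>"
      "\<And>i. i \<in> {1..n} \<Longrightarrow> expectation (X i) \<le> 1"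
    using assms(3) by (auto simp: admissible_def)
  let ?\<mu> = "\<lambda>i. expectation (X i)"
  have E: "expectation (\<lambda>\<omega>. \<Sum>i=1..n. X i \<omega>) = (\<Sum>i=1..n. ?\<mu> i)"
    using X(1) by (intro Bochner_Integration.integral_sum) auto
  define y where "y = (\<Sum>i=1..n. ?\<mu> i) + \<delta>"
  define g where "g = (\<lambda>t :: real. if t < y then 1 else 0 :: real)"
  have "tail_bound \<delta> (real n) \<le> expectation (\<lambda>\<omega>. g (\<Sum>i\<in>{1..n}. X i \<omega>))"
  proof (rule two_point_reduction[OF _ ind X(1,2)])
    fix s l :: "nat \<Rightarrow> real"
    assume sl: "\<And>i. i \<in> {1..n} \<Longrightarrow> 0 \<le> s i \<and> s i \<le> ?\<mu> i \<and> ?\<mu> i < l i"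
    have "tail_bound \<delta> (real n) \<le> texp (\<lambda>i. (?\<mu> i - s i) / (l i - s i)) (\<lambda>i. l i - s i) {1..n}
        (\<lambda>t. if t < \<delta> + (\<Sum>i=1..n. ?\<mu> i - s i) then 1 else 0)"
    proof (rule two_point_family_bound)
      fix i assume "i \<in> {1..n}"
      then show "0 \<le> ?\<mu> i - s i \<and> ?\<mu> i - s i \<le> 1 \<and> ?\<mu> i - s i < l i - s i"
        using sl[of i] X(3)[of i] by auto
    qed (use assms in auto)
    also have "(\<lambda>t. if t < \<delta> + (\<Sum>i=1..n. ?\<mu> i - s i) then 1 else 0) = (\<lambda>t. g (t + sum s {1..n}))"
      by (rule ext) (simp add: g_def y_def sum_subtractf algebra_simps)
    finally show "tail_bound \<delta> (real n) \<le> texp (\<lambda>i. (?\<mu> i - s i) / (l i - s i)) (\<lambda>i. l i - s i) {1..n}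
        (\<lambda>t. g (t + sum s {1..n}))" .
  qed (auto simp: g_def)
  also have "\<dots> = measure M {\<omega> \<in> space M. (\<Sum>i=1..n. X i \<omega>) < y}"
  proof -
    have [measurable]: "X i \<in> borel_measurable M" if "i \<in> {1..n}" for i
      using X(1)[OF that] by auto
    have [measurable]: "(\<lambda>\<omega>. \<Sum>i=1..n. X i \<omega>) \<in> borel_measurable M"
      by (intro borel_measurable_sum) auto
    have "expectation (\<lambda>\<omega>. g (\<Sum>i\<in>{1..n}. X i \<omega>)) =
        expectation (indicator {\<omega> \<in> space M. (\<Sum>i=1..n. X i \<omega>) < y})"
      by (intro Bochner_Integration.integral_cong) (auto simp: g_def indicator_def)
    then show ?thesis by simp
  qed
  finally show ?thesis
    using assms by (simp only: feige_bound_eq_tail_bound prob_sum_less_def E y_def)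
qed

section \<open>Optimality\<close>
definition two_point_pmf :: "real \<Rightarrow> real pmf" where
  "two_point_pmf L = map_pmf (\<lambda>b. if b then L else 0) (bernoulli_pmf (1 / L))"

lemma expectation_two_point_pmf:
  assumes "L \<ge> 1"
  shows "measure_pmf.expectation (two_point_pmf L) (\<lambda>x. x) = 1"
  using assms by (simp add: two_point_pmf_def integral_map_pmf)

lemma finite_set_two_point_pmf: "finite (set_pmf (two_point_pmf L))"
  by (auto simp: two_point_pmf_def intro: finite_imageI)

lemma set_two_point_pmf: "set_pmf (two_point_pmf L) \<subseteq> {0, L}"
  by (auto simp: two_point_pmf_def)

lemma prob_two_point_pmf_0:
  assumes "L \<ge> 1"
  shows "measure_pmf.prob (two_point_pmf L) {0} = 1 - 1 / L"
proof -
  have "(\<lambda>b. if b then L else 0) -` {0} = {False}"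
    using assms by (auto split: if_splits)
  thus ?thesis
    using assms unfolding two_point_pmf_def by (simp only: measure_map_pmf) (simp add: measure_pmf_single)
qed

text \<open>
  The law of \<open>n\<close> independent variables on \<open>{0, L}\<close> of mean \<open>1\<close>, as a measure on functions; the
  components outside \<open>{1..n}\<close> are \<open>0\<close>.
\<close>

definition two_point_product :: "nat \<Rightarrow> real \<Rightarrow> (nat \<Rightarrow> real) measure" where
  "two_point_product n L = measure_pmf (Pi_pmf {1..n} 0 (\<lambda>_. two_point_pmf L))"

lemma map_component_two_point:
  fixes i n :: nat
  assumes "i \<in> {1..n}"
  shows "map_pmf (\<lambda>f. f i) (Pi_pmf {1..n} 0 (\<lambda>_. two_point_pmf L)) = two_point_pmf L"
  using Pi_pmf_component[OF finite_atLeastAtMost, of i 1 n 0 "\<lambda>_. two_point_pmf L"] assms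
  by (simp only: if_True)

lemma two_point_component_values:
  fixes i n :: nat
  assumes "\<omega> \<in> set_pmf (Pi_pmf {1..n} 0 (\<lambda>_. two_point_pmf L))" "i \<in> {1..n}"
  shows "\<omega> i \<in> {0, L}"
proof -
  have "\<omega> i \<in> set_pmf (map_pmf (\<lambda>f. f i) (Pi_pmf {1..n} 0 (\<lambda>_. two_point_pmf L)))"
    using assms(1) by auto
  thus ?thesis
    unfolding map_component_two_point[OF assms(2), of L] using set_two_point_pmf[of L] by blast
qed

lemma component_expectation:
  assumes "i \<in> {1..n}" "L \<ge> 1"
  shows "integrable (two_point_product n L) (\<lambda>\<omega>. \<bar>\<omega> i\<bar>)"
    and "integrable (two_point_product n L) (\<lambda>\<omega>. \<omega> i)"
    and "(\<integral>\<omega>. \<bar>\<omega> i\<bar> \<partial>two_point_product n L) = 1"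
proof -
  let ?P = "Pi_pmf {1..n} 0 (\<lambda>_. two_point_pmf L)"
  have m: "map_pmf (\<lambda>f. f i) ?P = two_point_pmf L"
    by (rule map_component_two_point[OF assms(1)])
  have int: "integrable (measure_pmf (map_pmf (\<lambda>f. f i) ?P)) h" for h :: "real \<Rightarrow> real"
    unfolding m by (rule integrable_measure_pmf_finite[OF finite_set_two_point_pmf])
  show "integrable (two_point_product n L) (\<lambda>\<omega>. \<bar>\<omega> i\<bar>)"
    using int[of abs] by (simp add: two_point_product_def integrable_map_pmf_eq)
  show "integrable (two_point_product n L) (\<lambda>\<omega>. \<omega> i)"
    using int[of "\<lambda>x. x"] by (simp add: two_point_product_def integrable_map_pmf_eq)
  have "(\<integral>\<omega>. \<bar>\<omega> i\<bar> \<partial>two_point_product n L) = measure_pmf.expectation (map_pmf (\<lambda>f. f i) ?P) abs"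
    by (simp add: two_point_product_def integral_map_pmf)
  also have "\<dots> = measure_pmf.expectation (two_point_pmf L) abs"
    by (simp only: m)
  also have "\<dots> = measure_pmf.expectation (two_point_pmf L) (\<lambda>x. x)"
    using assms(2) set_two_point_pmf[of L]
    by (intro integral_cong_AE) (auto simp: AE_measure_pmf_iff)
  finally show "(\<integral>\<omega>. \<bar>\<omega> i\<bar> \<partial>two_point_product n L) = 1"
    using expectation_two_point_pmf[OF assms(2)] by simp
qed

text \<open>
  The absolute value makes the variables nonnegative on the whole space, as \<open>admissible\<close> demands,
  and changes them only on a null set.
\<close>

lemma admissible_two_point_product:
  assumes "L \<ge> 1"
  shows "admissible n (two_point_product n L) (\<lambda>i \<omega>. \<bar>\<omega> i\<bar>)"
proof -
  let ?P = "Pi_pmf {1..n} 0 (\<lambda>_. two_point_pmf L)"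
  have "prob_space.indep_vars (measure_pmf ?P) (\<lambda>_. borel) (\<lambda>i \<omega>. \<bar>\<omega> i\<bar>) {1..n}"
    by (rule prob_space.indep_vars_compose2[OF measure_pmf.prob_space_axioms
        indep_vars_Pi_pmf[OF finite_atLeastAtMost]]) simp
  thus ?thesis
    using component_expectation[OF _ assms, where n = n] measure_pmf.prob_space_axioms[of ?P]
    unfolding admissible_def two_point_product_def by auto
qed

text \<open>
  The sum is below \<open>n + \<delta>\<close> exactly if none of the variables has the value \<open>n + \<delta>\<close>.
\<close>

lemma prob_sum_less_two_point_product:
  assumes "\<delta> \<ge> 1"
  shows "prob_sum_less n (two_point_product n (real n + \<delta>)) (\<lambda>i \<omega>. \<bar>\<omega> i\<bar>) \<delta>
           = (1 - 1 / (real n + \<delta>)) ^ n"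
proof -
  let ?L = "real n + \<delta>"
  let ?P = "Pi_pmf {1..n} 0 (\<lambda>_. two_point_pmf ?L)"
  have L: "?L \<ge> 1" using assms by simp
  have mean: "(\<integral>\<omega>. (\<Sum>i=1..n. \<bar>\<omega> i\<bar>) \<partial>two_point_product n ?L) = real n"
    using component_expectation[OF _ L, where n = n] by (subst Bochner_Integration.integral_sum) auto
  have "measure_pmf.prob ?P {\<omega>. (\<Sum>i=1..n. \<bar>\<omega> i\<bar>) < ?L} = measure_pmf.prob ?P (Pi {1..n} (\<lambda>_. {0}))"
  proof (rule measure_pmf.finite_measure_eq_AE)
    show "AE \<omega> in measure_pmf ?P.
        (\<omega> \<in> {\<omega>. (\<Sum>i=1..n. \<bar>\<omega> i\<bar>) < ?L}) = (\<omega> \<in> Pi {1..n} (\<lambda>_. {0}))"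
    proof (rule AE_pmfI)
      fix \<omega> assume \<omega>: "\<omega> \<in> set_pmf ?P"
      show "(\<omega> \<in> {\<omega>. (\<Sum>i=1..n. \<bar>\<omega> i\<bar>) < ?L}) = (\<omega> \<in> Pi {1..n} (\<lambda>_. {0}))"
      proof
        assume *: "\<omega> \<in> {\<omega>. (\<Sum>i=1..n. \<bar>\<omega> i\<bar>) < ?L}"
        have "\<omega> i = 0" if i: "i \<in> {1..n}" for i
        proof (rule ccontr)
          assume "\<omega> i \<noteq> 0"
          hence "?L \<le> \<bar>\<omega> i\<bar>"
            using two_point_component_values[OF \<omega> i] by auto
          also have "\<dots> \<le> (\<Sum>i=1..n. \<bar>\<omega> i\<bar>)"
            by (rule member_le_sum) (use i in auto)
          finally show False using * by simp
        qed
        thus "\<omega> \<in> Pi {1..n} (\<lambda>_. {0})" by auto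
      qed (use assms in \<open>auto simp: Pi_def\<close>)
    qed
  qed simp_all
  also have "\<dots> = (\<Prod>x\<in>{1..n}. measure_pmf.prob (two_point_pmf ?L) {0})"
    by (rule measure_Pi_pmf_Pi) simp
  also have "\<dots> = (1 - 1 / ?L) ^ n"
    using prob_two_point_pmf_0[OF L] by simp
  finally show ?thesis
    using mean by (simp add: prob_sum_less_def two_point_product_def)
qed

lemma feige_bound_optimal:
  assumes "\<delta> \<ge> 1" "c > feige_bound n \<delta>"
  shows "\<not> (\<forall>(M :: (nat \<Rightarrow> real) measure) X. admissible n M X \<longrightarrow> prob_sum_less n M X \<delta> \<ge> c)"
proof
  assume "\<forall>(M :: (nat \<Rightarrow> real) measure) X. admissible n M X \<longrightarrow> prob_sum_less n M X \<delta> \<ge> c"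
  moreover have "admissible n (two_point_product n (real n + \<delta>)) (\<lambda>i \<omega>. \<bar>\<omega> i\<bar>)"
    by (rule admissible_two_point_product) (use assms in simp)
  ultimately have "c \<le> prob_sum_less n (two_point_product n (real n + \<delta>)) (\<lambda>i \<omega>. \<bar>\<omega> i\<bar>) \<delta>"
    by blast
  also have "\<dots> = feige_bound n \<delta>"
    using prob_sum_less_two_point_product[OF assms(1), of n] assms(1) by (simp add: feige_bound_def)
  finally show False using assms(2) by simp
qed

section \<open>The sharp inequality\<close>

theorem theorem1p1:
  fixes n :: nat
  assumes "n \<ge> 1"
  shows "(\<forall>\<delta>>0. \<forall>(M :: 'a measure) X. admissible n M X \<longrightarrow>
            prob_sum_less n M X \<delta> \<ge> feige_bound n \<delta>) \<and>
         (\<forall>\<delta>\<ge>1. \<forall>c>feige_bound n \<delta>.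
            \<not> (\<forall>(M :: (nat \<Rightarrow> real) measure) X. admissible n M X \<longrightarrow>
                 prob_sum_less n M X \<delta> \<ge> c))"
  using prob_sum_less_ge_feige_bound[OF assms] feige_bound_optimal by blast

end
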